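(* There is a diagonal instance $x\in\mathbb N$ whose universal sentence $G_x=\mathcal A\cdot\mathrm{rrep}(f_x)$ is a genuine fiction: $G_x$ has a fafi value, neither $\emptyset\vdash G_x$ nor $\emptyset\vdash\neg G_x$ is derivable in OGA, and the pedigree of $G_x$ is the singleton $\{G_x\}$. In particular, there is a step function $f$ such that the totality claim $\mathcal A\cdot\mathrm{rrep}(f)$ is a genuine fiction.
   Context: **Syntax.** Terms: $t::=v_i\mid\bot\mid\mathbf 0\mid\mathbf S t\mid t=t\mid\neg t\mid t\lor t\mid\lambda t\mid t\cdot t\mid\mathcal R\mid\mathcal A$ ($v_i$, $i\in\mathbb N$, de Bruijn variables; $\lambda$ is the only binder; application associates to the left). A term is well-formed (wf) if generated by this grammar. $\bot$ is a divergent constant, $\mathcal R$ the primitive recursor, $\mathcal A$ the universal quantifier. Abbreviations: $t\,\mathsf N$ is $t=t$; $t\,\mathsf B$ is $t\lor\neg t$; $t\ne u$ is $\neg(t=u)$; $t\land u$ is $\neg(\neg t\lor\neg u)$; $t\to u$ is $\neg t\lor u$; $\underline n=\mathbf S^n\mathbf 0$. $\uparrow$ shifts all free indices up by one; $b[t]$ is the $\beta$-instance substituting $t$ for the outermost bound variable of $b$; $[v\mapsto s]$ is capture-avoiding substitution for a free variable; $\mathrm{fv}$ is the set of free variables. **Head steps** $\triangleright$: $(\lambda b)\cdot t\triangleright b[t]$; $\mathcal R\cdot g\cdot h\cdot\mathbf 0\triangleright g$; $\mathcal R\cdot g\cdot h\cdot(\mathbf S\underline n)\triangleright h\cdot\underline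 n\cdot(\mathcal R\cdot g\cdot h\cdot\underline n)$; if $t\triangleright t'$ then $t\cdot u\triangleright t'\cdot u$. **Rules.** Judgments are $\Gamma\vdash c$, $\Gamma$ a finite set of wf terms, $c$ a wf term (all terms in rules are wf). A proof is a finite list of judgments each following from earlier entries by one rule; $\Gamma\vdash c$ is derivable if it occurs in a proof. Rules ("$\Rightarrow$" from premises to conclusion, "$\Leftrightarrow$" both directions; $\Gamma$ is the context of a judgment when none is shown): $\Gamma,c\vdash c$; $\Gamma\vdash c\Rightarrow\Gamma,a\vdash c$; $\Gamma\vdash a$ and $\Gamma,a\vdash c\Rightarrow\Gamma\vdash c$; $\Gamma\vdash c\Rightarrow[v\mapsto s]\Gamma\vdash[v\mapsto s]c$; $\vdash a\Leftrightarrow\ \vdash a=\underline1$; $\vdash\neg a\Leftrightarrow\ \vdash a=\underline0$; $\vdash\neg a,\ \vdash a\Rightarrow\ \vdash c$; $\vdash a\Leftrightarrow\ \vdash\neg\neg a$; $\vdash a\Rightarrow\ \vdash a\lor b$; $\vdash b\Rightarrow\ \vdash a\lor b$; $\vdash\neg a,\ \vdash\neg b\Rightarrow\ \vdash\neg(a\lor b)$; $\vdash a\lor b,\ \Gamma,a\vdash c,\ \Gamma,b\vdash c\Rightarrow\ \vdash c$; $\vdash\neg(a\lor b)\Rightarrow\ \vdash\neg a$; $\vdash\neg(a\lor b)\Rightarrow\ \vdash\neg b$; $\vdash a\,\mathsf N\Leftrightarrow\ \vdash a=a$; $\vdash a=b\Rightarrow\ \vdash b=a$; $\vdash a=b,\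 \vdash[v\mapsto a]p\Rightarrow\ \vdash[v\mapsto b]p$; $\vdash a\ne b\Rightarrow\ \vdash b\ne a$; $\vdash a\,\mathsf N,\ \vdash b\,\mathsf N\Rightarrow\ \vdash(a=b)\,\mathsf B$; $\vdash(a=b)\,\mathsf B\Rightarrow\ \vdash(a\,\mathsf N)\land(b\,\mathsf N)$; $\vdash\mathbf 0\,\mathsf N$; $\vdash a\,\mathsf N\Leftrightarrow\ \vdash(\mathbf S a)\,\mathsf N$; $\vdash a\,\mathsf N\Rightarrow\ \vdash\mathbf S a\ne\mathbf 0$; $\vdash a\ne b\Leftrightarrow\ \vdash\mathbf S a\ne\mathbf S b$; $\vdash\mathbf S a=\mathbf S b\Rightarrow\ \vdash a=b$; $\vdash\bot\,\mathsf N\Rightarrow\ \vdash p$; induction: $\vdash[v_i\mapsto\mathbf 0]c$, $\ v_i\,\mathsf N,c,\Gamma\vdash[v_i\mapsto\mathbf S v_i]c$, $\ \vdash a\,\mathsf N\Rightarrow\ \vdash[v_i\mapsto a]c$ if $v_i\notin\mathrm{fv}(\Gamma)$; conversion, for $c\triangleright c'$: $\vdash c'\Rightarrow\ \vdash c$; $\vdash c\Rightarrow\ \vdash c'$; $\vdash\neg c\Rightarrow\ \vdash\neg c'$; $\vdash c'\,\mathsf N\Rightarrow\ \vdash c=c'$; $\vdash m\,\mathsf N,\ \vdash(h\cdot m\cdot(\mathcal R\cdot g\cdot h\cdot m))\,\mathsf N\Rightarrow\ \vdash\mathcal R\cdot g\cdot h\cdot(\mathbf S m)=h\cdot m\cdot(\mathcal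 R\cdot g\cdot h\cdot m)$; $v_0\,\mathsf N,\uparrow\Gamma\vdash\uparrow f\cdot v_0\Rightarrow\Gamma\vdash\mathcal A\cdot f$; $\vdash\mathcal A\cdot f,\ \vdash a\,\mathsf N\Rightarrow\ \vdash f\cdot a$; $\vdash\neg(f\cdot a),\ \vdash a\,\mathsf N\Rightarrow\ \vdash\neg(\mathcal A\cdot f)$; $\Gamma\vdash\neg(\mathcal A\cdot f)$ and $v_0\,\mathsf N,\neg(\uparrow f\cdot v_0),\uparrow\Gamma\vdash\uparrow c\Rightarrow\Gamma\vdash c$. These are the rules of RGA. OGA has these and the rule ATI: $\Gamma\vdash\mathcal A\cdot(\lambda((\uparrow u\cdot v_0)\,\mathsf B))\Rightarrow\Gamma\vdash(\mathcal A\cdot u)\,\mathsf B$. Below $\vdash$ is OGA-derivability. **Search sentences.** A step function is a primitive recursive $f:\mathbb N^2\to\mathbb N$ presented by a primitive recursive definition (from zero, successor, projections by composition and primitive recursion); different definitions of the same function count as different step functions. Its search at $n$ hits at step $k$ if $f(n,k)\neq0$, and hits if it hits at some step. $\mathrm{cmp}(f)$ is the closed term obtained by compiling the definition into curried $\lambda$-terms: zero functions to $\lambda\cdots\lambda\,\mathbf 0$, successor to $\lambda\,\mathbf S v_0$, projections to $\lambda\cdots\lambda\,v_i$, composition to the corresponding applications, and $F(0,\vec x)=G(\vec x)$, $F(m+1,\vec x)=H(m,F(m,\vec x),\vec x)$ to the curried term sending $y,\vec x$ to $\mathcal R\cdot(\mathrm{cmp}(G)\cdot\vec x)\cdot(\lambda\lambda\,\mathrm{cmp}(H)\cdot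 v_1\cdot v_0\cdot\vec x)\cdot y$ (indices of $\vec x$ shifted under the $\lambda$s). Put $\mathrm{rrep}(f)=\lambda\,\neg(\mathcal A\cdot\lambda(\mathrm{cmp}(f)\cdot v_1\cdot v_0=\mathbf 0))$. $\mathrm{rrep}(f)\cdot\underline n$ expresses that the search of $f$ at $n$ hits, and the totality claim $\mathcal A\cdot\mathrm{rrep}(f)$ that it hits at every $n$. **Diagonal instances.** Fix a standard enumeration $(\varphi_x)$ of the unary partial recursive functions with primitive recursive step predicate, and a fixed primitive recursive definition of $d$, where $d(x,n)=1$ if the computation $\varphi_x(x)$ has not halted within $n$ steps and $d(x,n)=0$ otherwise. $f_x$ is the step function $f_x(n,k)=d(x,n)$, presented by composing the definition of $d$ with the constant $x$ (uniformly in $x$). A diagonal instance is an $x$ for which $\varphi_x(x)$ does not halt. **Fafi values and fictions.** A universal $\mathcal A\cdot u$ is certified if $\emptyset\vdash\mathcal A\cdot(\lambda((\uparrow u\cdot v_0)\,\mathsf B))$. For each certified $\mathcal A\cdot u$ there is an atom $x_{\mathcal A\cdot u}$. Values are elements of the free Boolean algebra on these atoms, with constants $\top$ and $\mathsf F$. Evaluation $\varphi\rightsquigarrow p$ ("$p$ is a value of $\varphi$") is the least relation with: $\varphi\rightsquigarrow\top$ if $\emptyset\vdash\varphi$; $\varphi\rightsquigarrow\mathsf F$ if $\emptyset\vdash\neg\varphi$; $\varphi\rightsquigarrow p$ implies $\neg\varphi\rightsquigarrow\neg p$; $\varphi\rightsquigarrow p$, $\psi\rightsquigarrow q$ imply $\varphi\lor\psi\rightsquigarrow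 p\lor q$; $\mathcal A\cdot u\rightsquigarrow x_{\mathcal A\cdot u}$ if $\mathcal A\cdot u$ is certified. A sentence $\varphi$ is a genuine fiction ($\mathit{fict}$) if it has a value and neither $\emptyset\vdash\varphi$ nor $\emptyset\vdash\neg\varphi$. The support of a value is the (finite) set of sentences $\mathcal A\cdot u$ on whose atoms it depends; its pedigree is the set of members of the support that are neither provable nor refutable in OGA; the pedigree of a sentence is the pedigree of its value. *)

theory Defs
  imports "HOL-Library.FSet"
begin

section \<open>Terms\<close>

datatype tm =
    Var nat
  | Bot
  | Zero
  | Succ tm
  | Eq tm tm  (infix \<open>\<doteq>\<close> 70)
  | Neg tm
  | Or tm tm
  | Lam tm
  | App tm tm  (infixl \<open>\<cdot>\<close> 80)
  | Rec
  | Forall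

abbreviation isN :: "tm \<Rightarrow> tm" where "isN t \<equiv> t \<doteq> t"
abbreviation isB :: "tm \<Rightarrow> tm" where "isB t \<equiv> Or t (Neg t)"
abbreviation And :: "tm \<Rightarrow> tm \<Rightarrow> tm" where "And t u \<equiv> Neg (Or (Neg t) (Neg u))"

definition num :: "nat \<Rightarrow> tm" where "num n = (Succ ^^ n) Zero"

text \<open>Free variables, as indices relative to the outside of the term.\<close>

primrec fv :: "tm \<Rightarrow> nat set" where
  "fv (Var i) = {i}"
| "fv Bot = {}"
| "fv Zero = {}"
| "fv (Succ t) = fv t"
| "fv (t \<doteq> u) = fv t \<union> fv u"
| "fv (Neg t) = fv t"
| "fv (Or t u) = fv t \<union> fv u"
| "fv (Lam b) = {i. Suc i \<in> fv b}"
| "fv (t \<cdot> u) = fv t \<union> fv u"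
| "fv Rec = {}"
| "fv Forall = {}"

definition sentence :: "tm \<Rightarrow> bool" where "sentence t \<longleftrightarrow> fv t = {}"

primrec lift :: "nat \<Rightarrow> tm \<Rightarrow> tm" where
  "lift k (Var i) = Var (if i < k then i else Suc i)"
| "lift k Bot = Bot"
| "lift k Zero = Zero"
| "lift k (Succ t) = Succ (lift k t)"
| "lift k (t \<doteq> u) = (lift k t \<doteq> lift k u)"
| "lift k (Neg t) = Neg (lift k t)"
| "lift k (Or t u) = Or (lift k t) (lift k u)"
| "lift k (Lam b) = Lam (lift (Suc k) b)"
| "lift k (t \<cdot> u) = lift k t \<cdot> lift k u"
| "lift k Rec = Rec"
| "lift k Forall = Forall"

abbreviation up :: "tm \<Rightarrow> tm"  (\<open>\<up>\<close>) where "\<up> \<equiv> lift 0"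

text \<open>
  \<open>subst i s t\<close> is \<open>[v\<^sub>i \<mapsto> s]t\<close>: the variable \<open>v\<^sub>i\<close> is replaced and all other free variables
  keep their index.  By contrast \<open>inst k s b\<close> removes the index \<open>k\<close>, so the indices
  above it drop by one; \<open>inst 0 s b\<close> is the \<open>\<beta>\<close>-instance \<open>b[s]\<close>.
\<close>

primrec subst :: "nat \<Rightarrow> tm \<Rightarrow> tm \<Rightarrow> tm" where
  "subst i s (Var j) = (if j = i then s else Var j)"
| "subst i s Bot = Bot"
| "subst i s Zero = Zero"
| "subst i s (Succ t) = Succ (subst i s t)"
| "subst i s (t \<doteq> u) = (subst i s t \<doteq> subst i s u)"
| "subst i s (Neg t) = Neg (subst i s t)"
| "subst i s (Or t u) = Or (subst i s t) (subst i s u)"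
| "subst i s (Lam b) = Lam (subst (Suc i) (\<up> s) b)"
| "subst i s (t \<cdot> u) = subst i s t \<cdot> subst i s u"
| "subst i s Rec = Rec"
| "subst i s Forall = Forall"

primrec inst :: "nat \<Rightarrow> tm \<Rightarrow> tm \<Rightarrow> tm" where
  "inst k s (Var j) = (if j = k then s else if k < j then Var (j - 1) else Var j)"
| "inst k s Bot = Bot"
| "inst k s Zero = Zero"
| "inst k s (Succ t) = Succ (inst k s t)"
| "inst k s (t \<doteq> u) = (inst k s t \<doteq> inst k s u)"
| "inst k s (Neg t) = Neg (inst k s t)"
| "inst k s (Or t u) = Or (inst k s t) (inst k s u)"
| "inst k s (Lam b) = Lam (inst (Suc k) (\<up> s) b)"
| "inst k s (t \<cdot> u) = inst k s t \<cdot> inst k s u"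
| "inst k s Rec = Rec"
| "inst k s Forall = Forall"

inductive head_step :: "tm \<Rightarrow> tm \<Rightarrow> bool"  (infix \<open>\<rhd>\<close> 50) where
  beta: "Lam b \<cdot> t \<rhd> inst 0 t b"
| rec_Zero: "Rec \<cdot> g \<cdot> h \<cdot> Zero \<rhd> g"
| rec_Succ: "Rec \<cdot> g \<cdot> h \<cdot> Succ (num n) \<rhd> h \<cdot> num n \<cdot> (Rec \<cdot> g \<cdot> h \<cdot> num n)"
| app: "t \<rhd> t' \<Longrightarrow> t \<cdot> u \<rhd> t' \<cdot> u"


section \<open>The systems RGA and OGA\<close>

type_synonym sequent = "tm fset \<times> tm"

abbreviation judg :: "tm fset \<Rightarrow> tm \<Rightarrow> sequent"  (infix \<open>\<turnstile>\<close> 45) where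
  "\<Gamma> \<turnstile> c \<equiv> (\<Gamma>, c)"

text \<open>
  \<open>rga_rule ps j\<close>: the sequent \<open>j\<close> follows from the premises \<open>ps\<close> by one rule.
  The rule relating \<open>isN a\<close> and \<open>a \<doteq> a\<close> has no clause, since these are the same term.
\<close>

inductive rga_rule :: "sequent list \<Rightarrow> sequent \<Rightarrow> bool" where
  hyp: "rga_rule [] (finsert c \<Gamma> \<turnstile> c)"
| weaken: "rga_rule [\<Gamma> \<turnstile> c] (finsert a \<Gamma> \<turnstile> c)"
| cut: "rga_rule [\<Gamma> \<turnstile> a, finsert a \<Gamma> \<turnstile> c] (\<Gamma> \<turnstile> c)"
| subst: "rga_rule [\<Gamma> \<turnstile> c] (subst i s |`| \<Gamma> \<turnstile> subst i s c)"

| true_eq_one: "rga_rule [\<Gamma> \<turnstile> a] (\<Gamma> \<turnstile> a \<doteq> num 1)"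
| eq_one_true: "rga_rule [\<Gamma> \<turnstile> a \<doteq> num 1] (\<Gamma> \<turnstile> a)"
| false_eq_zero: "rga_rule [\<Gamma> \<turnstile> Neg a] (\<Gamma> \<turnstile> a \<doteq> num 0)"
| eq_zero_false: "rga_rule [\<Gamma> \<turnstile> a \<doteq> num 0] (\<Gamma> \<turnstile> Neg a)"

| explode: "rga_rule [\<Gamma> \<turnstile> Neg a, \<Gamma> \<turnstile> a] (\<Gamma> \<turnstile> c)"
| NegNegI: "rga_rule [\<Gamma> \<turnstile> a] (\<Gamma> \<turnstile> Neg (Neg a))"
| NegNegE: "rga_rule [\<Gamma> \<turnstile> Neg (Neg a)] (\<Gamma> \<turnstile> a)"

| OrI1: "rga_rule [\<Gamma> \<turnstile> a] (\<Gamma> \<turnstile> Or a b)"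
| OrI2: "rga_rule [\<Gamma> \<turnstile> b] (\<Gamma> \<turnstile> Or a b)"
| NegOrI: "rga_rule [\<Gamma> \<turnstile> Neg a, \<Gamma> \<turnstile> Neg b] (\<Gamma> \<turnstile> Neg (Or a b))"
| OrE: "rga_rule [\<Gamma> \<turnstile> Or a b, finsert a \<Gamma> \<turnstile> c, finsert b \<Gamma> \<turnstile> c] (\<Gamma> \<turnstile> c)"
| NegOrE1: "rga_rule [\<Gamma> \<turnstile> Neg (Or a b)] (\<Gamma> \<turnstile> Neg a)"
| NegOrE2: "rga_rule [\<Gamma> \<turnstile> Neg (Or a b)] (\<Gamma> \<turnstile> Neg b)"

| eq_sym: "rga_rule [\<Gamma> \<turnstile> a \<doteq> b] (\<Gamma> \<turnstile> b \<doteq> a)"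
| eq_subst: "rga_rule [\<Gamma> \<turnstile> a \<doteq> b, \<Gamma> \<turnstile> subst i a p] (\<Gamma> \<turnstile> subst i b p)"
| neq_sym: "rga_rule [\<Gamma> \<turnstile> Neg (a \<doteq> b)] (\<Gamma> \<turnstile> Neg (b \<doteq> a))"
| eq_isB: "rga_rule [\<Gamma> \<turnstile> isN a, \<Gamma> \<turnstile> isN b] (\<Gamma> \<turnstile> isB (a \<doteq> b))"
| eq_isB_isN: "rga_rule [\<Gamma> \<turnstile> isB (a \<doteq> b)] (\<Gamma> \<turnstile> And (isN a) (isN b))"

| Zero_isN: "rga_rule [] (\<Gamma> \<turnstile> isN Zero)"
| Succ_isN: "rga_rule [\<Gamma> \<turnstile> isN a] (\<Gamma> \<turnstile> isN (Succ a))"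
| isN_Succ: "rga_rule [\<Gamma> \<turnstile> isN (Succ a)] (\<Gamma> \<turnstile> isN a)"
| Succ_neq_Zero: "rga_rule [\<Gamma> \<turnstile> isN a] (\<Gamma> \<turnstile> Neg (Succ a \<doteq> Zero))"
| Succ_neqI: "rga_rule [\<Gamma> \<turnstile> Neg (a \<doteq> b)] (\<Gamma> \<turnstile> Neg (Succ a \<doteq> Succ b))"
| Succ_neqE: "rga_rule [\<Gamma> \<turnstile> Neg (Succ a \<doteq> Succ b)] (\<Gamma> \<turnstile> Neg (a \<doteq> b))"
| Succ_eqE: "rga_rule [\<Gamma> \<turnstile> Succ a \<doteq> Succ b] (\<Gamma> \<turnstile> a \<doteq> b)"
| Bot_isN: "rga_rule [\<Gamma> \<turnstile> isN Bot] (\<Gamma> \<turnstile> p)"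

| induction: "\<forall>t. t |\<in>| \<Gamma> \<longrightarrow> i \<notin> fv t \<Longrightarrow>
    rga_rule [\<Gamma> \<turnstile> subst i Zero c,
              finsert (isN (Var i)) (finsert c \<Gamma>) \<turnstile> subst i (Succ (Var i)) c,
              \<Gamma> \<turnstile> isN a]
             (\<Gamma> \<turnstile> subst i a c)"

| expand: "c \<rhd> c' \<Longrightarrow> rga_rule [\<Gamma> \<turnstile> c'] (\<Gamma> \<turnstile> c)"
| reduce: "c \<rhd> c' \<Longrightarrow> rga_rule [\<Gamma> \<turnstile> c] (\<Gamma> \<turnstile> c')"
| Neg_reduce: "c \<rhd> c' \<Longrightarrow> rga_rule [\<Gamma> \<turnstile> Neg c] (\<Gamma> \<turnstile> Neg c')"
| step_eq: "c \<rhd> c' \<Longrightarrow> rga_rule [\<Gamma> \<turnstile> isN c'] (\<Gamma> \<turnstile> c \<doteq> c')"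
| rec_eq: "rga_rule [\<Gamma> \<turnstile> isN m, \<Gamma> \<turnstile> isN (h \<cdot> m \<cdot> (Rec \<cdot> g \<cdot> h \<cdot> m))]
                    (\<Gamma> \<turnstile> Rec \<cdot> g \<cdot> h \<cdot> Succ m \<doteq> h \<cdot> m \<cdot> (Rec \<cdot> g \<cdot> h \<cdot> m))"

| ForallI: "rga_rule [finsert (isN (Var 0)) (\<up> |`| \<Gamma>) \<turnstile> \<up> f \<cdot> Var 0] (\<Gamma> \<turnstile> Forall \<cdot> f)"
| ForallE: "rga_rule [\<Gamma> \<turnstile> Forall \<cdot> f, \<Gamma> \<turnstile> isN a] (\<Gamma> \<turnstile> f \<cdot> a)"
| NegForallI: "rga_rule [\<Gamma> \<turnstile> Neg (f \<cdot> a), \<Gamma> \<turnstile> isN a] (\<Gamma> \<turnstile> Neg (Forall \<cdot> f))"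
| NegForallE: "rga_rule [\<Gamma> \<turnstile> Neg (Forall \<cdot> f),
                         finsert (isN (Var 0)) (finsert (Neg (\<up> f \<cdot> Var 0)) (\<up> |`| \<Gamma>)) \<turnstile> \<up> c]
                        (\<Gamma> \<turnstile> c)"

inductive oga_rule :: "sequent list \<Rightarrow> sequent \<Rightarrow> bool" where
  rga: "rga_rule ps j \<Longrightarrow> oga_rule ps j"
| ATI: "oga_rule [\<Gamma> \<turnstile> Forall \<cdot> Lam (isB (\<up> u \<cdot> Var 0))] (\<Gamma> \<turnstile> isB (Forall \<cdot> u))"

definition oga_proof :: "sequent list \<Rightarrow> bool" where
  "oga_proof js \<longleftrightarrow> (\<forall>i<length js. \<exists>ps. set ps \<subseteq> set (take i js) \<and> oga_rule ps (js ! i))"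

definition oga_derivable :: "sequent \<Rightarrow> bool" where
  "oga_derivable j \<longleftrightarrow> (\<exists>js. oga_proof js \<and> j \<in> set js)"

definition provable :: "tm \<Rightarrow> bool" where "provable c \<longleftrightarrow> oga_derivable ({||} \<turnstile> c)"
definition refutable :: "tm \<Rightarrow> bool" where "refutable c \<longleftrightarrow> provable (Neg c)"


section \<open>Primitive recursive definitions and their compilation\<close>

text \<open>
  \<open>PComp n f gs\<close> records the arity \<open>n\<close> of the composite, which is not determined by \<open>gs\<close>
  when \<open>gs\<close> is empty.  Functions of arity 0 are allowed.
\<close>

datatype prdef =
    PZero nat
  | PSucc
  | PProj nat nat
  | PComp nat prdef "prdef list"
  | PRec prdef prdef

primrec pr_arity :: "prdef \<Rightarrow> nat" where
  "pr_arity (PZero n) = n"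
| "pr_arity PSucc = 1"
| "pr_arity (PProj n i) = n"
| "pr_arity (PComp n f gs) = n"
| "pr_arity (PRec g h) = Suc (pr_arity g)"

fun pr_wf :: "prdef \<Rightarrow> bool" where
  "pr_wf (PZero n) \<longleftrightarrow> True"
| "pr_wf PSucc \<longleftrightarrow> True"
| "pr_wf (PProj n i) \<longleftrightarrow> i < n"
| "pr_wf (PComp n f gs) \<longleftrightarrow>
     pr_wf f \<and> pr_arity f = length gs \<and> (\<forall>g\<in>set gs. pr_wf g \<and> pr_arity g = n)"
| "pr_wf (PRec g h) \<longleftrightarrow> pr_wf g \<and> pr_wf h \<and> pr_arity h = pr_arity g + 2"

fun pr_eval :: "prdef \<Rightarrow> nat list \<Rightarrow> nat" where
  "pr_eval (PZero n) xs = 0"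
| "pr_eval PSucc xs = Suc (hd xs)"
| "pr_eval (PProj n i) xs = xs ! i"
| "pr_eval (PComp n f gs) xs = pr_eval f (map (\<lambda>g. pr_eval g xs) gs)"
| "pr_eval (PRec g h) xs =
     rec_nat (pr_eval g (tl xs)) (\<lambda>m r. pr_eval h (m # r # tl xs)) (hd xs)"

definition lams :: "nat \<Rightarrow> tm \<Rightarrow> tm" where "lams n t = (Lam ^^ n) t"
definition apps :: "tm \<Rightarrow> tm list \<Rightarrow> tm" where "apps t ts = foldl (\<cdot>) t ts"

text \<open>
  The arguments of an \<open>n\<close>-fold abstraction, first argument first, as seen from below
  \<open>s\<close> further binders: \<open>v\<^bsub>s+n-1\<^esub>, \<dots>, v\<^bsub>s\<^esub>\<close>.
\<close>

definition args :: "nat \<Rightarrow> nat \<Rightarrow> tm list" where "args s n = map Var (rev [s..<s + n])"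

fun cmp :: "prdef \<Rightarrow> tm" where
  "cmp (PZero n) = lams n Zero"
| "cmp PSucc = Lam (Succ (Var 0))"
| "cmp (PProj n i) = lams n (args 0 n ! i)"
| "cmp (PComp n f gs) = lams n (apps (cmp f) (map (\<lambda>g. apps (cmp g) (args 0 n)) gs))"
| "cmp (PRec g h) =
     (let k = pr_arity g in
      lams (Suc k)
        (Rec \<cdot> apps (cmp g) (args 0 k)
             \<cdot> Lam (Lam (apps (cmp h \<cdot> Var 1 \<cdot> Var 0) (args 2 k)))
             \<cdot> Var k))"

text \<open>
  A step function is a binary primitive recursive definition; definitions, not the functions
  they compute, are what is compiled.
\<close>

definition step_function :: "prdef \<Rightarrow> bool" where
  "step_function f \<longleftrightarrow> pr_wf f \<and> pr_arity f = 2"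

definition rrep :: "prdef \<Rightarrow> tm" where
  "rrep f = Lam (Neg (Forall \<cdot> Lam (cmp f \<cdot> Var 1 \<cdot> Var 0 \<doteq> Zero)))"

definition totality_claim :: "prdef \<Rightarrow> tm" where
  "totality_claim f = Forall \<cdot> rrep f"


section \<open>Partial recursive functions and diagonal instances\<close>

text \<open>
  \<open>partrec n F\<close>: the restriction of \<open>F\<close> to lists of length \<open>n\<close> is an \<open>n\<close>-ary partial recursive
  function, with \<open>None\<close> for divergence.  Values on lists of other lengths are irrelevant.
\<close>

inductive partrec :: "nat \<Rightarrow> (nat list \<Rightarrow> nat option) \<Rightarrow> bool" where
  zero: "partrec n (\<lambda>xs. Some 0)"
| succ: "partrec 1 (\<lambda>xs. Some (Suc (hd xs)))"
| proj: "i < n \<Longrightarrow> partrec n (\<lambda>xs. Some (xs ! i))"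
| comp: "partrec (length Gs) F \<Longrightarrow> (\<forall>G\<in>set Gs. partrec n G) \<Longrightarrow>
    partrec n (\<lambda>xs. if \<forall>G\<in>set Gs. G xs \<noteq> None then F (map (\<lambda>G. the (G xs)) Gs) else None)"
| prec: "partrec n G \<Longrightarrow> partrec (n + 2) H \<Longrightarrow>
    partrec (Suc n)
      (\<lambda>xs. rec_nat (G (tl xs)) (\<lambda>m r. Option.bind r (\<lambda>v. H (m # v # tl xs))) (hd xs))"
| mu: "partrec (Suc n) F \<Longrightarrow>
    partrec n (\<lambda>xs. if \<exists>z. F (z # xs) = Some 0 \<and> (\<forall>y<z. F (y # xs) \<noteq> None)
                    then Some (LEAST z. F (z # xs) = Some 0) else None)"

definition partrec1 :: "(nat \<Rightarrow> nat option) \<Rightarrow> bool" where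
  "partrec1 \<psi> \<longleftrightarrow> (\<exists>F. partrec 1 F \<and> (\<forall>x. \<psi> x = F [x]))"

definition partrec2 :: "(nat \<Rightarrow> nat \<Rightarrow> nat option) \<Rightarrow> bool" where
  "partrec2 \<psi> \<longleftrightarrow> (\<exists>F. partrec 2 F \<and> (\<forall>x y. \<psi> x y = F [x, y]))"

text \<open>
  A standard (acceptable) enumeration: it lists exactly the unary partial recursive functions,
  its universal function is partial recursive, and the s-m-n property holds.
\<close>

definition standard_enumeration :: "(nat \<Rightarrow> nat \<Rightarrow> nat option) \<Rightarrow> bool" where
  "standard_enumeration \<phi> \<longleftrightarrow>
     range \<phi> = {\<psi>. partrec1 \<psi>} \<and>
     partrec2 \<phi> \<and>
     (\<forall>\<psi>. partrec2 \<psi> \<longrightarrow> (\<exists>s. partrec1 (\<lambda>x. Some (s x)) \<and> (\<forall>x. \<phi> (s x) = \<psi> x)))"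

text \<open>\<open>halts x y n\<close>: the computation of \<open>\<phi>\<^sub>x(y)\<close> has halted within \<open>n\<close> steps.\<close>

definition pr_step_predicate ::
    "(nat \<Rightarrow> nat \<Rightarrow> nat option) \<Rightarrow> (nat \<Rightarrow> nat \<Rightarrow> nat \<Rightarrow> bool) \<Rightarrow> bool" where
  "pr_step_predicate \<phi> halts \<longleftrightarrow>
     (\<exists>T. pr_wf T \<and> pr_arity T = 3 \<and>
          (\<forall>x y n. pr_eval T [x, y, n] = (if halts x y n then 1 else 0))) \<and>
     (\<forall>x y m n. m \<le> n \<longrightarrow> halts x y m \<longrightarrow> halts x y n) \<and>
     (\<forall>x y. \<phi> x y \<noteq> None \<longleftrightarrow> (\<exists>n. halts x y n))"

definition presents_d :: "(nat \<Rightarrow> nat \<Rightarrow> nat \<Rightarrow> bool) \<Rightarrow> prdef \<Rightarrow> bool" where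
  "presents_d halts D \<longleftrightarrow>
     pr_wf D \<and> pr_arity D = 2 \<and>
     (\<forall>x n. pr_eval D [x, n] = (if halts x x n then 0 else 1))"

primrec pr_const :: "nat \<Rightarrow> nat \<Rightarrow> prdef" where
  "pr_const n 0 = PZero n"
| "pr_const n (Suc x) = PComp n PSucc [pr_const n x]"

definition diag_step :: "prdef \<Rightarrow> nat \<Rightarrow> prdef" where
  "diag_step D x = PComp 2 D [pr_const 2 x, PProj 2 0]"

definition diagonal_instance :: "(nat \<Rightarrow> nat \<Rightarrow> nat option) \<Rightarrow> nat \<Rightarrow> bool" where
  "diagonal_instance \<phi> x \<longleftrightarrow> \<phi> x x = None"


section \<open>Free Boolean algebras\<close>

text \<open>
  The free Boolean algebra on \<open>'a\<close> in its usual set representation: the algebra of sets of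
  valuations (a valuation being the set of atoms it makes true) that is generated by the sets
  of valuations making a given atom true.  Freeness is proved below as \<open>fba_free\<close>.
\<close>

inductive_set fba_carrier :: "'a set set set" where
  gen: "{M. a \<in> M} \<in> fba_carrier"
| UNIV: "UNIV \<in> fba_carrier"
| compl: "A \<in> fba_carrier \<Longrightarrow> - A \<in> fba_carrier"
| union: "A \<in> fba_carrier \<Longrightarrow> B \<in> fba_carrier \<Longrightarrow> A \<union> B \<in> fba_carrier"

lemma fba_carrier_inter: "A \<in> fba_carrier \<Longrightarrow> B \<in> fba_carrier \<Longrightarrow> A \<inter> B \<in> fba_carrier"
  using fba_carrier.compl[OF fba_carrier.union[OF fba_carrier.compl fba_carrier.compl, of A B]]
  by simp

typedef 'a fba = "fba_carrier :: 'a set set set"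
  morphisms models Abs_fba
  using fba_carrier.UNIV by blast

setup_lifting type_definition_fba

lift_definition atom :: "'a \<Rightarrow> 'a fba" is "\<lambda>a. {M. a \<in> M}"
  by (rule fba_carrier.gen)

instantiation fba :: (type) boolean_algebra
begin
lift_definition top_fba :: "'a fba" is UNIV by (rule fba_carrier.UNIV)
lift_definition bot_fba :: "'a fba" is "{}" using fba_carrier.compl[OF fba_carrier.UNIV] by simp
lift_definition uminus_fba :: "'a fba \<Rightarrow> 'a fba" is uminus by (rule fba_carrier.compl)
lift_definition sup_fba :: "'a fba \<Rightarrow> 'a fba \<Rightarrow> 'a fba" is "(\<union>)" by (rule fba_carrier.union)
lift_definition inf_fba :: "'a fba \<Rightarrow> 'a fba \<Rightarrow> 'a fba" is "(\<inter>)" by (rule fba_carrier_inter)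
lift_definition minus_fba :: "'a fba \<Rightarrow> 'a fba \<Rightarrow> 'a fba" is "(-)"
  by (metis Diff_eq fba_carrier.compl fba_carrier_inter)
lift_definition less_eq_fba :: "'a fba \<Rightarrow> 'a fba \<Rightarrow> bool" is "(\<subseteq>)" .
lift_definition less_fba :: "'a fba \<Rightarrow> 'a fba \<Rightarrow> bool" is "(\<subset>)" .
instance by standard (transfer; auto)+
end

inductive fba_ext :: "('a \<Rightarrow> 'b::boolean_algebra) \<Rightarrow> 'a set set \<Rightarrow> 'b \<Rightarrow> bool" for f where
  gen: "fba_ext f {M. a \<in> M} (f a)"
| UNIV: "fba_ext f UNIV top"
| compl: "fba_ext f A b \<Longrightarrow> fba_ext f (- A) (- b)"
| union: "fba_ext f A b \<Longrightarrow> fba_ext f B c \<Longrightarrow> fba_ext f (A \<union> B) (sup b c)"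

primrec minterm :: "('a \<Rightarrow> 'b::boolean_algebra) \<Rightarrow> 'a list \<Rightarrow> 'a set \<Rightarrow> 'b" where
  "minterm f [] M = top"
| "minterm f (a # as) M = inf (if a \<in> M then f a else - f a) (minterm f as M)"

lemma minterm_cong: "\<forall>a\<in>set as. a \<in> M \<longleftrightarrow> a \<in> N \<Longrightarrow> minterm f as M = minterm f as N"
  by (induction as) auto

lemma minterm_le:
  "a \<in> set as \<Longrightarrow> minterm f as M \<le> (if a \<in> M then f a else - f a)"
proof (induction as)
  case (Cons b as)
  then show ?case by (cases "a = b") (simp_all add: le_infI2)
qed simp

lemma minterm_separates:
  assumes "distinct as" "\<And>M. inf (minterm f as M) b = inf (minterm f as M) c"
  shows "b = c"
  using assms
proof (induction as)
  case (Cons a as)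
  have "inf (minterm f as M) b = inf (minterm f as M) c" for M
  proof -
    have *: "minterm f as (insert a M) = minterm f as M" "minterm f as (M - {a}) = minterm f as M"
      using Cons.prems(1) by (auto intro!: minterm_cong)
    have 1: "inf (f a) (inf (minterm f as M) b) = inf (f a) (inf (minterm f as M) c)"
      using Cons.prems(2)[of "insert a M"] by (simp add: * inf_assoc)
    have 2: "inf (- f a) (inf (minterm f as M) b) = inf (- f a) (inf (minterm f as M) c)"
      using Cons.prems(2)[of "M - {a}"] by (simp add: * inf_assoc)
    have "x = sup (inf (f a) x) (inf (- f a) x)" for x
      by (subst inf_sup_distrib2[symmetric]) simp
    from this[of "inf (minterm f as M) b"] this[of "inf (minterm f as M) c"]
    show ?thesis unfolding 1 2 by (rule trans[OF _ sym])
  qed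
  moreover have "distinct as" using Cons.prems(1) by simp
  ultimately show ?case using Cons.IH by blast
qed simp

lemma fba_ext_minterm:
  assumes "fba_ext f A b"
  shows "\<exists>X. finite X \<and> (\<forall>as M. X \<subseteq> set as \<longrightarrow>
           inf (minterm f as M) b = (if M \<in> A then minterm f as M else bot))"
  using assms
proof induction
  case (gen a)
  show ?case
  proof (intro exI[of _ "{a}"] conjI allI impI)
    fix as M assume "{a} \<subseteq> set as"
    then have "minterm f as M \<le> (if a \<in> M then f a else - f a)" by (intro minterm_le) auto
    then show "inf (minterm f as M) (f a) = (if M \<in> {M. a \<in> M} then minterm f as M else bot)"
      by (auto simp: inf.absorb1 inf_shunt split: if_splits)
  qed auto
next
  case UNIV
  show ?case by (auto intro!: exI[of _ "{}"])
next
  case (compl A b)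
  have *: "inf m (- b) = (if P then bot else m)" if "inf m b = (if P then m else bot)" for m P
    using that by (metis inf.absorb_iff1 inf_shunt double_compl)
  from compl.IH obtain X where X: "finite X" "\<And>as M. X \<subseteq> set as \<Longrightarrow>
      inf (minterm f as M) b = (if M \<in> A then minterm f as M else bot)" by blast
  show ?case using X(1) *[OF X(2)] by (intro exI[of _ X]) auto
next
  case (union A b B c)
  then obtain X Y where "finite X" "finite Y"
    "\<And>as M. X \<subseteq> set as \<Longrightarrow> inf (minterm f as M) b = (if M \<in> A then minterm f as M else bot)"
    "\<And>as M. Y \<subseteq> set as \<Longrightarrow> inf (minterm f as M) c = (if M \<in> B then minterm f as M else bot)"
    by metis
  then show ?case by (intro exI[of _ "X \<union> Y"]) (auto simp: inf_sup_distrib1)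
qed

lemma fba_ext_unique:
  assumes "fba_ext f A b" "fba_ext f A c"
  shows "b = c"
proof -
  obtain X Y where X: "finite X"
    "\<And>as M. X \<subseteq> set as \<Longrightarrow> inf (minterm f as M) b = (if M \<in> A then minterm f as M else bot)"
    and Y: "finite Y"
    "\<And>as M. Y \<subseteq> set as \<Longrightarrow> inf (minterm f as M) c = (if M \<in> A then minterm f as M else bot)"
    using fba_ext_minterm[OF assms(1)] fba_ext_minterm[OF assms(2)] by metis
  have "finite (X \<union> Y)" using X(1) Y(1) by simp
  from finite_distinct_list[OF this] obtain as where as: "set as = X \<union> Y" "distinct as" by blast
  have "inf (minterm f as M) b = inf (minterm f as M) c" for M
    by (rule trans[OF X(2) Y(2)[symmetric]]) (simp_all add: as)
  then show ?thesis by (rule minterm_separates[OF as(2)])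
qed

lemma fba_ext_exists: "A \<in> fba_carrier \<Longrightarrow> \<exists>b. fba_ext f A b"
  by (induction rule: fba_carrier.induct) (blast intro: fba_ext.intros)+

theorem fba_free:
  fixes f :: "'a \<Rightarrow> 'b::boolean_algebra"
  shows "\<exists>!h. (\<forall>a. h (atom a) = f a) \<and> h top = top \<and>
              (\<forall>p. h (- p) = - h p) \<and> (\<forall>p q. h (sup p q) = sup (h p) (h q))"
proof -
  define h where "h p = (THE b. fba_ext f (models p) b)" for p
  have h_ext: "fba_ext f (models p) (h p)" for p
  proof -
    obtain b where b: "fba_ext f (models p) b" using fba_ext_exists[OF models] by blast
    show ?thesis unfolding h_def by (rule theI[where a = b]) (fact b, rule fba_ext_unique[OF _ b])
  qed
  have h: "h p = b" if "fba_ext f (models p) b" for p b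
    using fba_ext_unique[OF h_ext that] .
  show ?thesis
  proof (intro ex1I[of _ h] conjI allI)
    show "h (atom a) = f a" for a by (intro h) (simp add: atom.rep_eq fba_ext.gen)
    show "h top = top" by (intro h) (simp add: top_fba.rep_eq fba_ext.UNIV)
    show "h (- p) = - h p" for p
      by (intro h) (simp add: uminus_fba.rep_eq fba_ext.compl h_ext)
    show "h (sup p q) = sup (h p) (h q)" for p q
      by (intro h) (simp add: sup_fba.rep_eq fba_ext.union h_ext)
  next
    fix g assume g: "(\<forall>a. g (atom a) = f a) \<and> g top = top \<and>
      (\<forall>p. g (- p) = - g p) \<and> (\<forall>p q. g (sup p q) = sup (g p) (g q))"
    have "A \<in> fba_carrier \<Longrightarrow> fba_ext f A (g (Abs_fba A))" for A
    proof (induction rule: fba_carrier.induct)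
      case (gen a) then show ?case using g fba_ext.gen[of f a] by (simp add: atom_def)
    next
      case UNIV then show ?case using g fba_ext.UNIV[of f] by (simp add: top_fba_def)
    next
      case (compl A)
      then have "Abs_fba (- A) = - Abs_fba A"
        by (metis Abs_fba_inverse models_inverse uminus_fba.rep_eq)
      then show ?case using g compl fba_ext.compl[of f A] by simp
    next
      case (union A B)
      then have "Abs_fba (A \<union> B) = sup (Abs_fba A) (Abs_fba B)"
        by (metis Abs_fba_inverse models_inverse sup_fba.rep_eq)
      then show ?case using g union fba_ext.union[of f A _ B] by simp
    qed
    then have g': "fba_ext f (models p) (g p)" for p by (metis models models_inverse)
    show "g = h" by (rule ext) (rule h[OF g', symmetric])
  qed
qed


section \<open>Fafi values and genuine fictions\<close>

definition certified :: "tm \<Rightarrow> bool" where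
  "certified \<phi> \<longleftrightarrow> (\<exists>u. \<phi> = Forall \<cdot> u \<and> provable (Forall \<cdot> Lam (isB (\<up> u \<cdot> Var 0))))"

text \<open>
  Values live in the free Boolean algebra on all terms, but by the last clause only the atoms
  of certified universals ever occur in a value.
\<close>

inductive fafi_value :: "tm \<Rightarrow> tm fba \<Rightarrow> bool"  (infix \<open>\<leadsto>\<close> 50) where
  provable: "provable \<phi> \<Longrightarrow> \<phi> \<leadsto> top"
| refutable: "refutable \<phi> \<Longrightarrow> \<phi> \<leadsto> bot"
| Neg: "\<phi> \<leadsto> p \<Longrightarrow> Neg \<phi> \<leadsto> - p"
| Or: "\<phi> \<leadsto> p \<Longrightarrow> \<psi> \<leadsto> q \<Longrightarrow> Or \<phi> \<psi> \<leadsto> sup p q"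
| atom: "certified (Forall \<cdot> u) \<Longrightarrow> Forall \<cdot> u \<leadsto> atom (Forall \<cdot> u)"

definition genuine_fiction :: "tm \<Rightarrow> bool" where
  "genuine_fiction \<phi> \<longleftrightarrow> sentence \<phi> \<and> (\<exists>p. \<phi> \<leadsto> p) \<and> \<not> provable \<phi> \<and> \<not> refutable \<phi>"

text \<open>An element depends on an atom if changing the truth value of that atom can change it.\<close>

definition support :: "'a fba \<Rightarrow> 'a set" where
  "support p = {a. \<exists>M. (insert a M \<in> models p) \<noteq> (M - {a} \<in> models p)}"

definition value_pedigree :: "tm fba \<Rightarrow> tm set" where
  "value_pedigree p = {\<phi> \<in> support p. \<not> provable \<phi> \<and> \<not> refutable \<phi>}"

text \<open>
  The pedigree of a sentence is that of its value; here \<open>\<phi>\<close> must have a value, and every value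
  of \<open>\<phi>\<close> must have pedigree \<open>P\<close>.
\<close>

definition has_pedigree :: "tm \<Rightarrow> tm set \<Rightarrow> bool" where
  "has_pedigree \<phi> P \<longleftrightarrow> (\<exists>p. \<phi> \<leadsto> p) \<and> (\<forall>p. \<phi> \<leadsto> p \<longrightarrow> value_pedigree p = P)"

end

theory Submission
  imports Defs "HOL-Library.Nat_Bijection"
begin

text \<open>
  OGA is sound for a big-step evaluation of terms to numbers in which \<open>\<A>\<close> is evaluated by an
  infinitary rule and truth is the value 1: equal values may replace each other in any context,
  and this validates every rule, including ATI. Totality of primitive recursion is provable for
  open terms, so every totality claim is certified, and its only value, if it is neither provable
  nor refutable, is its own atom. Provability is recursively enumerable. For the first part, some
  \<open>\<phi>\<^sub>e\<close> therefore halts exactly on those \<open>x\<close> for which \<open>G\<^sub>x\<close> is provable. If \<open>G\<^sub>e\<close> were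
  provable, it would be true, so \<open>\<phi>\<^sub>e(e)\<close> would diverge, a contradiction; hence \<open>\<phi>\<^sub>e(e)\<close> diverges,
  and the true sentence \<open>G\<^sub>e\<close> is neither provable nor refutable. For the second part the same
  argument is run on a primitive recursive matrix \<open>T\<close> of \<open>{c. G(c, c) provable}\<close>, where \<open>c\<close> ranges
  over codes of compiled terms, at the code of \<open>cmp T\<close> itself.

  Only a system between OGA and truth has to be enumerated, so the coded system below need not
  match OGA exactly.
\<close>


section \<open>Parallel substitution\<close>

text \<open>The rules identify a formula with its equation to 1 and its negation with its equation
  to 0, so truth has to be the value 1, and divergent terms such as \<open>Bot\<close> simply have
  no value. Evaluation carries a stack of arguments because conversion acts at the head of an
  application and arguments are passed unevaluated.

  The second part is no specialisation of the first: that would require constructing a standard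
  enumeration together with its step predicate. A diagonal over codes of compiled terms supplies the
  self-reference instead.

  Enumerability is obtained without a machine model. An inductively defined coded system is the
  least fixed point of an enumeration operator, and closure rules for primitive recursive functions,
  recursively enumerable predicates and such operators replace explicit programming.\<close>

definition up_env :: "(nat \<Rightarrow> tm) \<Rightarrow> nat \<Rightarrow> tm" where
  "up_env \<sigma> j = (case j of 0 \<Rightarrow> Var 0 | Suc i \<Rightarrow> \<up> (\<sigma> i))"

lemma up_env_simps [simp]: "up_env \<sigma> 0 = Var 0" "up_env \<sigma> (Suc i) = \<up> (\<sigma> i)"
  by (simp_all add: up_env_def)

text \<open>A common generalisation of \<open>lift\<close>, \<open>inst\<close> and
  \<open>subst\<close>: their commutation laws all reduce to the composition of environments in
  \<open>psub_psub\<close>.\<close>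

primrec psub :: "(nat \<Rightarrow> tm) \<Rightarrow> tm \<Rightarrow> tm" where
  "psub \<sigma> (Var j) = \<sigma> j"
| "psub \<sigma> Bot = Bot"
| "psub \<sigma> Zero = Zero"
| "psub \<sigma> (Succ t) = Succ (psub \<sigma> t)"
| "psub \<sigma> (t \<doteq> u) = (psub \<sigma> t \<doteq> psub \<sigma> u)"
| "psub \<sigma> (Neg t) = Neg (psub \<sigma> t)"
| "psub \<sigma> (Or t u) = Or (psub \<sigma> t) (psub \<sigma> u)"
| "psub \<sigma> (Lam b) = Lam (psub (up_env \<sigma>) b)"
| "psub \<sigma> (t \<cdot> u) = psub \<sigma> t \<cdot> psub \<sigma> u"
| "psub \<sigma> Rec = Rec"
| "psub \<sigma> Forall = Forall"

lemma up_env_Var [simp]: "up_env Var = Var"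
  by (rule ext) (simp add: up_env_def split: nat.split)

lemma psub_Var [simp]: "psub Var t = t"
  by (induction t) simp_all

lemma psub_cong: "(\<And>i. i \<in> fv t \<Longrightarrow> \<sigma> i = \<tau> i) \<Longrightarrow> psub \<sigma> t = psub \<tau> t"
proof (induction t arbitrary: \<sigma> \<tau>)
  case (Succ t)
  from Succ.prems show ?case using Succ.IH[of \<sigma> \<tau>] by simp
next
  case (Neg t)
  from Neg.prems show ?case using Neg.IH[of \<sigma> \<tau>] by simp
next
  case (Lam b)
  have "up_env \<sigma> i = up_env \<tau> i" if "i \<in> fv b" for i
    using that Lam.prems by (cases i) simp_all
  from this show ?case using Lam.IH[of "up_env \<sigma>" "up_env \<tau>"] by simp
next
  case (Eq t u)
  from Eq.prems show ?case using Eq.IH[of \<sigma> \<tau>] by simp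
next
  case (Or t u)
  from Or.prems show ?case using Or.IH[of \<sigma> \<tau>] by simp
next
  case (App t u)
  from App.prems show ?case using App.IH[of \<sigma> \<tau>] by simp
qed auto

lemma psub_closed: "fv t = {} \<Longrightarrow> psub \<sigma> t = t"
  using psub_cong[of t \<sigma> Var] by simp

lemma lift_lift: "i \<le> k \<Longrightarrow> lift (Suc k) (lift i t) = lift i (lift k t)"
  by (induction t arbitrary: i k) simp_all

lemma psub_lift: "psub \<sigma> (lift k t) = psub (\<lambda>j. \<sigma> (if j < k then j else Suc j)) t"
proof (induction t arbitrary: \<sigma> k)
  case (Lam b)
  have "(\<lambda>j. up_env \<sigma> (if j < Suc k then j else Suc j)) =
      up_env (\<lambda>j. \<sigma> (if j < k then j else Suc j))"
    by (rule ext) (auto simp: up_env_def split: nat.split)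
  then show ?case by (simp add: Lam)
qed simp_all

lemma psub_up [simp]: "psub \<sigma> (\<up> t) = psub (\<lambda>j. \<sigma> (Suc j)) t"
  by (simp add: psub_lift)

lemma lift_eq_psub: "lift k t = psub (\<lambda>j. Var (if j < k then j else Suc j)) t"
  using psub_lift[of Var k t] by simp

lemma lift_psub: "lift k (psub \<sigma> t) = psub (\<lambda>j. lift k (\<sigma> j)) t"
proof (induction t arbitrary: \<sigma> k)
  case (Lam b)
  have "(\<lambda>j. lift (Suc k) (up_env \<sigma> j)) = up_env (\<lambda>j. lift k (\<sigma> j))"
    by (rule ext) (auto simp: up_env_def lift_lift split: nat.split)
  then show ?case by (simp add: Lam)
qed simp_all

lemma psub_psub: "psub \<sigma> (psub \<tau> t) = psub (\<lambda>j. psub \<sigma> (\<tau> j)) t"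
proof (induction t arbitrary: \<sigma> \<tau>)
  case (Lam b)
  have "(\<lambda>j. psub (up_env \<sigma>) (up_env \<tau> j)) = up_env (\<lambda>j. psub \<sigma> (\<tau> j))"
    by (rule ext) (auto simp: up_env_def lift_psub split: nat.split)
  then show ?case by (simp add: Lam)
qed simp_all

lemma inst_eq_psub:
  "inst k s t = psub (\<lambda>j. if j = k then s else if k < j then Var (j - 1) else Var j) t"
proof (induction t arbitrary: k s)
  case (Lam b)
  have "(\<lambda>j. if j = Suc k then \<up> s else if Suc k < j then Var (j - 1) else Var j) =
      up_env (\<lambda>j. if j = k then s else if k < j then Var (j - 1) else Var j)"
    by (rule ext) (auto simp: up_env_def split: nat.split)
  then show ?case by (simp add: Lam)
qed simp_all

lemma subst_eq_psub: "subst i s t = psub (\<lambda>j. if j = i then s else Var j) t"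
proof (induction t arbitrary: i s)
  case (Lam b)
  have "(\<lambda>j. if j = Suc i then \<up> s else Var j) = up_env (\<lambda>j. if j = i then s else Var j)"
    by (rule ext) (auto simp: up_env_def split: nat.split)
  then show ?case by (simp add: Lam)
qed simp_all

lemma psub_subst: "psub \<sigma> (subst i s t) = psub (\<sigma>(i := psub \<sigma> s)) t"
  by (auto simp: subst_eq_psub psub_psub intro!: arg_cong[where f = "\<lambda>\<sigma>. psub \<sigma> t"])

lemma psub_inst_0: "psub \<sigma> (inst 0 s b) = inst 0 (psub \<sigma> s) (psub (up_env \<sigma>) b)"
  unfolding inst_eq_psub psub_psub
  by (rule arg_cong[where f = "\<lambda>\<sigma>. psub \<sigma> b"], rule ext)
    (auto simp: up_env_def lift_eq_psub psub_psub split: nat.split)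

text \<open>Raising the indices above \<open>i\<close> offsets the lowering that \<open>inst\<close>
  performs. The coded system thereby expresses \<open>subst\<close> through the relations for
  \<open>lift\<close> and \<open>inst\<close>.\<close>

lemma subst_eq_inst_lift: "subst i s t = inst i s (lift (Suc i) t)"
  unfolding inst_eq_psub psub_lift subst_eq_psub
  by (rule arg_cong[where f = "\<lambda>\<sigma>. psub \<sigma> t"]) auto

lemma num_simps: "num 0 = Zero" "num (Suc n) = Succ (num n)"
  by (simp_all add: num_def)

lemma fv_num [simp]: "fv (num n) = {}"
  by (induction n) (simp_all add: num_simps)

lemma psub_num [simp]: "psub \<sigma> (num n) = num n"
  by (simp add: psub_closed)


section \<open>A truth-value semantics\<close>

text \<open>\<open>ev t us n\<close>: the term \<open>t\<close>, applied to the stack \<open>us\<close> of arguments, has value \<open>n\<close>.\<close>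

inductive ev :: "tm \<Rightarrow> tm list \<Rightarrow> nat \<Rightarrow> bool" where
  Zero: "ev Zero [] 0"
| Succ: "ev t [] n \<Longrightarrow> ev (Succ t) [] (Suc n)"
| EqT: "ev t [] n \<Longrightarrow> ev u [] n \<Longrightarrow> ev (t \<doteq> u) [] (Suc 0)"
| EqF: "ev t [] m \<Longrightarrow> ev u [] n \<Longrightarrow> m \<noteq> n \<Longrightarrow> ev (t \<doteq> u) [] 0"
| NegT: "ev t [] 0 \<Longrightarrow> ev (Neg t) [] (Suc 0)"
| NegF: "ev t [] (Suc 0) \<Longrightarrow> ev (Neg t) [] 0"
| OrT1: "ev t [] (Suc 0) \<Longrightarrow> ev (Or t u) [] (Suc 0)"
| OrT2: "ev u [] (Suc 0) \<Longrightarrow> ev (Or t u) [] (Suc 0)"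
| OrF: "ev t [] 0 \<Longrightarrow> ev u [] 0 \<Longrightarrow> ev (Or t u) [] 0"
| Lam: "ev (inst 0 u b) us n \<Longrightarrow> ev (Lam b) (u # us) n"
| App: "ev t (u # us) n \<Longrightarrow> ev (t \<cdot> u) us n"
| Rec0: "ev t [] 0 \<Longrightarrow> ev g us n \<Longrightarrow> ev Rec (g # h # t # us) n"
| RecS: "ev t [] (Suc k) \<Longrightarrow> ev h (num k # Rec \<cdot> g \<cdot> h \<cdot> num k # us) n \<Longrightarrow>
    ev Rec (g # h # t # us) n"
| ForallT: "(\<And>n. ev u [num n] (Suc 0)) \<Longrightarrow> ev Forall [u] (Suc 0)"
| ForallF: "ev u [num n] 0 \<Longrightarrow> ev Forall [u] 0"

inductive_cases ev_ZeroE: "ev Zero us n"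
inductive_cases ev_BotE: "ev Bot us n"
inductive_cases ev_SuccE: "ev (Succ t) us n"
inductive_cases ev_EqE: "ev (t \<doteq> u) us n"
inductive_cases ev_NegE: "ev (Neg t) us n"
inductive_cases ev_OrE: "ev (Or t u) us n"
inductive_cases ev_LamE: "ev (Lam b) us n"
inductive_cases ev_AppE: "ev (t \<cdot> u) us n"
inductive_cases ev_RecE: "ev Rec us n"
inductive_cases ev_ForallE: "ev Forall us n"

lemma ev_App [simp]: "ev (t \<cdot> u) us n \<longleftrightarrow> ev t (u # us) n"
  by (auto elim: ev_AppE intro: ev.App)

lemma ev_Lam [simp]: "ev (Lam b) (u # us) n \<longleftrightarrow> ev (inst 0 u b) us n"
  by (auto elim: ev_LamE intro: ev.Lam)

lemma ev_num: "ev (num n) [] n"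
  by (induction n) (auto simp: num_simps intro: ev.intros)

text \<open>Stronger than determinism: a stack on which \<open>t\<close> has a value cannot be
  extended to another one. \<open>ev_eqv\<close> relies on this to exclude further arguments after a
  term that already has a value.\<close>

lemma ev_det_aux: "ev t vs m \<Longrightarrow> ev t (vs @ us) n \<Longrightarrow> us = [] \<and> m = n"
proof (induction arbitrary: us n rule: ev.induct)
  case Zero
  then show ?case by (auto elim: ev_ZeroE)
next
  case (Succ t n)
  note IH = Succ.IH[of "[]", simplified]
  from Succ.prems show ?case by (auto elim!: ev_SuccE dest: IH)
next
  case (EqT t n u)
  note IH = EqT.IH(1)[of "[]", simplified] EqT.IH(2)[of "[]", simplified]
  from EqT.prems show ?case by (auto elim!: ev_EqE dest: IH)
next
  case (EqF t m u n)
  note IH = EqF.IH(1)[of "[]", simplified] EqF.IH(2)[of "[]", simplified]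
  from EqF.prems EqF.hyps(3) show ?case by (auto elim!: ev_EqE dest!: IH)
next
  case (NegT t)
  note IH = NegT.IH[of "[]", simplified]
  from NegT.prems show ?case by (auto elim!: ev_NegE dest: IH)
next
  case (NegF t)
  note IH = NegF.IH[of "[]", simplified]
  from NegF.prems show ?case by (auto elim!: ev_NegE dest: IH)
next
  case (OrT1 t u)
  note IH = OrT1.IH[of "[]", simplified]
  from OrT1.prems show ?case by (auto elim!: ev_OrE dest: IH)
next
  case (OrT2 u t)
  note IH = OrT2.IH[of "[]", simplified]
  from OrT2.prems show ?case by (auto elim!: ev_OrE dest: IH)
next
  case (OrF t u)
  note IH = OrF.IH(1)[of "[]", simplified] OrF.IH(2)[of "[]", simplified]
  from OrF.prems show ?case by (auto elim!: ev_OrE dest: IH)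
next
  case (Rec0 t g us n h)
  note IH = Rec0.IH(1)[of "[]", simplified] Rec0.IH(2)
  from Rec0.prems show ?case by (auto elim!: ev_RecE dest: IH)
next
  case (RecS t k h g us n)
  note IH = RecS.IH(1)[of "[]", simplified] RecS.IH(2)[simplified]
  from RecS.prems show ?case by (auto elim!: ev_RecE dest: IH)
next
  case (ForallT u)
  note IH = ForallT.IH[of _ "[]", simplified]
  from ForallT.prems show ?case by (auto elim!: ev_ForallE dest: IH)
next
  case (ForallF u k)
  note IH = ForallF.IH[of "[]", simplified]
  from ForallF.prems show ?case by (auto elim!: ev_ForallE dest: IH)
qed auto

lemma ev_det: "ev t us m \<Longrightarrow> ev t us n \<Longrightarrow> m = n"
  using ev_det_aux[of t us m "[]" n] by simp

text \<open>Variables have no evaluation rule, so a successful evaluation never reaches a free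
  variable and survives every substitution.\<close>

lemma ev_psub: "ev t us n \<Longrightarrow> ev (psub \<sigma> t) (map (psub \<sigma>) us) n"
proof (induction rule: ev.induct)
  case (Lam u b us n)
  then show ?case by (simp add: psub_inst_0)
qed (auto intro: ev.intros)

corollary ev_lift: "ev t [] n \<Longrightarrow> ev (lift k t) [] n"
  using ev_psub[of t "[]" n] by (simp add: lift_eq_psub)

lemma ev_head_step: "t \<rhd> t' \<Longrightarrow> ev t us n \<longleftrightarrow> ev t' us n"
proof (induction arbitrary: us rule: head_step.induct)
  case (rec_Zero g h)
  show ?case by (auto elim!: ev_RecE dest: ev_det[OF _ ev.Zero] intro: ev.Rec0 ev.Zero)
next
  case (rec_Succ g h k)
  have "ev (Succ (num k)) [] (Suc k)" by (intro ev.Succ ev_num)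
  then show ?case by (auto elim!: ev_RecE dest: ev_det intro: ev.RecS)
qed simp_all

text \<open>The compatible closure of having the same value. Without a transitivity rule, related
  terms either share a value or agree in their outermost constructor, which is the case distinction
  of \<open>eqv_cases\<close>.\<close>

inductive eqv :: "tm \<Rightarrow> tm \<Rightarrow> bool"  (infix \<open>\<approx>\<close> 50) where
  same: "ev a [] n \<Longrightarrow> ev b [] n \<Longrightarrow> a \<approx> b"
| refl [simp]: "t \<approx> t"
| Succ: "t \<approx> t' \<Longrightarrow> Succ t \<approx> Succ t'"
| Eq: "t \<approx> t' \<Longrightarrow> u \<approx> u' \<Longrightarrow> (t \<doteq> u) \<approx> (t' \<doteq> u')"
| Neg: "t \<approx> t' \<Longrightarrow> Neg t \<approx> Neg t'"
| Or: "t \<approx> t' \<Longrightarrow> u \<approx> u' \<Longrightarrow> Or t u \<approx> Or t' u'"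
| Lam: "t \<approx> t' \<Longrightarrow> Lam t \<approx> Lam t'"
| App: "t \<approx> t' \<Longrightarrow> u \<approx> u' \<Longrightarrow> t \<cdot> u \<approx> t' \<cdot> u'"

lemma eqv_lift: "a \<approx> b \<Longrightarrow> lift k a \<approx> lift k b"
  by (induction arbitrary: k rule: eqv.induct) (auto intro: eqv.intros ev_lift)

lemma eqv_up_env: "(\<And>j. \<sigma> j \<approx> \<tau> j) \<Longrightarrow> up_env \<sigma> j \<approx> up_env \<tau> j"
  by (cases j) (simp_all add: eqv_lift)

lemma psub_eqv: "(\<And>j. \<sigma> j \<approx> \<tau> j) \<Longrightarrow> psub \<sigma> t \<approx> psub \<tau> t"
proof (induction t arbitrary: \<sigma> \<tau>)
  case (Lam b)
  then show ?case using eqv_up_env[of \<sigma> \<tau>] by (simp add: eqv.Lam)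
qed (auto intro: eqv.intros)

lemma eqv_psub: "a \<approx> b \<Longrightarrow> (\<And>j. \<sigma> j \<approx> \<tau> j) \<Longrightarrow> psub \<sigma> a \<approx> psub \<tau> b"
proof (induction arbitrary: \<sigma> \<tau> rule: eqv.induct)
  case (same a n b)
  then have "ev (psub \<sigma> a) [] n" "ev (psub \<tau> b) [] n"
    using ev_psub[of _ "[]" n] by simp_all
  then show ?case by (rule eqv.same)
next
  case (Lam t t')
  then show ?case using eqv_up_env[of \<sigma> \<tau>] by (simp add: eqv.Lam)
qed (auto intro: eqv.intros psub_eqv)

lemma eqv_inst: "b \<approx> b' \<Longrightarrow> t \<approx> t' \<Longrightarrow> inst 0 t b \<approx> inst 0 t' b'"
  unfolding inst_eq_psub by (rule eqv_psub) auto

lemma eqv_cases: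
  assumes "t \<approx> t'"
  obtains (same) n where "ev t [] n" "ev t' [] n"
    | (Var) i where "t = Var i" "t' = Var i"
    | (Bot) "t = Bot" "t' = Bot"
    | (Zero) "t = Zero" "t' = Zero"
    | (Succ) s s' where "t = Succ s" "t' = Succ s'" "s \<approx> s'"
    | (Eq) s s' u u' where "t = (s \<doteq> u)" "t' = (s' \<doteq> u')" "s \<approx> s'" "u \<approx> u'"
    | (Neg) s s' where "t = Neg s" "t' = Neg s'" "s \<approx> s'"
    | (Or) s s' u u' where "t = Or s u" "t' = Or s' u'" "s \<approx> s'" "u \<approx> u'"
    | (Lam) s s' where "t = Lam s" "t' = Lam s'" "s \<approx> s'"
    | (App) s s' u u' where "t = s \<cdot> u" "t' = s' \<cdot> u'" "s \<approx> s'" "u \<approx> u'"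
    | (Rec) "t = Rec" "t' = Rec"
    | (Forall) "t = Forall" "t' = Forall"
  using assms
proof (cases rule: eqv.cases)
  case refl
  then show ?thesis using that by (cases t) auto
qed (use that in auto)

text \<open>Head and stack are replaced simultaneously, because a beta step moves a stack entry into
  the head. When the two heads are related by a common value, determinism settles the case;
  otherwise they have the same constructor and the same evaluation rule applies.\<close>

lemma ev_eqv: "ev t us n \<Longrightarrow> t \<approx> t' \<Longrightarrow> list_all2 (\<approx>) us us' \<Longrightarrow> ev t' us' n"
proof (induction arbitrary: t' us' rule: ev.induct)
  case Zero
  from Zero(1) show ?case using Zero(2) ev_det[OF ev.Zero]
    by (cases rule: eqv_cases) (auto intro: ev.intros)
next
  case (Succ t n)
  note D = ev_det[OF ev.Succ[OF Succ.hyps]]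
  from Succ.prems(1) show ?case using Succ.prems(2) Succ.IH
    by (cases rule: eqv_cases) (auto dest: D intro: ev.Succ)
next
  case (EqT t n u)
  note D = ev_det[OF ev.EqT[OF EqT.hyps]]
  from EqT.prems(1) show ?case using EqT.prems(2) EqT.IH
    by (cases rule: eqv_cases) (auto dest: D intro: ev.EqT[of _ n])
next
  case (EqF t m u n)
  note D = ev_det[OF ev.EqF[OF EqF.hyps]]
  from EqF.prems(1) show ?case using EqF.prems(2) EqF.IH EqF.hyps(3)
    by (cases rule: eqv_cases) (auto dest: D intro: ev.EqF[of _ m _ n])
next
  case (NegT t)
  note D = ev_det[OF ev.NegT[OF NegT.hyps]]
  from NegT.prems(1) show ?case using NegT.prems(2) NegT.IH
    by (cases rule: eqv_cases) (auto dest: D intro: ev.NegT)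
next
  case (NegF t)
  note D = ev_det[OF ev.NegF[OF NegF.hyps]]
  from NegF.prems(1) show ?case using NegF.prems(2) NegF.IH
    by (cases rule: eqv_cases) (auto dest: D intro: ev.NegF)
next
  case (OrT1 t u)
  note D = ev_det[OF ev.OrT1[OF OrT1.hyps]]
  from OrT1.prems(1) show ?case using OrT1.prems(2) OrT1.IH
    by (cases rule: eqv_cases) (auto dest: D intro: ev.OrT1)
next
  case (OrT2 u t)
  note D = ev_det[OF ev.OrT2[OF OrT2.hyps]]
  from OrT2.prems(1) show ?case using OrT2.prems(2) OrT2.IH
    by (cases rule: eqv_cases) (auto dest: D intro: ev.OrT2)
next
  case (OrF t u)
  note D = ev_det[OF ev.OrF[OF OrF.hyps]]
  from OrF.prems(1) show ?case using OrF.prems(2) OrF.IH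
    by (cases rule: eqv_cases) (auto dest: D intro: ev.OrF)
next
  case (Lam u b us n)
  from Lam.prems(1) show ?case
  proof (cases rule: eqv_cases)
    case (Lam s s')
    then show ?thesis using Lam.prems(2) Lam.IH by (auto simp: list_all2_Cons1 eqv_inst)
  qed (auto elim: ev_LamE)
next
  case (App t u us n)
  from App.prems(1) show ?case
  proof (cases rule: eqv_cases)
    case (same m)
    \<comment> \<open>The application already has a value on the empty stack, so no further
      arguments can be left.\<close>
    then have "ev (t \<cdot> u) ([] @ us) n" using App.hyps by simp
    then have "us = [] \<and> m = n" using same(1) ev_det_aux by blast
    then show ?thesis using same App.prems(2) by simp
  next
    case (App s s' u' u'')
    then show ?thesis using App.prems(2) App.IH by simp
  qed simp_all
next
  case (Rec0 t g us n h)
  from Rec0.prems(1) have "t' = Rec" by (cases rule: eqv_cases) (auto elim: ev_RecE)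
  moreover from Rec0.prems(2) obtain g' h' s' vs where
    "us' = g' # h' # s' # vs" "g \<approx> g'" "t \<approx> s'" "list_all2 (\<approx>) us vs"
    by (auto simp: list_all2_Cons1)
  ultimately show ?case using Rec0.IH by (auto intro: ev.Rec0)
next
  case (RecS t k h g us n)
  from RecS.prems(1) have "t' = Rec" by (cases rule: eqv_cases) (auto elim: ev_RecE)
  moreover from RecS.prems(2) obtain g' h' s' vs where
    "us' = g' # h' # s' # vs" "g \<approx> g'" "h \<approx> h'" "t \<approx> s'" "list_all2 (\<approx>) us vs"
    by (auto simp: list_all2_Cons1)
  \<comment> \<open>The recursive call is itself a stack entry; only \<open>g\<close> and
    \<open>h\<close> change in it, its argument being a numeral on both sides.\<close>
  moreover from this have "Rec \<cdot> g \<cdot> h \<cdot> num k \<approx> Rec \<cdot> g' \<cdot> h' \<cdot> num k"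
    by (intro eqv.App eqv.refl)
  ultimately show ?case using RecS.IH(1)[of s' "[]"] RecS.IH(2)[of h'] by (auto intro!: ev.RecS[of s' k])
next
  case (ForallT u)
  from ForallT.prems(1) have "t' = Forall" by (cases rule: eqv_cases) (auto elim: ev_ForallE)
  moreover from ForallT.prems(2) obtain u' where "us' = [u']" "u \<approx> u'"
    by (auto simp: list_all2_Cons1)
  moreover from this have "ev u' [num k] (Suc 0)" for k using ForallT.IH[of u' k "[num k]"] by simp
  ultimately show ?case by (simp add: ev.ForallT)
next
  case (ForallF u n)
  from ForallF.prems(1) have "t' = Forall" by (cases rule: eqv_cases) (auto elim: ev_ForallE)
  moreover from ForallF.prems(2) obtain u' where "us' = [u']" "u \<approx> u'"
    by (auto simp: list_all2_Cons1)
  ultimately show ?case using ForallF.IH[of u' "[num n]"] by (auto intro: ev.ForallF)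
qed

lemma eqv_imp_ev: "t \<approx> t' \<Longrightarrow> ev t [] n \<Longrightarrow> ev t' [] n"
  by (rule ev_eqv) auto


section \<open>Derivations\<close>

abbreviation derives :: "tm fset \<Rightarrow> tm \<Rightarrow> bool"  (infix \<open>\<tturnstile>\<close> 45) where
  "\<Gamma> \<tturnstile> c \<equiv> oga_derivable (\<Gamma>, c)"

lemma oga_proof_append: "oga_proof js \<Longrightarrow> oga_proof ks \<Longrightarrow> oga_proof (js @ ks)"
  unfolding oga_proof_def
proof (intro allI impI)
  fix i assume js: "\<forall>i<length js. \<exists>ps. set ps \<subseteq> set (take i js) \<and> oga_rule ps (js ! i)"
    and ks: "\<forall>i<length ks. \<exists>ps. set ps \<subseteq> set (take i ks) \<and> oga_rule ps (ks ! i)"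
    and i: "i < length (js @ ks)"
  show "\<exists>ps. set ps \<subseteq> set (take i (js @ ks)) \<and> oga_rule ps ((js @ ks) ! i)"
  proof (cases "i < length js")
    case True
    then show ?thesis using js by (simp add: nth_append)
  next
    case False
    then have "i - length js < length ks" using i by simp
    with ks obtain ps where "set ps \<subseteq> set (take (i - length js) ks)"
      "oga_rule ps (ks ! (i - length js))" by blast
    then show ?thesis using False by (intro exI[of _ ps]) (auto simp: nth_append)
  qed
qed

text \<open>Concatenating proofs of the premises gives one list containing them all, to which the
  new judgment is appended. From here on derivability is handled as closure under rules.\<close>

lemma oga_derivable_rule:
  assumes "oga_rule ps j" "\<And>p. p \<in> set ps \<Longrightarrow> oga_derivable p"
  shows "oga_derivable j"
proof -
  have "\<exists>js. oga_proof js \<and> set ps \<subseteq> set js"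
    using assms(2)
  proof (induction ps)
    case Nil
    show ?case by (intro exI[of _ "[]"]) (simp add: oga_proof_def)
  next
    case (Cons p ps)
    then obtain js ks where "oga_proof js" "p \<in> set js" "oga_proof ks" "set ps \<subseteq> set ks"
      unfolding oga_derivable_def by (metis list.set_intros)
    then show ?case by (intro exI[of _ "js @ ks"]) (auto simp: oga_proof_append)
  qed
  then obtain js where js: "oga_proof js" "set ps \<subseteq> set js" by blast
  have "oga_proof (js @ [j])" unfolding oga_proof_def
  proof (intro allI impI)
    fix i assume "i < length (js @ [j])"
    then show "\<exists>ps. set ps \<subseteq> set (take i (js @ [j])) \<and> oga_rule ps ((js @ [j]) ! i)"
      using js assms(1) by (cases "i < length js") (auto simp: oga_proof_def nth_append)
  qed
  then show ?thesis unfolding oga_derivable_def by (intro exI[of _ "js @ [j]"]) simp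
qed

lemma oga_derivable_induct [consumes 1, case_names step]:
  assumes "oga_derivable j"
    and "\<And>ps j. oga_rule ps j \<Longrightarrow> (\<And>p. p \<in> set ps \<Longrightarrow> P p) \<Longrightarrow> P j"
  shows "P j"
proof -
  obtain js where js: "oga_proof js" "j \<in> set js" using assms(1) unfolding oga_derivable_def by blast
  have "i < length js \<Longrightarrow> P (js ! i)" for i
  proof (induction i rule: less_induct)
    case (less i)
    then obtain ps where ps: "set ps \<subseteq> set (take i js)" "oga_rule ps (js ! i)"
      using js(1) unfolding oga_proof_def by blast
    show ?case
    proof (rule assms(2)[OF ps(2)])
      fix p assume "p \<in> set ps"
      then obtain k where "k < i" "p = js ! k"
        using ps(1) less.prems by (force simp: in_set_conv_nth)
      then show "P p" using less by simp
    qed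
  qed
  then show ?thesis using js(2) by (auto simp: in_set_conv_nth)
qed

lemma rga0: "rga_rule [] j \<Longrightarrow> oga_derivable j"
  by (rule oga_derivable_rule[OF oga_rule.rga]) auto

lemma rga1: "rga_rule [p] j \<Longrightarrow> oga_derivable p \<Longrightarrow> oga_derivable j"
  by (rule oga_derivable_rule[OF oga_rule.rga]) auto

lemma rga2: "rga_rule [p, q] j \<Longrightarrow> oga_derivable p \<Longrightarrow> oga_derivable q \<Longrightarrow> oga_derivable j"
  by (rule oga_derivable_rule[OF oga_rule.rga]) auto

lemma rga3: "rga_rule [p, q, r] j \<Longrightarrow>
    oga_derivable p \<Longrightarrow> oga_derivable q \<Longrightarrow> oga_derivable r \<Longrightarrow> oga_derivable j"
  by (rule oga_derivable_rule[OF oga_rule.rga]) auto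

section \<open>Derived rules for numbers and Boolean formulas\<close>

lemmas D_weaken = rga1[OF rga_rule.weaken]
lemmas D_hyp = rga0[OF rga_rule.hyp]

text \<open>The equation makes \<open>isB (a \<doteq> b)\<close> derivable, and
  \<open>eq_isB_isN\<close> extracts from this that both sides are numbers. \<open>And\<close>
  abbreviates a negated disjunction, hence the two elimination steps.\<close>

lemma D_eq_isN: "\<Gamma> \<tturnstile> a \<doteq> b \<Longrightarrow> \<Gamma> \<tturnstile> isN a"
  by (rule rga1[OF rga_rule.NegNegE], rule rga1[OF rga_rule.NegOrE1],
      rule rga1[OF rga_rule.eq_isB_isN], rule rga1[OF rga_rule.OrI1])

lemma D_steps_isN: "(\<rhd>)\<^sup>*\<^sup>* c c' \<Longrightarrow> \<Gamma> \<tturnstile> isN c' \<Longrightarrow> \<Gamma> \<tturnstile> isN c"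
  by (induction rule: converse_rtranclp_induct) (auto intro: D_eq_isN rga1[OF rga_rule.step_eq])

lemma D_isB_Neg: "\<Gamma> \<tturnstile> isB a \<Longrightarrow> \<Gamma> \<tturnstile> isB (Neg a)"
  by (rule rga3[OF rga_rule.OrE[of _ a "Neg a"]])
    (auto intro: rga1[OF rga_rule.OrI1] rga1[OF rga_rule.OrI2] rga1[OF rga_rule.NegNegI] D_hyp)

text \<open>Conversion under \<open>Neg\<close> goes only from \<open>c\<close> to
  \<open>c'\<close>, so the negative case takes a detour: \<open>Neg c'\<close> gives
  \<open>c' \<doteq> num 0\<close>, hence \<open>c'\<close> is a number, \<open>step_eq\<close>
  yields \<open>c \<doteq> c'\<close>, and equality substitution carries the negation over to
  \<open>c\<close>.\<close>

lemma D_isB_expand: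
  assumes "c \<rhd> c'" "\<Gamma> \<tturnstile> isB c'"
  shows "\<Gamma> \<tturnstile> isB c"
proof (rule rga3[OF rga_rule.OrE assms(2)])
  show "finsert c' \<Gamma> \<tturnstile> isB c"
    by (rule rga1[OF rga_rule.OrI1], rule rga1[OF rga_rule.expand[OF assms(1)]], rule D_hyp)
  let ?\<Gamma> = "finsert (Neg c') \<Gamma>"
  have *: "?\<Gamma> \<tturnstile> Neg c'" by (rule D_hyp)
  have "?\<Gamma> \<tturnstile> c \<doteq> c'"
    by (rule rga1[OF rga_rule.step_eq[OF assms(1)]], rule D_eq_isN,
        rule rga1[OF rga_rule.false_eq_zero], rule *)
  then have "?\<Gamma> \<tturnstile> c' \<doteq> c" by (rule rga1[OF rga_rule.eq_sym])
  from rga2[OF rga_rule.eq_subst[of _ c' c 0 "Neg (Var 0)"] this] * have "?\<Gamma> \<tturnstile> Neg c" by simp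
  then show "?\<Gamma> \<tturnstile> isB c" by (rule rga1[OF rga_rule.OrI2])
qed

lemma D_Forall_Lam:
  assumes "finsert (isN (Var 0)) (\<up> |`| \<Gamma>) \<tturnstile> b"
  shows "\<Gamma> \<tturnstile> Forall \<cdot> Lam b"
proof (rule rga1[OF rga_rule.ForallI])
  \<comment> \<open>Lifting makes room above the bound variable, and the instance then identifies it
    with the eigenvariable.\<close>
  have "inst 0 (Var 0) (lift 1 b) = b"
    unfolding inst_eq_psub psub_lift
    by (rule trans[OF psub_cong[where \<tau> = Var] psub_Var]) auto
  then have "\<up> (Lam b) \<cdot> Var 0 \<rhd> b" using head_step.beta[of "lift 1 b" "Var 0"] by simp
  from rga1[OF rga_rule.expand[OF this] assms]
  show "finsert (isN (Var 0)) (\<up> |`| \<Gamma>) \<tturnstile> \<up> (Lam b) \<cdot> Var 0" .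
qed


section \<open>Compiled definitions\<close>

lemma apps_simps [simp]: "apps t [] = t" "apps t (u # us) = apps (t \<cdot> u) us"
  by (simp_all add: apps_def)

lemma psub_apps [simp]: "psub \<sigma> (apps t ts) = apps (psub \<sigma> t) (map (psub \<sigma>) ts)"
  by (induction ts arbitrary: t) simp_all

lemma ev_apps [simp]: "ev (apps t ts) us n \<longleftrightarrow> ev t (ts @ us) n"
  by (induction ts arbitrary: t) simp_all

lemma fv_apps [simp]: "fv (apps t ts) = fv t \<union> \<Union> (fv ` set ts)"
  by (induction ts arbitrary: t) auto

lemma lams_simps [simp]: "lams 0 t = t" "lams (Suc n) t = Lam (lams n t)"
  by (simp_all add: lams_def)

lemma fv_lams [simp]: "fv (lams n t) = {i. i + n \<in> fv t}"
  by (induction n) auto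

lemma fv_args [simp]: "\<Union> (fv ` set (args s n)) = {s..<s + n}"
  by (auto simp: args_def)

lemma length_args [simp]: "length (args s n) = n"
  by (simp add: args_def)

lemma nth_args: "i < n \<Longrightarrow> args s n ! i = Var (s + (n - Suc i))"
  by (simp add: args_def rev_nth)

lemma fv_cmp: "pr_wf f \<Longrightarrow> fv (cmp f) = {}"
proof (induction f)
  case (PProj n i)
  then show ?case by (auto simp: args_def rev_nth)
next
  case (PComp n f gs)
  have "fv (apps (cmp g) (args 0 n)) = {..<n}" if "g \<in> set gs" for g
    using PComp that by auto
  then show ?case using PComp by auto
next
  case (PRec g h)
  then show ?case by (auto simp: Let_def)
qed auto

lemma psub_cmp [simp]: "pr_wf f \<Longrightarrow> psub \<sigma> (cmp f) = cmp f"
  by (simp add: psub_closed fv_cmp)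

text \<open>The environment that binds \<open>n\<close> abstractions to \<open>ts\<close>, the last of which gets index 0.\<close>

definition bind_env :: "tm list \<Rightarrow> (nat \<Rightarrow> tm) \<Rightarrow> nat \<Rightarrow> tm" where
  "bind_env ts \<sigma> = foldl (\<lambda>\<sigma> t. case_nat t \<sigma>) \<sigma> ts"

lemma bind_env_nth: "i < length ts \<Longrightarrow> bind_env ts \<sigma> i = rev ts ! i"
proof (induction ts arbitrary: i rule: rev_induct)
  case (snoc t ts)
  then show ?case by (cases i) (simp_all add: bind_env_def)
qed simp

lemma inst_0_psub: "inst 0 t (psub (up_env \<sigma>) b) = psub (case_nat t \<sigma>) b"
  unfolding inst_eq_psub psub_psub
  by (rule arg_cong[where f = "\<lambda>\<sigma>. psub \<sigma> b"], rule ext) (auto split: nat.split)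

lemma head_steps_apps: "(\<rhd>)\<^sup>*\<^sup>* t t' \<Longrightarrow> (\<rhd>)\<^sup>*\<^sup>* (apps t us) (apps t' us)"
proof (induction us arbitrary: t t')
  case (Cons u us)
  have "(\<rhd>)\<^sup>*\<^sup>* (t \<cdot> u) (t' \<cdot> u)" using Cons.prems
    by (induction rule: rtranclp_induct) (auto intro: head_step.app rtranclp.rtrancl_into_rtrancl)
  then show ?case using Cons.IH by simp
qed simp

lemma lams_steps_psub:
  "(\<rhd>)\<^sup>*\<^sup>* (apps (psub \<sigma> (lams (length ts) b)) ts) (psub (bind_env ts \<sigma>) b)"
proof (induction ts arbitrary: \<sigma>)
  case Nil
  show ?case by (simp add: bind_env_def)
next
  case (Cons t ts)
  have "psub \<sigma> (lams (length (t # ts)) b) \<cdot> t \<rhd> psub (case_nat t \<sigma>) (lams (length ts) b)"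
    using head_step.beta[of "psub (up_env \<sigma>) (lams (length ts) b)" t] by (simp add: inst_0_psub)
  then have "(\<rhd>)\<^sup>*\<^sup>* (apps (psub \<sigma> (lams (length (t # ts)) b) \<cdot> t) ts)
      (apps (psub (case_nat t \<sigma>) (lams (length ts) b)) ts)"
    by (intro head_steps_apps) simp
  also have "(\<rhd>)\<^sup>*\<^sup>* \<dots> (psub (bind_env (t # ts) \<sigma>) b)"
    using Cons.IH[of "case_nat t \<sigma>"] by (simp add: bind_env_def)
  finally show ?case by simp
qed

lemma lams_steps: "length ts = n \<Longrightarrow> (\<rhd>)\<^sup>*\<^sup>* (apps (lams n b) ts) (psub (bind_env ts Var) b)"
  using lams_steps_psub[of Var ts b] by simp

text \<open>The prefix \<open>us\<close> holds arguments that precede the parameters, such as the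
  recursion argument in \<open>PRec_steps\<close>.\<close>

lemma bind_env_args: "length ts = n \<Longrightarrow> map (psub (bind_env (us @ ts) Var)) (args 0 n) = ts"
  by (rule nth_equalityI) (simp_all add: args_def bind_env_nth rev_nth nth_append)

lemma PComp_steps:
  assumes "pr_wf (PComp n f gs)" "length ts = n"
  shows "(\<rhd>)\<^sup>*\<^sup>* (apps (cmp (PComp n f gs)) ts) (apps (cmp f) (map (\<lambda>g. apps (cmp g) ts) gs))"
proof -
  have "psub (bind_env ts Var) (apps (cmp f) (map (\<lambda>g. apps (cmp g) (args 0 n)) gs)) =
      apps (cmp f) (map (\<lambda>g. apps (cmp g) ts) gs)"
    using assms bind_env_args[OF assms(2), of "[]"] by (simp add: comp_def cong: map_cong)
  then show ?thesis using lams_steps[OF assms(2)] by (metis cmp.simps(4))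
qed

text \<open>The step term of a compiled recursion once its parameters have been filled in; they
  stand below two binders, hence the double lift.\<close>

definition rec_step :: "prdef \<Rightarrow> tm list \<Rightarrow> tm" where
  "rec_step h ts = Lam (Lam (apps (cmp h \<cdot> Var 1 \<cdot> Var 0) (map (\<lambda>t. \<up> (\<up> t)) ts)))"

lemma rec_step_steps:
  assumes "pr_wf h"
  shows "(\<rhd>)\<^sup>*\<^sup>* (rec_step h ts \<cdot> a \<cdot> b) (apps (cmp h) (a # b # ts))"
proof -
  have "psub (bind_env [a, b] Var) (apps (cmp h \<cdot> Var 1 \<cdot> Var 0) (map (\<lambda>t. \<up> (\<up> t)) ts)) =
      apps (cmp h) (a # b # ts)"
    using assms by (simp add: comp_def bind_env_def)
  then show ?thesis
    using lams_steps[of "[a, b]" 2 "apps (cmp h \<cdot> Var 1 \<cdot> Var 0) (map (\<lambda>t. \<up> (\<up> t)) ts)"]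
    by (simp add: rec_step_def numeral_2_eq_2)
qed

lemma psub_rec_step: "pr_wf h \<Longrightarrow> psub \<sigma> (rec_step h ts) = rec_step h (map (psub \<sigma>) ts)"
  by (simp add: rec_step_def comp_def lift_psub)

lemma PRec_steps:
  assumes "pr_wf (PRec g h)" "length ts = pr_arity g"
  shows "(\<rhd>)\<^sup>*\<^sup>* (apps (cmp (PRec g h)) (t # ts)) (Rec \<cdot> apps (cmp g) ts \<cdot> rec_step h ts \<cdot> t)"
proof -
  let ?E = "bind_env ([t] @ ts) Var"
  have "map (psub (up_env (up_env ?E))) (args 2 (pr_arity g)) =
      map (\<lambda>t. \<up> (\<up> t)) (map (psub ?E) (args 0 (pr_arity g)))"
    by (rule nth_equalityI) (simp_all add: nth_args numeral_2_eq_2)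
  also have "\<dots> = map (\<lambda>t. \<up> (\<up> t)) ts" using bind_env_args[OF assms(2), of "[t]"] by simp
  finally have *: "map (psub (up_env (up_env ?E))) (args 2 (pr_arity g)) = map (\<lambda>t. \<up> (\<up> t)) ts" .
  have "?E (pr_arity g) = t" using assms(2) by (simp add: bind_env_nth nth_append)
  then have "psub ?E (Rec \<cdot> apps (cmp g) (args 0 (pr_arity g)) \<cdot>
      Lam (Lam (apps (cmp h \<cdot> Var 1 \<cdot> Var 0) (args 2 (pr_arity g)))) \<cdot> Var (pr_arity g)) =
      Rec \<cdot> apps (cmp g) ts \<cdot> rec_step h ts \<cdot> t"
    using assms * bind_env_args[OF assms(2), of "[t]"] by (simp add: rec_step_def)
  moreover have "length ([t] @ ts) = Suc (pr_arity g)" using assms(2) by simp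
  ultimately show ?thesis using lams_steps[of "[t] @ ts" "Suc (pr_arity g)"]
    by (metis cmp.simps(5) append_Cons append_Nil)
qed

section \<open>Values and provable termination of compiled terms\<close>

lemma ev_head_steps: "(\<rhd>)\<^sup>*\<^sup>* t t' \<Longrightarrow> ev t [] n \<longleftrightarrow> ev t' [] n"
  by (induction rule: rtranclp_induct) (simp_all add: ev_head_step)

text \<open>The arguments are arbitrary terms with values, not numerals, since composition and
  recursion pass unevaluated applications on.\<close>

lemma ev_cmp:
  "pr_wf f \<Longrightarrow> length ts = pr_arity f \<Longrightarrow> list_all2 (\<lambda>t x. ev t [] x) ts xs \<Longrightarrow>
    ev (apps (cmp f) ts) [] (pr_eval f xs)"
proof (induction f arbitrary: ts xs)
  case (PZero n)
  then show ?case using ev_head_steps[OF lams_steps[of ts n Zero]] by (simp add: ev.Zero)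
next
  case PSucc
  then obtain t x where "ts = [t]" "xs = [x]" "ev t [] x"
    by (auto simp: length_Suc_conv list_all2_Cons1)
  then show ?case by (simp add: ev.Succ)
next
  case (PProj n i)
  have "psub (bind_env ts Var) (args 0 n ! i) = ts ! i"
    using bind_env_args[of ts n "[]"] PProj.prems by (metis append_Nil length_args nth_map pr_arity.simps(3) pr_wf.simps(3))
  then show ?case using ev_head_steps[OF lams_steps[of ts n "args 0 n ! i"]] PProj.prems
      list_all2_nthD[OF PProj.prems(3), of i] by simp
next
  case (PComp n f gs)
  have "list_all2 (\<lambda>t x. ev t [] x) (map (\<lambda>g. apps (cmp g) ts) gs) (map (\<lambda>g. pr_eval g xs) gs)"
    unfolding list_all2_map1 list_all2_map2 using PComp by (intro list.rel_refl_strong) simp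
  then have "ev (apps (cmp f) (map (\<lambda>g. apps (cmp g) ts) gs)) [] (pr_eval f (map (\<lambda>g. pr_eval g xs) gs))"
    using PComp.prems by (intro PComp.IH(1)) simp_all
  then show ?case using ev_head_steps[OF PComp_steps[OF PComp.prems(1)], of ts] PComp.prems by simp
next
  case (PRec g h)
  then obtain t ts' x xs' where ts: "ts = t # ts'" "xs = x # xs'" "ev t [] x"
    "list_all2 (\<lambda>t x. ev t [] x) ts' xs'" "length ts' = pr_arity g"
    by (auto simp: length_Suc_conv list_all2_Cons1)
  \<comment> \<open>The inner induction generalises over the term \<open>t\<close> with value
    \<open>x\<close>, because evaluation continues with the numeral of the predecessor instead of a
    subterm of \<open>t\<close>.\<close>
  have "ev (Rec \<cdot> apps (cmp g) ts' \<cdot> rec_step h ts' \<cdot> t) [] (pr_eval (PRec g h) (x # xs'))"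
    if "ev t [] x" for t x
  proof (insert that, induction x arbitrary: t)
    case 0
    then show ?case using PRec.IH(1)[of ts' xs'] PRec.prems ts by (auto intro!: ev.Rec0)
  next
    case (Suc x)
    have "ev (rec_step h ts' \<cdot> num x \<cdot> (Rec \<cdot> apps (cmp g) ts' \<cdot> rec_step h ts' \<cdot> num x)) []
        (pr_eval h (x # pr_eval (PRec g h) (x # xs') # xs'))"
      unfolding ev_head_steps[OF rec_step_steps[OF pr_wf.simps(5)[THEN iffD1, OF PRec.prems(1), THEN conjunct2, THEN conjunct1]]]
      using PRec.prems ts Suc.IH[OF ev_num] by (intro PRec.IH(2)) (simp_all add: ev_num)
    then show ?case using Suc.prems by (auto intro!: ev.RecS)
  qed
  then show ?case unfolding ts(1,2) ev_head_steps[OF PRec_steps[OF PRec.prems(1) ts(5)]]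
    using ts(3) by blast
qed

lemma finite_fv: "finite (fv t)"
proof (induction t)
  case (Lam t)
  have "fv (Lam t) = Suc -` fv t" by auto
  then show ?case using Lam by (simp add: finite_vimageI)
qed auto

lemma subst_fresh: "i \<notin> fv t \<Longrightarrow> subst i s t = t"
  unfolding subst_eq_psub by (rule trans[OF psub_cong[where \<tau> = Var] psub_Var]) auto

text \<open>Structural induction outside, the object-level induction rule inside: at a recursion the
  claim for \<open>h\<close> is used in a context enlarged by \<open>isN (Var i)\<close> and the
  induction formula, so the context must be arbitrary.\<close>

lemma D_cmp_isN:
  "pr_wf f \<Longrightarrow> length ts = pr_arity f \<Longrightarrow> (\<And>t. t \<in> set ts \<Longrightarrow> \<Gamma> \<tturnstile> isN t) \<Longrightarrow>
    \<Gamma> \<tturnstile> isN (apps (cmp f) ts)"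
proof (induction f arbitrary: ts \<Gamma>)
  case (PZero n)
  then show ?case using D_steps_isN[OF lams_steps[of ts n Zero]] rga0[OF rga_rule.Zero_isN] by simp
next
  case PSucc
  then obtain t where ts: "ts = [t]" by (auto simp: length_Suc_conv)
  have "cmp PSucc \<cdot> t \<rhd> Succ t" using head_step.beta[of "Succ (Var 0)" t] by simp
  then show ?case using PSucc(3)[of t] rga1[OF rga_rule.Succ_isN] ts
    by (auto intro: D_steps_isN[of _ "Succ t"])
next
  case (PProj n i)
  have "psub (bind_env ts Var) (args 0 n ! i) = ts ! i"
    using bind_env_args[of ts n "[]"] PProj.prems by (metis append_Nil length_args nth_map pr_arity.simps(3) pr_wf.simps(3))
  then show ?case using D_steps_isN[OF lams_steps[of ts n "args 0 n ! i"]] PProj.prems by simp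
next
  case (PComp n f gs)
  have "\<Gamma> \<tturnstile> isN (apps (cmp f) (map (\<lambda>g. apps (cmp g) ts) gs))"
    using PComp.prems by (intro PComp.IH(1)) (auto intro: PComp.IH(2))
  then show ?case using D_steps_isN[OF PComp_steps] PComp.prems by simp
next
  case (PRec g h)
  then obtain y ts' where ts: "ts = y # ts'" "length ts' = pr_arity g" by (auto simp: length_Suc_conv)
  have wf: "pr_wf g" "pr_wf h" "pr_arity h = pr_arity g + 2" using PRec.prems(1) by simp_all
  define G where "G = apps (cmp g) ts'"
  define H where "H = rec_step h ts'"
  \<comment> \<open>Freshness for the context is the side condition of the induction rule; freshness
    for the parameters ensures that substituting for \<open>i\<close> affects only the recursion
    argument.\<close>
  have "finite (\<Union> (fv ` (fset \<Gamma> \<union> set ts')))" by (simp add: finite_fv)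
  then obtain i where "i \<notin> \<Union> (fv ` (fset \<Gamma> \<union> set ts'))" using ex_new_if_finite by blast
  then have i: "\<forall>t. t |\<in>| \<Gamma> \<longrightarrow> i \<notin> fv t" "\<And>t. t \<in> set ts' \<Longrightarrow> i \<notin> fv t" by auto
  have "map (subst i s) ts' = ts'" for s using i(2) by (intro map_idI subst_fresh)
  then have GH: "subst i s G = G" "subst i s H = H" for s
    unfolding G_def H_def subst_eq_psub by (simp_all add: wf psub_rec_step)
  define c where "c = isN (Rec \<cdot> G \<cdot> H \<cdot> Var i)"
  have "\<Gamma> \<tturnstile> subst i y c"
  proof (rule rga3[OF rga_rule.induction[OF i(1)]])
    have "\<Gamma> \<tturnstile> isN G" unfolding G_def using PRec.prems ts wf by (intro PRec.IH(1)) simp_all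
    then show "\<Gamma> \<tturnstile> subst i Zero c" unfolding c_def
      by (simp add: GH) (rule D_steps_isN[OF r_into_rtranclp[of "(\<rhd>)", OF head_step.rec_Zero]])
    let ?\<Gamma> = "finsert (isN (Var i)) (finsert c \<Gamma>)"
    have "?\<Gamma> \<tturnstile> isN (apps (cmp h) (Var i # (Rec \<cdot> G \<cdot> H \<cdot> Var i) # ts'))"
    proof (rule PRec.IH(2)[OF wf(2)])
      fix t assume "t \<in> set (Var i # (Rec \<cdot> G \<cdot> H \<cdot> Var i) # ts')"
      then consider "t = Var i" | "t = Rec \<cdot> G \<cdot> H \<cdot> Var i" | "t \<in> set ts" using ts by auto
      then show "?\<Gamma> \<tturnstile> isN t"
      proof cases
        case 1
        then show ?thesis by (simp add: D_hyp)
      next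
        case 2
        then show ?thesis unfolding c_def by (simp add: D_weaken[OF D_hyp])
      next
        case 3
        then show ?thesis using PRec.prems(3) by (intro D_weaken)
      qed
    qed (simp add: wf(3) ts)
    then have "?\<Gamma> \<tturnstile> isN (H \<cdot> Var i \<cdot> (Rec \<cdot> G \<cdot> H \<cdot> Var i))"
      unfolding H_def using D_steps_isN[OF rec_step_steps[OF wf(2)]] by blast
    \<comment> \<open>The head step for successors fires at numerals only. At
      \<open>Succ (Var i)\<close> the recursion equation comes from \<open>rec_eq\<close>, whose
      termination premise has just been derived.\<close>
    then have "?\<Gamma> \<tturnstile> Rec \<cdot> G \<cdot> H \<cdot> Succ (Var i) \<doteq> H \<cdot> Var i \<cdot> (Rec \<cdot> G \<cdot> H \<cdot> Var i)"
      by (rule rga2[OF rga_rule.rec_eq D_hyp])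
    then have "?\<Gamma> \<tturnstile> isN (Rec \<cdot> G \<cdot> H \<cdot> Succ (Var i))" by (rule D_eq_isN)
    then show "?\<Gamma> \<tturnstile> subst i (Succ (Var i)) c" unfolding c_def by (simp add: GH)
    show "\<Gamma> \<tturnstile> isN y" using PRec.prems(3) ts by simp
  qed
  then have "\<Gamma> \<tturnstile> isN (Rec \<cdot> G \<cdot> H \<cdot> y)" unfolding c_def by (simp add: GH)
  then show ?case unfolding ts(1) using D_steps_isN[OF PRec_steps[OF PRec.prems(1) ts(2)]]
    by (simp add: G_def H_def)
qed


section \<open>Totality claims\<close>

lemma lift_closed: "fv t = {} \<Longrightarrow> lift k t = t"
  by (simp add: lift_eq_psub psub_closed)

lemma inst_closed: "fv t = {} \<Longrightarrow> inst k s t = t"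
  by (simp add: inst_eq_psub psub_closed)

lemma fv_rrep: "pr_wf f \<Longrightarrow> fv (rrep f) = {}"
  by (auto simp: rrep_def fv_cmp)

lemma sentence_totality_claim: "pr_wf f \<Longrightarrow> sentence (totality_claim f)"
  by (simp add: sentence_def totality_claim_def fv_rrep)

text \<open>Provable termination of \<open>cmp f\<close> makes the matrix equation Boolean, ATI
  transfers this to the inner universal, and negation and beta expansion carry it to
  \<open>rrep f \<cdot> Var 0\<close>. Generalising over the remaining variable gives exactly the
  certificate.\<close>

lemma certified_totality_claim:
  assumes "step_function f"
  shows "certified (totality_claim f)"
proof -
  have wf: "pr_wf f" "pr_arity f = 2" using assms by (simp_all add: step_function_def)
  \<comment> \<open>The inner search predicate with the input left open: \<open>Var 1\<close> under
    the binder is \<open>Var 0\<close> outside.\<close>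
  define w where "w = Lam (cmp f \<cdot> Var 1 \<cdot> Var 0 \<doteq> Zero)"
  let ?\<Gamma> = "{|isN (Var 0)|}" and ?\<Delta> = "{|isN (Var 0), isN (Var 1)|}"
  have "?\<Delta> \<tturnstile> isN (apps (cmp f) [Var 1, Var 0])"
    by (rule D_cmp_isN) (auto simp: wf intro: D_hyp D_weaken)
  then have "?\<Delta> \<tturnstile> isB (cmp f \<cdot> Var 1 \<cdot> Var 0 \<doteq> Zero)"
    by (intro rga2[OF rga_rule.eq_isB] rga0[OF rga_rule.Zero_isN]) simp
  moreover have "\<up> w \<cdot> Var 0 \<rhd> (cmp f \<cdot> Var 1 \<cdot> Var 0 \<doteq> Zero)"
    using head_step.beta[of "cmp f \<cdot> Var 2 \<cdot> Var 0 \<doteq> Zero" "Var 0"]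
    by (simp add: w_def lift_closed inst_closed fv_cmp wf numeral_2_eq_2)
  ultimately have "?\<Delta> \<tturnstile> isB (\<up> w \<cdot> Var 0)" by (rule D_isB_expand[rotated])
  then have "?\<Gamma> \<tturnstile> Forall \<cdot> Lam (isB (\<up> w \<cdot> Var 0))" by (intro D_Forall_Lam) simp
  then have "?\<Gamma> \<tturnstile> isB (Forall \<cdot> w)" by (intro oga_derivable_rule[OF oga_rule.ATI]) simp
  then have "?\<Gamma> \<tturnstile> isB (Neg (Forall \<cdot> w))" by (rule D_isB_Neg)
  moreover have "rrep f \<cdot> Var 0 \<rhd> Neg (Forall \<cdot> w)"
    using head_step.beta[of "Neg (Forall \<cdot> Lam (cmp f \<cdot> Var 1 \<cdot> Var 0 \<doteq> Zero))" "Var 0"]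
    by (simp add: rrep_def w_def inst_closed fv_cmp wf)
  ultimately have "?\<Gamma> \<tturnstile> isB (\<up> (rrep f) \<cdot> Var 0)"
    unfolding lift_closed[OF fv_rrep[OF wf(1)]] by (rule D_isB_expand[rotated])
  then have "{||} \<tturnstile> Forall \<cdot> Lam (isB (\<up> (rrep f) \<cdot> Var 0))" by (intro D_Forall_Lam) simp
  then show ?thesis by (auto simp: certified_def totality_claim_def provable_def)
qed

lemma ev_Forall_bool:
  assumes "\<And>n. ev u [num n] (of_bool (P n))"
  shows "ev Forall [u] (of_bool (\<forall>n. P n))"
proof (cases "\<forall>n. P n")
  case True
  then show ?thesis using assms by (auto intro!: ev.ForallT simp: of_bool_def)
next
  case False
  then obtain n where "\<not> P n" by blast
  then show ?thesis using False assms[of n] by (auto intro: ev.ForallF)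
qed

lemma ev_Neg_bool: "ev t [] (of_bool P) \<Longrightarrow> ev (Neg t) [] (of_bool (\<not> P))"
  by (cases P) (auto intro: ev.NegT ev.NegF)

lemma ev_Eq_bool: "ev t [] m \<Longrightarrow> ev u [] n \<Longrightarrow> ev (t \<doteq> u) [] (of_bool (m = n))"
  by (cases "m = n") (auto intro: ev.EqT ev.EqF)

lemma ev_totality_claim:
  assumes "step_function f"
  shows "ev (totality_claim f) [] (of_bool (\<forall>n. \<exists>k. pr_eval f [n, k] \<noteq> 0))"
proof -
  have wf: "pr_wf f" "pr_arity f = 2" using assms by (simp_all add: step_function_def)
  have "ev (Lam (cmp f \<cdot> num n \<cdot> Var 0 \<doteq> Zero)) [num k] (of_bool (pr_eval f [n, k] = 0))" for n k
  proof -
    have "ev (apps (cmp f) [num n, num k]) [] (pr_eval f [n, k])"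
      by (intro ev_cmp) (simp_all add: wf ev_num)
    then have "ev (cmp f \<cdot> num n \<cdot> num k \<doteq> Zero) [] (of_bool (pr_eval f [n, k] = 0))"
      by (intro ev_Eq_bool ev.Zero) simp
    then show ?thesis by (simp add: inst_closed fv_cmp wf)
  qed
  then have "ev (Neg (Forall \<cdot> Lam (cmp f \<cdot> num n \<cdot> Var 0 \<doteq> Zero))) []
      (of_bool (\<not> (\<forall>k. pr_eval f [n, k] = 0)))" for n
    by (intro ev_Neg_bool) (simp add: ev_Forall_bool)
  then have "ev (rrep f) [num n] (of_bool (\<exists>k. pr_eval f [n, k] \<noteq> 0))" for n
    by (simp add: rrep_def inst_closed lift_closed fv_cmp wf)
  then show ?thesis unfolding totality_claim_def by (simp add: ev_Forall_bool)
qed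

lemma pr_wf_diag_step:
  assumes "pr_wf D" "pr_arity D = 2"
  shows "step_function (diag_step D x)"
proof -
  have "pr_wf (pr_const 2 x) \<and> pr_arity (pr_const 2 x) = 2" by (induction x) simp_all
  then show ?thesis using assms by (simp add: step_function_def diag_step_def)
qed

lemma pr_eval_diag_step: "pr_eval (diag_step D x) [n, k] = pr_eval D [x, n]"
proof -
  have "pr_eval (pr_const 2 x) [n, k] = x" by (induction x) simp_all
  then show ?thesis by (simp add: diag_step_def)
qed

lemma ev_totality_claim_diag:
  assumes "pr_wf D" "pr_arity D = 2"
  shows "ev (totality_claim (diag_step D x)) [] (of_bool (\<forall>n. pr_eval D [x, n] \<noteq> 0))"
  using ev_totality_claim[OF pr_wf_diag_step[OF assms]] by (simp add: pr_eval_diag_step)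

lemma genuine_fiction_totality_claim:
  assumes "step_function f" "\<not> provable (totality_claim f)" "\<not> refutable (totality_claim f)"
  shows "genuine_fiction (totality_claim f)" "has_pedigree (totality_claim f) {totality_claim f}"
proof -
  let ?G = "totality_claim f"
  have *: "?G \<leadsto> atom ?G"
    using certified_totality_claim[OF assms(1)] unfolding totality_claim_def by (rule fafi_value.atom)
  then show "genuine_fiction ?G"
    using assms sentence_totality_claim by (auto simp: genuine_fiction_def step_function_def)
  have "p = atom ?G" if "?G \<leadsto> p" for p
    using that assms(2,3) unfolding totality_claim_def by (cases rule: fafi_value.cases) simp_all
  moreover have "support (atom ?G) = {?G}" by (auto simp: support_def atom.rep_eq)
  then have "value_pedigree (atom ?G) = {?G}" using assms(2,3) by (auto simp: value_pedigree_def)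
  ultimately show "has_pedigree ?G {?G}" unfolding has_pedigree_def using * by metis
qed


section \<open>Primitive recursive functions\<close>

definition prim :: "nat \<Rightarrow> (nat list \<Rightarrow> nat) \<Rightarrow> bool" where
  "prim n f \<longleftrightarrow> (\<exists>T. pr_wf T \<and> pr_arity T = n \<and> (\<forall>xs. length xs = n \<longrightarrow> pr_eval T xs = f xs))"

lemma prim_cong: "prim n f \<Longrightarrow> (\<And>xs. length xs = n \<Longrightarrow> f xs = g xs) \<Longrightarrow> prim n g"
  unfolding prim_def by metis

lemma prim_nth: "i < n \<Longrightarrow> prim n (\<lambda>xs. xs ! i)"
  unfolding prim_def by (intro exI[of _ "PProj n i"]) simp

lemma prim_zero: "prim n (\<lambda>xs. 0)"
  unfolding prim_def by (intro exI[of _ "PZero n"]) simp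

lemma prim_comp:
  assumes "prim (length fs) h" "\<And>f. f \<in> set fs \<Longrightarrow> prim n f"
  shows "prim n (\<lambda>xs. h (map (\<lambda>f. f xs) fs))"
proof -
  obtain H where H: "pr_wf H" "pr_arity H = length fs"
    "\<And>xs. length xs = length fs \<Longrightarrow> pr_eval H xs = h xs"
    using assms(1) unfolding prim_def by blast
  obtain T where T: "\<And>f. f \<in> set fs \<Longrightarrow> pr_wf (T f) \<and> pr_arity (T f) = n \<and>
      (\<forall>xs. length xs = n \<longrightarrow> pr_eval (T f) xs = f xs)"
    using assms(2) unfolding prim_def by metis
  have "pr_eval (PComp n H (map T fs)) xs = h (map (\<lambda>f. f xs) fs)" if "length xs = n" for xs
  proof -
    have "map (\<lambda>g. pr_eval g xs) (map T fs) = map (\<lambda>f. f xs) fs" using T that by simp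
    then show ?thesis using H(3) by (simp del: map_map)
  qed
  then show ?thesis using H T unfolding prim_def by (intro exI[of _ "PComp n H (map T fs)"]) auto
qed

lemma prim_Suc: "prim n f \<Longrightarrow> prim n (\<lambda>xs. Suc (f xs))"
proof -
  have "prim 1 (\<lambda>xs. Suc (hd xs))" unfolding prim_def by (intro exI[of _ PSucc]) simp
  then show "prim n f \<Longrightarrow> ?thesis" using prim_comp[of "[f]" "\<lambda>xs. Suc (hd xs)" n] by simp
qed

lemma prim_const: "prim n (\<lambda>xs. k)"
  by (induction k) (simp_all add: prim_zero prim_Suc)

lemma prim_comp1: "prim 1 (\<lambda>xs. h (xs ! 0)) \<Longrightarrow> prim n f \<Longrightarrow> prim n (\<lambda>xs. h (f xs))"
  using prim_comp[of "[f]" "\<lambda>xs. h (xs ! 0)" n] by simp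

lemma prim_comp2:
  "prim 2 (\<lambda>xs. h (xs ! 0) (xs ! 1)) \<Longrightarrow> prim n f \<Longrightarrow> prim n g \<Longrightarrow> prim n (\<lambda>xs. h (f xs) (g xs))"
  using prim_comp[of "[f, g]" "\<lambda>xs. h (xs ! 0) (xs ! 1)" n] by (auto simp: numeral_2_eq_2)

lemma prim_rec:
  assumes "prim n f" "prim n g" "prim (Suc (Suc n)) h"
  shows "prim n (\<lambda>xs. rec_nat (g xs) (\<lambda>m r. h (m # r # xs)) (f xs))"
proof -
  obtain G H where GH: "pr_wf G" "pr_arity G = n" "\<And>xs. length xs = n \<Longrightarrow> pr_eval G xs = g xs"
    "pr_wf H" "pr_arity H = Suc (Suc n)" "\<And>xs. length xs = Suc (Suc n) \<Longrightarrow> pr_eval H xs = h xs"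
    using assms(2,3) unfolding prim_def by blast
  have rec: "prim (Suc n) (\<lambda>xs. rec_nat (g (tl xs)) (\<lambda>m r. h (m # r # tl xs)) (hd xs))"
    unfolding prim_def by (rule exI[of _ "PRec G H"]) (simp add: GH)
  let ?R = "\<lambda>xs. rec_nat (g (tl xs)) (\<lambda>m r. h (m # r # tl xs)) (hd xs)"
  \<comment> \<open>\<open>PRec\<close> recurses on its first argument; \<open>f\<close> is put
    there, and the projections restore the full list as parameters.\<close>
  let ?fs = "f # map (\<lambda>i xs. xs ! i) [0..<n]"
  have "prim n (\<lambda>xs. ?R (map (\<lambda>f. f xs) ?fs))"
  proof (rule prim_comp)
    show "prim (length ?fs) ?R" using rec by simp
    show "prim n f'" if "f' \<in> set ?fs" for f' using that assms(1) by (auto intro: prim_nth)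
  qed
  then show ?thesis by (rule prim_cong) (auto simp: comp_def map_nth)
qed

text \<open>A recursion step that ignores the previous result distinguishes zero from
  successors.\<close>

lemma prim_case:
  assumes "prim n f"
  shows "prim n (\<lambda>xs. 1 - f xs)" "prim n (\<lambda>xs. f xs - 1)"
proof -
  have "prim n (\<lambda>xs. rec_nat 1 (\<lambda>m r. (\<lambda>ys. 0) (m # r # xs)) (f xs))"
    by (intro prim_rec assms prim_const)
  moreover have "rec_nat 1 (\<lambda>m r. 0) k = 1 - k" for k :: nat by (cases k) simp_all
  ultimately show "prim n (\<lambda>xs. 1 - f xs)" by (elim prim_cong) simp
  have "prim n (\<lambda>xs. rec_nat 0 (\<lambda>m r. (\<lambda>ys. ys ! 0) (m # r # xs)) (f xs))"
    by (intro prim_rec assms prim_const prim_nth) simp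
  moreover have "rec_nat 0 (\<lambda>m r. m) k = k - 1" for k :: nat by (cases k) simp_all
  ultimately show "prim n (\<lambda>xs. f xs - 1)" by (elim prim_cong) simp
qed

lemma prim_add: "prim n f \<Longrightarrow> prim n g \<Longrightarrow> prim n (\<lambda>xs. f xs + g xs)"
proof (rule prim_comp2[where h = "(+)"])
  have "prim 2 (\<lambda>xs. rec_nat (xs ! 0) (\<lambda>m r. (\<lambda>ys. Suc (ys ! 1)) (m # r # xs)) (xs ! 1))"
    by (intro prim_rec prim_Suc prim_nth) simp_all
  moreover have "rec_nat a (\<lambda>m r. Suc r) b = a + b" for a b by (induction b) simp_all
  ultimately show "prim 2 (\<lambda>xs. xs ! 0 + xs ! 1)" by simp
qed

lemma prim_diff: "prim n f \<Longrightarrow> prim n g \<Longrightarrow> prim n (\<lambda>xs. f xs - g xs)"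
proof (rule prim_comp2[where h = "(-)"])
  have "prim 2 (\<lambda>xs. rec_nat (xs ! 0) (\<lambda>m r. (\<lambda>ys. ys ! 1 - 1) (m # r # xs)) (xs ! 1))"
    by (intro prim_rec prim_case prim_nth) simp_all
  moreover have "rec_nat a (\<lambda>m r. r - Suc 0) b = a - b" for a b by (induction b) simp_all
  ultimately show "prim 2 (\<lambda>xs. xs ! 0 - xs ! 1)" by simp
qed

lemma prim_mult: "prim n f \<Longrightarrow> prim n g \<Longrightarrow> prim n (\<lambda>xs. f xs * g xs)"
proof (rule prim_comp2[where h = "(*)"])
  have "prim 2 (\<lambda>xs. rec_nat 0 (\<lambda>m r. (\<lambda>ys. ys ! 1 + ys ! 2) (m # r # xs)) (xs ! 1))"
    by (intro prim_rec prim_add prim_nth prim_const) simp_all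
  moreover have "rec_nat 0 (\<lambda>m r. r + a) b = a * b" for a b :: nat by (induction b) simp_all
  ultimately show "prim 2 (\<lambda>xs. xs ! 0 * xs ! 1)" by simp
qed

lemma prim_triangle: "prim n f \<Longrightarrow> prim n (\<lambda>xs. triangle (f xs))"
proof (rule prim_comp1[where h = triangle])
  have "prim 1 (\<lambda>xs. rec_nat 0 (\<lambda>m r. (\<lambda>ys. ys ! 1 + Suc (ys ! 0)) (m # r # xs)) (xs ! 0))"
    by (intro prim_rec prim_add prim_Suc prim_nth prim_const) simp_all
  moreover have "rec_nat 0 (\<lambda>m r. r + Suc m) b = triangle b" for b :: nat
    by (induction b) simp_all
  ultimately show "prim 1 (\<lambda>xs. triangle (xs ! 0))" by simp
qed

section \<open>Cantor pairing and its inverses\<close>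

definition pair :: "nat \<Rightarrow> nat \<Rightarrow> nat" where "pair a b = prod_encode (a, b)"
definition pfst :: "nat \<Rightarrow> nat" where "pfst z = fst (prod_decode z)"
definition psnd :: "nat \<Rightarrow> nat" where "psnd z = snd (prod_decode z)"

lemma pair_simps [simp]: "pfst (pair a b) = a" "psnd (pair a b) = b" "pair (pfst z) (psnd z) = z"
  by (simp_all add: pair_def pfst_def psnd_def)

lemma pair_eq_iff [simp]: "pair a b = pair c d \<longleftrightarrow> a = c \<and> b = d"
  by (metis pair_simps(1,2))

text \<open>The index \<open>a + b\<close> of the diagonal on which Cantor's enumeration puts \<open>pair a b\<close>.\<close>

definition diagonal :: "nat \<Rightarrow> nat" where
  "diagonal z = rec_nat 0 (\<lambda>m w. w + (1 - (triangle (Suc w) - Suc m))) z"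

lemma triangle_mono: "m \<le> n \<Longrightarrow> triangle m \<le> triangle n"
  by (induction n rule: dec_induct) simp_all

lemma diagonal_bounds: "triangle (diagonal z) \<le> z \<and> z < triangle (Suc (diagonal z))"
proof (induction z)
  case 0
  show ?case by (simp add: diagonal_def)
next
  case (Suc z)
  define w where "w = diagonal z"
  have "diagonal (Suc z) = w + (1 - (triangle (Suc w) - Suc z))"
    by (simp add: diagonal_def w_def)
  \<comment> \<open>By the induction hypothesis \<open>Suc z\<close> is at most
    \<open>triangle (Suc w)\<close>, so the truncated difference vanishes exactly at equality, where
    the next diagonal begins.\<close>
  also have "\<dots> = (if triangle (Suc w) = Suc z then Suc w else w)"
    using Suc unfolding w_def by auto
  finally show ?case using Suc unfolding w_def[symmetric] by auto
qed

text \<open>Both sides index the interval between consecutive triangular numbers that contains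
  \<open>pair a b\<close>, and there is only one such interval.\<close>

lemma diagonal_pair: "diagonal (pair a b) = a + b"
proof -
  have *: "triangle (a + b) \<le> pair a b" "pair a b < triangle (Suc (a + b))"
    by (simp_all add: pair_def prod_encode_def)
  have "m \<le> n" if "triangle m \<le> pair a b" "pair a b < triangle (Suc n)" for m n
    using that triangle_mono[of "Suc n" m] by (meson not_less_eq_eq leD le_trans)
  from this[OF *(1)] this[OF _ *(2)] show ?thesis
    using diagonal_bounds[of "pair a b"] by (simp add: le_antisym)
qed

lemma pfst_eq: "pfst z = z - triangle (diagonal z)" and psnd_eq: "psnd z = diagonal z - pfst z"
proof -
  obtain a b where "z = pair a b" by (metis pair_simps(3))
  then show "pfst z = z - triangle (diagonal z)" "psnd z = diagonal z - pfst z"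
    by (simp_all add: diagonal_pair) (simp add: pair_def prod_encode_def)
qed

lemma prim_pair: "prim n f \<Longrightarrow> prim n g \<Longrightarrow> prim n (\<lambda>xs. pair (f xs) (g xs))"
  unfolding pair_def prod_encode_def by (simp add: prim_add prim_triangle)

lemma prim_diagonal: "prim n f \<Longrightarrow> prim n (\<lambda>xs. diagonal (f xs))"
proof (rule prim_comp1[where h = diagonal])
  have "prim 1 (\<lambda>xs. rec_nat 0 (\<lambda>m r. (\<lambda>ys. ys ! 1 + (1 - (triangle (Suc (ys ! 1)) - Suc (ys ! 0))))
      (m # r # xs)) (xs ! 0))"
    by (intro prim_rec prim_add prim_diff prim_triangle prim_Suc prim_nth prim_const) simp_all
  then show "prim 1 (\<lambda>xs. diagonal (xs ! 0))" by (simp add: diagonal_def)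
qed

lemma prim_pfst: "prim n f \<Longrightarrow> prim n (\<lambda>xs. pfst (f xs))"
  unfolding pfst_eq by (intro prim_diff prim_triangle prim_diagonal)

lemma prim_psnd: "prim n f \<Longrightarrow> prim n (\<lambda>xs. psnd (f xs))"
  unfolding psnd_eq by (intro prim_diff prim_pfst prim_diagonal)

text \<open>Unary functions suffice, since several arguments can be packed into one by \<open>pair\<close>.\<close>

definition PR :: "(nat \<Rightarrow> nat) \<Rightarrow> bool" where "PR f \<longleftrightarrow> prim 1 (\<lambda>xs. f (xs ! 0))"

named_theorems PR_intros

lemma prim_PR: "PR h \<Longrightarrow> prim n f \<Longrightarrow> prim n (\<lambda>xs. h (f xs))"
  unfolding PR_def by (rule prim_comp1)

lemma PR_id [PR_intros]: "PR (\<lambda>x. x)"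
  unfolding PR_def by (simp add: prim_nth)

lemma PR_const [PR_intros]: "PR (\<lambda>x. k)"
  unfolding PR_def by (rule prim_const)

lemma PR_Suc [PR_intros]: "PR f \<Longrightarrow> PR (\<lambda>x. Suc (f x))"
  unfolding PR_def by (rule prim_Suc)

lemma PR_add [PR_intros]: "PR f \<Longrightarrow> PR g \<Longrightarrow> PR (\<lambda>x. f x + g x)"
  unfolding PR_def by (rule prim_add)

lemma PR_diff [PR_intros]: "PR f \<Longrightarrow> PR g \<Longrightarrow> PR (\<lambda>x. f x - g x)"
  unfolding PR_def by (rule prim_diff)

lemma PR_mult [PR_intros]: "PR f \<Longrightarrow> PR g \<Longrightarrow> PR (\<lambda>x. f x * g x)"
  unfolding PR_def by (rule prim_mult)

lemma PR_pair [PR_intros]: "PR f \<Longrightarrow> PR g \<Longrightarrow> PR (\<lambda>x. pair (f x) (g x))"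
  unfolding PR_def by (rule prim_pair)

lemma PR_pfst [PR_intros]: "PR f \<Longrightarrow> PR (\<lambda>x. pfst (f x))"
  unfolding PR_def by (rule prim_pfst)

lemma PR_psnd [PR_intros]: "PR f \<Longrightarrow> PR (\<lambda>x. psnd (f x))"
  unfolding PR_def by (rule prim_psnd)

lemma PR_comp: "PR h \<Longrightarrow> PR f \<Longrightarrow> PR (\<lambda>x. h (f x))"
  unfolding PR_def by (rule prim_comp1)

lemma PR_rec:
  assumes "PR f" "PR g" "PR (\<lambda>p. h (pfst p) (pfst (psnd p)) (psnd (psnd p)))"
  shows "PR (\<lambda>x. rec_nat (g x) (\<lambda>m r. h m r x) (f x))"
proof -
  have "prim 3 (\<lambda>ys. (\<lambda>p. h (pfst p) (pfst (psnd p)) (psnd (psnd p)))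
      (pair (ys ! 0) (pair (ys ! 1) (ys ! 2))))"
    by (intro prim_PR[OF assms(3)] prim_pair prim_nth) simp_all
  then have "prim 3 (\<lambda>ys. h (ys ! 0) (ys ! 1) (ys ! 2))" by simp
  then have "prim 1 (\<lambda>xs. rec_nat (g (xs ! 0))
      (\<lambda>m r. (\<lambda>ys. h (ys ! 0) (ys ! 1) (ys ! 2)) (m # r # xs)) (f (xs ! 0)))"
    using assms(1,2) unfolding PR_def by (intro prim_rec) (simp_all add: numeral_3_eq_3)
  then show ?thesis unfolding PR_def by (simp add: numeral_2_eq_2)
qed

section \<open>Primitive recursive predicates\<close>

definition dec :: "(nat \<Rightarrow> bool) \<Rightarrow> bool" where "dec P \<longleftrightarrow> PR (\<lambda>x. of_bool (P x))"

lemma dec_comp: "dec P \<Longrightarrow> PR f \<Longrightarrow> dec (\<lambda>x. P (f x))"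
  unfolding dec_def by (rule PR_comp)

lemma dec_not: "dec P \<Longrightarrow> dec (\<lambda>x. \<not> P x)"
proof -
  assume "dec P"
  then have "PR (\<lambda>x. 1 - of_bool (P x))" unfolding dec_def by (intro PR_intros)
  moreover have "1 - of_bool b = (of_bool (\<not> b) :: nat)" for b by simp
  ultimately show ?thesis unfolding dec_def by simp
qed

lemma dec_conj: "dec P \<Longrightarrow> dec Q \<Longrightarrow> dec (\<lambda>x. P x \<and> Q x)"
  unfolding dec_def of_bool_conj by (rule PR_mult)

lemma dec_disj: "dec P \<Longrightarrow> dec Q \<Longrightarrow> dec (\<lambda>x. P x \<or> Q x)"
  using dec_not[OF dec_conj[OF dec_not dec_not]] by simp

lemma dec_le: "PR f \<Longrightarrow> PR g \<Longrightarrow> dec (\<lambda>x. f x \<le> g x)"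
proof -
  assume "PR f" "PR g"
  then have "PR (\<lambda>x. 1 - (f x - g x))" by (intro PR_intros)
  moreover have "1 - (a - b) = (of_bool (a \<le> b) :: nat)" for a b :: nat by simp
  ultimately show ?thesis unfolding dec_def by simp
qed

lemma dec_less: "PR f \<Longrightarrow> PR g \<Longrightarrow> dec (\<lambda>x. f x < g x)"
  using dec_not[OF dec_le] by (simp add: not_le)

lemma dec_eq: "PR f \<Longrightarrow> PR g \<Longrightarrow> dec (\<lambda>x. f x = g x)"
  using dec_conj[OF dec_le dec_le] by (simp add: eq_iff)

text \<open>Truth values are multiplied along a recursion up to the bound.\<close>

lemma dec_ball:
  assumes "PR f" "dec (\<lambda>p. P (pfst p) (psnd p))"
  shows "dec (\<lambda>x. \<forall>i<f x. P x i)"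
proof -
  have "dec (\<lambda>p. P (psnd (psnd p)) (pfst p))"
    using dec_comp[OF assms(2), of "\<lambda>p. pair (psnd (psnd p)) (pfst p)"] by (simp add: PR_intros)
  then have "PR (\<lambda>x. rec_nat 1 (\<lambda>m r. r * of_bool (P x m)) (f x))"
    using assms(1) unfolding dec_def by (intro PR_rec PR_intros)
  moreover have "rec_nat 1 (\<lambda>m r. r * of_bool (P x m)) n = (of_bool (\<forall>i<n. P x i) :: nat)" for x n
    by (induction n) (auto simp: less_Suc_eq)
  ultimately show ?thesis unfolding dec_def by simp
qed

text \<open>Every number codes an infinite sequence, so decoding needs no side conditions.\<close>

definition at :: "nat \<Rightarrow> nat \<Rightarrow> nat" where "at c i = pfst ((psnd ^^ i) c)"

lemma at_pair [simp]: "at (pair a c) 0 = a" "at (pair a c) (Suc i) = at c i"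
  by (simp_all add: at_def funpow_Suc_right del: funpow.simps)

lemma at_surj: "\<exists>c. \<forall>i<n. at c i = f i"
proof (induction n arbitrary: f)
  case (Suc n)
  from Suc[of "\<lambda>i. f (Suc i)"] obtain c where c: "\<forall>i<n. at c i = f (Suc i)" by blast
  have "at (pair (f 0) c) i = f i" if "i < Suc n" for i using c that by (cases i) simp_all
  then show ?case by blast
qed simp

lemma PR_at [PR_intros]: "PR f \<Longrightarrow> PR g \<Longrightarrow> PR (\<lambda>x. at (f x) (g x))"
proof -
  assume "PR f" "PR g"
  then have "PR (\<lambda>x. pfst (rec_nat (f x) (\<lambda>m r. psnd r) (g x)))" by (intro PR_rec PR_intros)
  moreover have "rec_nat a (\<lambda>m r. psnd r) n = (psnd ^^ n) a" for a n by (induction n) simp_all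
  ultimately show ?thesis by (simp add: at_def)
qed

text \<open>The number \<open>pair n c\<close> codes the list \<open>at c 0, \<dots>, at c (n - 1)\<close>.\<close>

definition members :: "nat \<Rightarrow> nat set" where "members l = at (psnd l) ` {..<pfst l}"

definition lnil :: nat where "lnil = pair 0 0"
definition lcons :: "nat \<Rightarrow> nat \<Rightarrow> nat" where "lcons a l = pair (Suc (pfst l)) (pair a (psnd l))"

lemma members_simps [simp]: "members lnil = {}" "members (lcons a l) = insert a (members l)"
  by (simp_all add: members_def lnil_def lcons_def lessThan_Suc_eq_insert_0 image_image)

lemma members_surj: "finite A \<Longrightarrow> \<exists>l. members l = A"
  by (induction rule: finite_induct) (metis members_simps)+

lemma PR_lcons [PR_intros]: "PR f \<Longrightarrow> PR g \<Longrightarrow> PR (\<lambda>x. lcons (f x) (g x))"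
  unfolding lcons_def by (intro PR_intros)


section \<open>Recursively enumerable predicates and enumeration operators\<close>

definition RE :: "(nat \<Rightarrow> bool) \<Rightarrow> bool" where
  "RE P \<longleftrightarrow> (\<exists>Q. dec Q \<and> (\<forall>x. P x \<longleftrightarrow> (\<exists>z. Q (pair x z))))"

named_theorems RE_intros

lemma RE_dec: "dec P \<Longrightarrow> RE P"
  unfolding RE_def by (rule exI[of _ "\<lambda>p. P (pfst p)"]) (simp add: dec_comp PR_intros)

lemma RE_comp: "RE P \<Longrightarrow> PR f \<Longrightarrow> RE (\<lambda>x. P (f x))"
proof -
  assume "RE P" "PR f"
  then obtain Q where "dec Q" "\<And>x. P x \<longleftrightarrow> (\<exists>z. Q (pair x z))" unfolding RE_def by blast
  moreover from \<open>dec Q\<close> have "dec (\<lambda>p. Q (pair (f (pfst p)) (psnd p)))"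
    by (rule dec_comp) (intro PR_intros PR_comp[OF \<open>PR f\<close>])
  ultimately show ?thesis unfolding RE_def
    by (intro exI[of _ "\<lambda>p. Q (pair (f (pfst p)) (psnd p))"]) simp
qed

lemma RE_eq [RE_intros]: "PR f \<Longrightarrow> PR g \<Longrightarrow> RE (\<lambda>x. f x = g x)"
  by (intro RE_dec dec_eq)

lemma RE_less [RE_intros]: "PR f \<Longrightarrow> PR g \<Longrightarrow> RE (\<lambda>x. f x < g x)"
  by (intro RE_dec dec_less)

lemma RE_le [RE_intros]: "PR f \<Longrightarrow> PR g \<Longrightarrow> RE (\<lambda>x. f x \<le> g x)"
  by (intro RE_dec dec_le)

lemma RE_ex [RE_intros]:
  assumes "RE (\<lambda>p. P (pfst p) (psnd p))"
  shows "RE (\<lambda>x. \<exists>y. P x y)"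
proof -
  obtain Q where Q: "dec Q" "\<And>p. P (pfst p) (psnd p) \<longleftrightarrow> (\<exists>z. Q (pair p z))"
    using assms unfolding RE_def by blast
  have "dec (\<lambda>p. Q (pair (pair (pfst p) (pfst (psnd p))) (psnd (psnd p))))"
    using Q(1) by (rule dec_comp) (intro PR_intros)
  moreover have "(\<exists>y. P x y) \<longleftrightarrow> (\<exists>z. Q (pair (pair x (pfst z)) (psnd z)))" for x
    using Q(2)[of "pair x _"] by simp (metis pair_simps(1,2))
  ultimately show ?thesis unfolding RE_def
    by (intro exI[of _ "\<lambda>p. Q (pair (pair (pfst p) (pfst (psnd p))) (psnd (psnd p)))"]) simp
qed

lemma RE_conj [RE_intros]:
  assumes "RE P" "RE P'"
  shows "RE (\<lambda>x. P x \<and> P' x)"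
proof -
  obtain Q Q' where Q: "dec Q" "\<And>x. P x \<longleftrightarrow> (\<exists>z. Q (pair x z))"
    "dec Q'" "\<And>x. P' x \<longleftrightarrow> (\<exists>z. Q' (pair x z))"
    using assms unfolding RE_def by blast
  have "RE (\<lambda>x. \<exists>z z'. Q (pair x z) \<and> Q' (pair x z'))"
    by (intro RE_ex RE_dec dec_conj dec_comp[OF Q(1)] dec_comp[OF Q(3)] PR_intros)
  then show ?thesis using Q(2,4) by simp
qed

lemma RE_disj [RE_intros]:
  assumes "RE P" "RE P'"
  shows "RE (\<lambda>x. P x \<or> P' x)"
proof -
  obtain Q Q' where Q: "dec Q" "\<And>x. P x \<longleftrightarrow> (\<exists>z. Q (pair x z))"
    "dec Q'" "\<And>x. P' x \<longleftrightarrow> (\<exists>z. Q' (pair x z))"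
    using assms unfolding RE_def by blast
  have "RE (\<lambda>x. \<exists>z. Q (pair x z) \<or> Q' (pair x z))"
    by (intro RE_ex RE_dec dec_disj dec_comp[OF Q(1)] dec_comp[OF Q(3)] PR_intros)
  then show ?thesis using Q(2,4) by (simp add: ex_disj_distrib)
qed

text \<open>Finitely many witnesses fit into one sequence code, so the existential quantifier moves
  in front of the bounded universal one, leaving a primitive recursive matrix.\<close>

lemma RE_ball [RE_intros]:
  assumes "PR f" "RE (\<lambda>p. P (pfst p) (psnd p))"
  shows "RE (\<lambda>x. \<forall>i<f x. P x i)"
proof -
  obtain Q where Q: "dec Q" "\<And>p. P (pfst p) (psnd p) \<longleftrightarrow> (\<exists>z. Q (pair p z))"
    using assms(2) unfolding RE_def by blast
  have "RE (\<lambda>x. \<exists>c. \<forall>i<f x. Q (pair (pair x i) (at c i)))"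
    by (intro RE_ex RE_dec dec_ball dec_comp[OF Q(1)] PR_intros PR_comp[OF assms(1)])
  moreover have "(\<exists>c. \<forall>i<f x. Q (pair (pair x i) (at c i))) \<longleftrightarrow> (\<forall>i<f x. P x i)" for x
  proof
    assume "\<forall>i<f x. P x i"
    then have "\<forall>i<f x. \<exists>z. Q (pair (pair x i) z)" using Q(2)[of "pair x _"] by simp
    then obtain g where "\<forall>i<f x. Q (pair (pair x i) (g i))" by metis
    then show "\<exists>c. \<forall>i<f x. Q (pair (pair x i) (at c i))" using at_surj[of "f x" g] by metis
  qed (use Q(2)[of "pair x _"] in auto)
  ultimately show ?thesis by simp
qed

lemma RE_members [RE_intros]: "PR f \<Longrightarrow> PR g \<Longrightarrow> RE (\<lambda>x. f x \<in> members (g x))"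
  unfolding members_def image_iff Bex_def lessThan_iff
  by (intro RE_intros PR_intros) (auto intro!: PR_comp[of f] PR_comp[of g] PR_intros)

lemma RE_ball_members [RE_intros]:
  assumes "PR f" "RE (\<lambda>p. P (pfst p) (psnd p))"
  shows "RE (\<lambda>x. \<forall>a\<in>members (f x). P x a)"
proof -
  have "RE (\<lambda>x. \<forall>i<pfst (f x). P x (at (psnd (f x)) i))"
    using RE_comp[OF assms(2), of "\<lambda>p. pair (pfst p) (at (psnd (f (pfst p))) (psnd p))"]
    by (intro RE_ball PR_intros assms(1)) (simp add: PR_intros PR_comp[OF assms(1)])
  moreover have "(\<forall>i<pfst (f x). P x (at (psnd (f x)) i)) \<longleftrightarrow> (\<forall>a\<in>members (f x). P x a)" for x
    by (auto simp: members_def)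
  ultimately show ?thesis by simp
qed

text \<open>Enumeration operators: membership in \<open>F S\<close> is witnessed by finitely many members of \<open>S\<close>.\<close>

definition EO :: "((nat \<Rightarrow> bool) \<Rightarrow> nat \<Rightarrow> bool) \<Rightarrow> bool" where
  "EO F \<longleftrightarrow> (\<exists>Q. RE Q \<and> (\<forall>S x. F S x \<longleftrightarrow> (\<exists>w. Q (pair x w) \<and> (\<forall>a\<in>members w. S a))))"

lemma EO_I:
  "RE Q \<Longrightarrow> (\<And>S x. F S x \<longleftrightarrow> (\<exists>w. Q (pair x w) \<and> (\<forall>a\<in>members w. S a))) \<Longrightarrow> EO F"
  unfolding EO_def by (intro exI[of _ Q]) simp

named_theorems EO_intros

lemma EO_RE: "RE P \<Longrightarrow> EO (\<lambda>S. P)"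
proof -
  assume P: "RE P"
  have "P x \<longleftrightarrow> (\<exists>w. P (pfst (pair x w)) \<and> (\<forall>a\<in>members w. S a))" for S x
    using members_simps(1) by (auto intro!: exI[of _ lnil])
  then show ?thesis using P unfolding EO_def
    by (intro exI[of _ "\<lambda>p. P (pfst p)"]) (simp add: RE_comp PR_intros)
qed

lemma EO_app [EO_intros]: "PR f \<Longrightarrow> EO (\<lambda>S x. S (f x))"
proof -
  assume f: "PR f"
  have "S (f x) \<longleftrightarrow> (\<exists>w. f (pfst (pair x w)) \<in> members (psnd (pair x w)) \<and> (\<forall>a\<in>members w. S a))"
    for S x
    by (auto intro!: exI[of _ "lcons (f x) lnil"])
  then show ?thesis unfolding EO_def
    by (intro exI[of _ "\<lambda>p. f (pfst p) \<in> members (psnd p)"] conjI RE_intros PR_intros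
        PR_comp[OF f]) simp
qed

lemma EO_ex [EO_intros]:
  assumes "EO (\<lambda>S p. F S (pfst p) (psnd p))"
  shows "EO (\<lambda>S x. \<exists>y. F S x y)"
proof -
  obtain Q where Q: "RE Q"
    "\<And>S p. F S (pfst p) (psnd p) \<longleftrightarrow> (\<exists>w. Q (pair p w) \<and> (\<forall>a\<in>members w. S a))"
    using assms unfolding EO_def by blast
  have "RE (\<lambda>p. \<exists>y. Q (pair (pair (pfst p) y) (psnd p)))"
    by (intro RE_ex RE_comp[OF Q(1)] PR_intros)
  moreover have "(\<exists>y. F S x y) \<longleftrightarrow> (\<exists>w. (\<exists>y. Q (pair (pair x y) w)) \<and> (\<forall>a\<in>members w. S a))" for S x
    using Q(2)[of S "pair x _"] by auto
  ultimately show ?thesis unfolding EO_def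
    by (intro exI[of _ "\<lambda>p. \<exists>y. Q (pair (pair (pfst p) y) (psnd p))"]) simp
qed

lemma EO_disj [EO_intros]:
  assumes "EO F" "EO F'"
  shows "EO (\<lambda>S x. F S x \<or> F' S x)"
proof -
  obtain Q where Q: "RE Q" "\<And>S x. F S x \<longleftrightarrow> (\<exists>w. Q (pair x w) \<and> (\<forall>a\<in>members w. S a))"
    using assms(1) unfolding EO_def by blast
  obtain Q' where Q': "RE Q'" "\<And>S x. F' S x \<longleftrightarrow> (\<exists>w. Q' (pair x w) \<and> (\<forall>a\<in>members w. S a))"
    using assms(2) unfolding EO_def by blast
  have "F S x \<or> F' S x \<longleftrightarrow> (\<exists>w. (Q (pair x w) \<or> Q' (pair x w)) \<and> (\<forall>a\<in>members w. S a))" for S x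
    unfolding Q(2) Q'(2) by blast
  then show ?thesis by (rule EO_I[OF RE_disj[OF Q(1) Q'(1)]])
qed

lemma EO_conj [EO_intros]:
  assumes "EO F" "EO F'"
  shows "EO (\<lambda>S x. F S x \<and> F' S x)"
proof -
  obtain Q where Q: "RE Q" "\<And>S x. F S x \<longleftrightarrow> (\<exists>w. Q (pair x w) \<and> (\<forall>a\<in>members w. S a))"
    using assms(1) unfolding EO_def by blast
  obtain Q' where Q': "RE Q'" "\<And>S x. F' S x \<longleftrightarrow> (\<exists>w. Q' (pair x w) \<and> (\<forall>a\<in>members w. S a))"
    using assms(2) unfolding EO_def by blast
  \<comment> \<open>Demanding only that \<open>w\<close> contain both witness lists avoids computing
    a union of coded lists; inclusion is already recursively enumerable.\<close>
  define R where "R x w \<longleftrightarrow> (\<exists>u v. Q (pair x u) \<and> Q' (pair x v) \<and>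
    (\<forall>a\<in>members u. a \<in> members w) \<and> (\<forall>a\<in>members v. a \<in> members w))" for x w
  have "RE (\<lambda>p. R (pfst p) (psnd p))" unfolding R_def
    by (intro RE_intros RE_comp[OF Q(1)] RE_comp[OF Q'(1)] PR_intros)
  moreover have "F S x \<and> F' S x \<longleftrightarrow> (\<exists>w. R x w \<and> (\<forall>a\<in>members w. S a))" for S x
  proof
    assume "F S x \<and> F' S x"
    then obtain u v where uv: "Q (pair x u)" "\<forall>a\<in>members u. S a" "Q' (pair x v)" "\<forall>a\<in>members v. S a"
      unfolding Q(2) Q'(2) by blast
    have "finite (members u \<union> members v)" by (simp add: members_def)
    then obtain w where w: "members w = members u \<union> members v" using members_surj by metis
    have "R x w" unfolding R_def w using uv(1,3) by (intro exI[of _ u] exI[of _ v]) simp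
    then show "\<exists>w. R x w \<and> (\<forall>a\<in>members w. S a)" using uv(2,4) w by (intro exI[of _ w]) auto
  next
    assume "\<exists>w. R x w \<and> (\<forall>a\<in>members w. S a)"
    then show "F S x \<and> F' S x" unfolding R_def Q(2) Q'(2) by blast
  qed
  ultimately show ?thesis unfolding EO_def by (intro exI[of _ "\<lambda>p. R (pfst p) (psnd p)"]) simp
qed

text \<open>
  A member of the least fixed point is certified by a list of numbers each of which is produced
  by the operator from earlier ones.
\<close>

theorem RE_lfp:
  assumes "EO F"
  shows "RE (lfp F)"
proof -
  obtain Q where Q: "RE Q" "\<And>S x. F S x \<longleftrightarrow> (\<exists>w. Q (pair x w) \<and> (\<forall>a\<in>members w. S a))"
    using assms unfolding EO_def by blast
  have mF: "F S' x" if "F S x" "\<And>a. S a \<Longrightarrow> S' a" for S S' x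
    using that unfolding Q(2) by blast
  have mono: "mono F" by (rule monoI) (auto simp: le_fun_def intro: mF)
  define ok where "ok c n \<longleftrightarrow> (\<forall>i<n. F (\<lambda>a. \<exists>j<i. a = at c j) (at c i))" for c n
  have okD: "F (\<lambda>a. \<exists>j<i. a = at c j) (at c i)" if "ok c n" "i < n" for c n i
    using that by (simp add: ok_def)
  have sound: "lfp F (at c i)" if "ok c n" "i < n" for c n i
    using that(2)
  proof (induction i rule: less_induct)
    case (less i)
    have "F (lfp F) (at c i)"
    proof (rule mF[OF okD[OF that(1) less.prems]])
      fix a assume "\<exists>j<i. a = at c j"
      then obtain j where "j < i" "a = at c j" by (elim exE conjE)
      then show "lfp F a" using less.IH[of j] less.prems by simp
    qed
    then show ?case by (subst lfp_unfold[OF mono])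
  qed
  have ok_append: "\<exists>e. ok e (m + n) \<and> (\<forall>i<m. at e i = at c i) \<and> (\<forall>i<n. at e (m + i) = at d i)"
    if c: "ok c m" and d: "ok d n" for c d m n
  proof -
    obtain e where e: "\<forall>i<m + n. at e i = (if i < m then at c i else at d (i - m))"
      using at_surj[of "m + n" "\<lambda>i. if i < m then at c i else at d (i - m)"] by (elim exE)
    have e1: "at e i = at c i" if "i < m" for i using e that by simp
    have e2: "at e (m + i) = at d i" if "i < n" for i using e that by simp
    have "F (\<lambda>a. \<exists>j<i. a = at e j) (at e i)" if i: "i < m + n" for i
    proof (cases "i < m")
      case True
      show ?thesis unfolding e1[OF True]
      proof (rule mF[OF okD[OF c True]])
        fix a assume "\<exists>j<i. a = at c j"
        then obtain j where "j < i" "a = at c j" by (elim exE conjE)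
        then show "\<exists>j<i. a = at e j" using e1[of j] True by (intro exI[of _ j]) simp
      qed
    next
      case False
      define k where "k = i - m"
      have k: "k < n" "i = m + k" using False i by (simp_all add: k_def)
      show ?thesis unfolding k(2) e2[OF k(1)]
      proof (rule mF[OF okD[OF d k(1)]])
        fix a assume "\<exists>j<k. a = at d j"
        then obtain j where "j < k" "a = at d j" by (elim exE conjE)
        then show "\<exists>j<m + k. a = at e j" using e2[of j] k(1) by (intro exI[of _ "m + j"]) simp
      qed
    qed
    then have "ok e (m + n)" by (simp add: ok_def)
    then show ?thesis using e1 e2 by (intro exI[of _ e]) simp
  qed
  define D where "D x \<longleftrightarrow> (\<exists>c n. ok c n \<and> (\<exists>i<n. x = at c i))" for x
  have "D x" if FD: "F D x" for x
  proof -
    obtain w where w: "Q (pair x w)" "\<forall>a\<in>members w. D a" using FD unfolding Q(2) by blast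
    \<comment> \<open>Certificates for the finitely many members of \<open>w\<close> are merged one
      at a time; afterwards \<open>x\<close> is appended as the last entry.\<close>
    have "\<exists>c n. ok c n \<and> (\<forall>j<k. \<exists>i<n. at (psnd w) j = at c i)" if "k \<le> pfst w" for k
      using that
    proof (induction k)
      case 0
      show ?case by (intro exI[of _ 0]) (simp add: ok_def)
    next
      case (Suc k)
      then obtain c n where c: "ok c n" "\<forall>j<k. \<exists>i<n. at (psnd w) j = at c i" by auto
      have "at (psnd w) k \<in> members w" using Suc.prems by (auto simp: members_def)
      then obtain d m i where d: "ok d m" "i < m" "at (psnd w) k = at d i"
        using w(2)[rule_format, of "at (psnd w) k"] unfolding D_def by blast
      obtain e where e: "ok e (n + m)" "\<forall>i<n. at e i = at c i" "\<forall>i<m. at e (n + i) = at d i"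
        using ok_append[OF c(1) d(1)] by (elim exE conjE)
      have "\<exists>i<n + m. at (psnd w) j = at e i" if "j < Suc k" for j
      proof (cases "j < k")
        case True
        then obtain i where "i < n" "at (psnd w) j = at c i" using c(2) by blast
        then show ?thesis using e(2) by (intro exI[of _ i]) simp
      next
        case False
        then have "j = k" using that by simp
        then show ?thesis using d e(3) by (intro exI[of _ "n + i"]) simp
      qed
      then show ?case using e(1) by (intro exI[of _ e] exI[of _ "n + m"]) simp
    qed
    from this[OF order.refl] obtain c n
      where c: "ok c n" "\<forall>j<pfst w. \<exists>i<n. at (psnd w) j = at c i" by (elim exE conjE)
    obtain e where e: "\<forall>i<Suc n. at e i = (if i < n then at c i else x)"
      using at_surj[of "Suc n" "\<lambda>i. if i < n then at c i else x"] by (elim exE)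
    have e1: "at e i = at c i" if "i < n" for i using e that by simp
    have e2: "at e n = x" using e by simp
    have "F (\<lambda>a. \<exists>j<n. a = at e j) x" unfolding Q(2)
    proof (rule exI[of _ w], intro conjI ballI)
      fix a assume "a \<in> members w"
      then obtain j where "j < pfst w" "a = at (psnd w) j" by (auto simp: members_def)
      then obtain i where "i < n" "a = at c i" using c(2) by blast
      then show "\<exists>j<n. a = at e j" using e1[of i] by (intro exI[of _ i]) simp
    qed (fact w(1))
    moreover have "F (\<lambda>a. \<exists>j<i. a = at e j) (at e i)" if i: "i < n" for i unfolding e1[OF i]
    proof (rule mF[OF okD[OF c(1) i]])
      fix a assume "\<exists>j<i. a = at c j"
      then obtain j where "j < i" "a = at c j" by (elim exE conjE)
      then show "\<exists>j<i. a = at e j" using e1[of j] i by (intro exI[of _ j]) simp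
    qed
    ultimately have "ok e (Suc n)" unfolding ok_def by (simp add: less_Suc_eq e2)
    then show "D x" unfolding D_def using e2 by (intro exI[of _ e] exI[of _ "Suc n"]) auto
  qed
  then have "lfp F \<le> D" by (intro lfp_lowerbound) (simp add: le_fun_def)
  moreover have "D \<le> lfp F" using sound unfolding D_def by (auto simp: le_fun_def)
  ultimately have "lfp F = D" by (rule antisym)
  \<comment> \<open>Unfolding \<open>Q(2)\<close> turns each use of \<open>F\<close> on the earlier
    entries into a recursively enumerable condition on a finite list.\<close>
  moreover have "RE (\<lambda>x. D x)" unfolding D_def ok_def Q(2)
    by (intro RE_intros PR_intros RE_comp[OF Q(1)])
  ultimately show ?thesis by simp
qed


section \<open>Partial recursive functions from primitive recursive definitions\<close>

lemma partrec_pr_eval: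
  "pr_wf T \<Longrightarrow>
    \<exists>F. partrec (pr_arity T) F \<and> (\<forall>xs. length xs = pr_arity T \<longrightarrow> F xs = Some (pr_eval T xs))"
proof (induction T)
  case (PZero n)
  show ?case by (auto intro: partrec.zero)
next
  case PSucc
  show ?case by (auto intro: partrec.succ[simplified])
next
  case (PProj n i)
  then show ?case by (auto intro: partrec.proj)
next
  case (PComp n f gs)
  then obtain F where F: "partrec (length gs) F"
    "\<And>xs. length xs = length gs \<Longrightarrow> F xs = Some (pr_eval f xs)" by auto
  have "\<forall>g\<in>set gs. \<exists>G. partrec n G \<and> (\<forall>xs. length xs = n \<longrightarrow> G xs = Some (pr_eval g xs))"
    using PComp by fastforce
  then obtain G where G: "\<And>g. g \<in> set gs \<Longrightarrow>
      partrec n (G g) \<and> (\<forall>xs. length xs = n \<longrightarrow> G g xs = Some (pr_eval g xs))" by metis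
  let ?Gs = "map G gs"
  have "partrec n (\<lambda>xs. if \<forall>G\<in>set ?Gs. G xs \<noteq> None then F (map (\<lambda>G. the (G xs)) ?Gs) else None)"
    using F(1) G by (intro partrec.comp) auto
  moreover have "map (\<lambda>G. the (G xs)) ?Gs = map (\<lambda>g. pr_eval g xs) gs" if "length xs = n" for xs
    using G that by simp
  ultimately show ?case using F(2) G
    by (intro exI[of _ "\<lambda>xs. if \<forall>G\<in>set ?Gs. G xs \<noteq> None
      then F (map (\<lambda>G. the (G xs)) ?Gs) else None"]) (auto simp del: map_map)
next
  case (PRec g h)
  then obtain G H where GH: "partrec (pr_arity g) G" "partrec (pr_arity g + 2) H"
    "\<And>xs. length xs = pr_arity g \<Longrightarrow> G xs = Some (pr_eval g xs)"
    "\<And>xs. length xs = pr_arity g + 2 \<Longrightarrow> H xs = Some (pr_eval h xs)" by fastforce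
  have "rec_nat (G (tl xs)) (\<lambda>m r. Option.bind r (\<lambda>v. H (m # v # tl xs))) k =
      Some (rec_nat (pr_eval g (tl xs)) (\<lambda>m r. pr_eval h (m # r # tl xs)) k)"
    if "length xs = Suc (pr_arity g)" for xs k
    using that by (induction k) (simp_all add: GH(3,4))
  with partrec.prec[OF GH(1,2)] show ?case by fastforce
qed

lemma RE_partrec1:
  assumes "RE P"
  shows "\<exists>\<chi>. partrec1 \<chi> \<and> (\<forall>x. \<chi> x \<noteq> None \<longleftrightarrow> P x)"
proof -
  obtain Q where Q: "dec Q" "\<And>x. P x \<longleftrightarrow> (\<exists>z. Q (pair x z))" using assms unfolding RE_def by blast
  have "PR (\<lambda>p. 1 - of_bool (Q p))" using Q(1) unfolding dec_def by (intro PR_diff PR_const)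
  \<comment> \<open>\<open>partrec.mu\<close> searches on the first argument, so entry 0 is the
    witness and entry 1 the input. Complementing turns success into the value 0 that the search
    looks for.\<close>
  then have "prim (Suc 1) (\<lambda>xs. 1 - of_bool (Q (pair (xs ! 1) (xs ! 0))))"
    by (rule prim_PR) (intro prim_pair prim_nth; simp)
  then obtain T where T: "pr_wf T" "pr_arity T = Suc 1"
    "\<And>xs. length xs = Suc 1 \<Longrightarrow> pr_eval T xs = 1 - of_bool (Q (pair (xs ! 1) (xs ! 0)))"
    unfolding prim_def by blast
  obtain F where F: "partrec (Suc 1) F" "\<And>xs. length xs = Suc 1 \<Longrightarrow> F xs = Some (pr_eval T xs)"
    using partrec_pr_eval[OF T(1)] T(2) by auto
  let ?M = "\<lambda>xs. if \<exists>z. F (z # xs) = Some 0 \<and> (\<forall>y<z. F (y # xs) \<noteq> None)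
    then Some (LEAST z. F (z # xs) = Some 0) else None"
  have "partrec 1 ?M" using F(1) by (rule partrec.mu)
  then have "partrec1 (\<lambda>x. ?M [x])" unfolding partrec1_def by blast
  moreover have "?M [x] \<noteq> None \<longleftrightarrow> P x" for x by (auto simp: F(2) T(3) Q(2))
  ultimately show ?thesis by blast
qed

text \<open>The value 0 marks success, the same convention as in \<open>presents_d\<close>, so that
  both diagonals share \<open>diag_fiction\<close>.\<close>

lemma RE_step:
  assumes "RE P"
  shows "\<exists>T. pr_wf T \<and> pr_arity T = 2 \<and> (\<forall>x. P x \<longleftrightarrow> (\<exists>n. pr_eval T [x, n] = 0))"
proof -
  obtain Q where Q: "dec Q" "\<And>x. P x \<longleftrightarrow> (\<exists>z. Q (pair x z))" using assms unfolding RE_def by blast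
  have "PR (\<lambda>p. 1 - of_bool (Q p))" using Q(1) unfolding dec_def by (intro PR_diff PR_const)
  then have "prim 2 (\<lambda>xs. 1 - of_bool (Q (pair (xs ! 0) (xs ! 1))))"
    by (rule prim_PR) (intro prim_pair prim_nth; simp)
  then obtain T where "pr_wf T" "pr_arity T = 2"
    "\<And>xs. length xs = 2 \<Longrightarrow> pr_eval T xs = 1 - of_bool (Q (pair (xs ! 0) (xs ! 1)))"
    unfolding prim_def by blast
  then show ?thesis using Q(2) by (intro exI[of _ T]) auto
qed


section \<open>Coding terms by numbers\<close>

definition cVar :: "nat \<Rightarrow> nat" where "cVar i = pair 0 i"
definition cLam :: "nat \<Rightarrow> nat" where "cLam b = pair 1 b"
definition cConst :: "nat \<Rightarrow> nat" where "cConst c = pair 2 c"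
text \<open>One shape for all constructors that bind nothing, unary ones being padded with
  \<open>cBot\<close>: lifting and instantiation then have a single clause for them. The tags 0, 1
  and 2 are taken, hence the offset.\<close>

definition cBin :: "nat \<Rightarrow> nat \<Rightarrow> nat \<Rightarrow> nat" where "cBin k a b = pair (k + 3) (pair a b)"

abbreviation "cBot \<equiv> cConst 0"
abbreviation "cZero \<equiv> cConst (Suc 0)"
abbreviation "cRec \<equiv> cConst 2"
abbreviation "cForall \<equiv> cConst 3"
abbreviation "cApp \<equiv> cBin 0"
abbreviation "cEq \<equiv> cBin (Suc 0)"
abbreviation "cOr \<equiv> cBin 2"
abbreviation "cSucc a \<equiv> cBin 3 a cBot"
abbreviation "cNeg a \<equiv> cBin 4 a cBot"
abbreviation "cisN a \<equiv> cEq a a"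
abbreviation "cisB a \<equiv> cOr a (cNeg a)"
abbreviation "cAnd a b \<equiv> cNeg (cOr (cNeg a) (cNeg b))"

text \<open>The last branch is a default: surplus codes are read as \<open>Forall\<close> here and
  as \<open>Neg\<close> in \<open>bin_tm\<close>.\<close>

definition const_tm :: "nat \<Rightarrow> tm" where
  "const_tm c = (if c = 0 then Bot else if c = 1 then Zero else if c = 2 then Rec else Forall)"

definition bin_tm :: "nat \<Rightarrow> tm \<Rightarrow> tm \<Rightarrow> tm" where
  "bin_tm k a b = (if k = 0 then a \<cdot> b else if k = 1 then a \<doteq> b else if k = 2 then Or a b
    else if k = 3 then Succ a else Neg a)"

lemma psnd_le: "psnd n \<le> n" and pfst_le: "pfst n \<le> n"
  using le_prod_encode_1[of "pfst n" "psnd n"] le_prod_encode_2[of "psnd n" "pfst n"]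
    pair_simps(3)[of n] by (simp_all add: pair_def)

text \<open>Termination of \<open>decode\<close> rests on this. Strictness can fail at tag 0, but
  the clause for variables does not recurse.\<close>

lemma psnd_less: "0 < pfst n \<Longrightarrow> psnd n < n"
proof -
  assume "0 < pfst n"
  moreover have "n = triangle (pfst n + psnd n) + pfst n"
    using pair_simps(3)[of n] by (simp add: pair_def prod_encode_def)
  moreover have "k \<le> triangle k" for k by (induction k) simp_all
  ultimately show ?thesis by (metis add_less_le_mono add.commute add_0 le_trans le_add2 nat_less_le add_le_less_mono)
qed

text \<open>\<open>decode\<close> is total, so that no validity of codes has to be checked in the coded system.\<close>

function decode :: "nat \<Rightarrow> tm" where
  "decode n = (if pfst n = 0 then Var (psnd n)
    else if pfst n = 1 then Lam (decode (psnd n))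
    else if pfst n = 2 then const_tm (psnd n)
    else bin_tm (pfst n - 3) (decode (pfst (psnd n))) (decode (psnd (psnd n))))"
  by auto
termination
  by (relation "measure id")
    (auto intro: psnd_less le_less_trans[OF pfst_le psnd_less] le_less_trans[OF psnd_le psnd_less])

declare decode.simps [simp del]

lemma decode_code [simp]:
  "decode (cVar i) = Var i" "decode (cLam b) = Lam (decode b)" "decode (cConst c) = const_tm c"
  "decode (cBin k a b) = bin_tm k (decode a) (decode b)"
  by (subst decode.simps; simp add: cVar_def cLam_def cConst_def cBin_def)+

primrec enc :: "tm \<Rightarrow> nat" where
  "enc (Var i) = cVar i"
| "enc Bot = cBot"
| "enc Zero = cZero"
| "enc (Succ t) = cSucc (enc t)"
| "enc (t \<doteq> u) = cEq (enc t) (enc u)"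
| "enc (Neg t) = cNeg (enc t)"
| "enc (Or t u) = cOr (enc t) (enc u)"
| "enc (Lam b) = cLam (enc b)"
| "enc (t \<cdot> u) = cApp (enc t) (enc u)"
| "enc Rec = cRec"
| "enc Forall = cForall"

lemma const_tm_simps [simp]:
  "const_tm 0 = Bot" "const_tm (Suc 0) = Zero" "const_tm 2 = Rec" "const_tm 3 = Forall"
  by (simp_all add: const_tm_def)

lemma bin_tm_simps [simp]:
  "bin_tm 0 a b = a \<cdot> b" "bin_tm (Suc 0) a b = (a \<doteq> b)" "bin_tm 2 a b = Or a b"
  "bin_tm 3 a b = Succ a" "bin_tm 4 a b = Neg a"
  by (simp_all add: bin_tm_def)

lemma decode_enc [simp]: "decode (enc t) = t"
  by (induction t) simp_all

lemma PR_code [PR_intros]: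
  "PR f \<Longrightarrow> PR (\<lambda>x. cVar (f x))" "PR f \<Longrightarrow> PR (\<lambda>x. cLam (f x))"
  "PR f \<Longrightarrow> PR (\<lambda>x. cConst (f x))"
  "PR k \<Longrightarrow> PR f \<Longrightarrow> PR g \<Longrightarrow> PR (\<lambda>x. cBin (k x) (f x) (g x))"
  unfolding cVar_def cLam_def cConst_def cBin_def by (intro PR_intros; assumption)+

section \<open>Syntactic operations as recursively enumerable relations\<close>

lemmas EO_RE_intros [EO_intros] =
  EO_RE[OF RE_eq] EO_RE[OF RE_less] EO_RE[OF RE_le] EO_RE[OF RE_members] EO_RE[OF RE_ball_members]

text \<open>Exposes the definition of an inductive predicate as a least fixed point, under names
  such as \<open>lift_code_def\<close>; this is the form to which \<open>RE_lfp\<close>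
  applies.\<close>

declare [[inductive_internals]]

text \<open>The graph of \<open>lift\<close> as a predicate on packed triples, because
  \<open>RE_lfp\<close> speaks of sets of numbers.\<close>

inductive lift_code :: "nat \<Rightarrow> bool" where
  "i < k \<Longrightarrow> lift_code (pair k (pair (cVar i) (cVar i)))"
| "k \<le> i \<Longrightarrow> lift_code (pair k (pair (cVar i) (cVar (Suc i))))"
| "lift_code (pair k (pair (cConst c) (cConst c)))"
| "lift_code (pair (Suc k) (pair b b')) \<Longrightarrow> lift_code (pair k (pair (cLam b) (cLam b')))"
| "lift_code (pair k (pair a a')) \<Longrightarrow> lift_code (pair k (pair b b')) \<Longrightarrow>
    lift_code (pair k (pair (cBin j a b) (cBin j a' b')))"

lemma lift_const_bin:
  "lift k (const_tm c) = const_tm c" "lift k (bin_tm j a b) = bin_tm j (lift k a) (lift k b)"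
  by (simp_all add: const_tm_def bin_tm_def)

lemma lift_code_sound:
  "lift_code x \<Longrightarrow> decode (psnd (psnd x)) = lift (pfst x) (decode (pfst (psnd x)))"
  by (induction rule: lift_code.induct) (simp_all add: lift_const_bin)

text \<open>Deliberately asymmetric to soundness: soundness concerns all codes through
  \<open>decode\<close>, whereas completeness is claimed for canonical codes, the only ones that
  arise from OGA derivations.\<close>

lemma lift_code_enc: "lift_code (pair k (pair (enc t) (enc (lift k t))))"
  by (induction t arbitrary: k) (auto intro: lift_code.intros)

lemma RE_lift_code: "RE lift_code"
  unfolding lift_code_def by (rule RE_lfp) (intro EO_intros PR_intros)

lemmas RE_lift_code' [RE_intros] = RE_comp[OF RE_lift_code]
lemmas EO_lift_code [EO_intros] = EO_RE[OF RE_lift_code']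

inductive inst_code :: "nat \<Rightarrow> bool" where
  "inst_code (pair k (pair s (pair (cVar k) s)))"
| "k < j \<Longrightarrow> inst_code (pair k (pair s (pair (cVar j) (cVar (j - Suc 0)))))"
| "j < k \<Longrightarrow> inst_code (pair k (pair s (pair (cVar j) (cVar j))))"
| "inst_code (pair k (pair s (pair (cConst c) (cConst c))))"
| "lift_code (pair 0 (pair s s')) \<Longrightarrow> inst_code (pair (Suc k) (pair s' (pair b b'))) \<Longrightarrow>
    inst_code (pair k (pair s (pair (cLam b) (cLam b'))))"
| "inst_code (pair k (pair s (pair a a'))) \<Longrightarrow> inst_code (pair k (pair s (pair b b'))) \<Longrightarrow>
    inst_code (pair k (pair s (pair (cBin j a b) (cBin j a' b'))))"

lemma inst_const_bin:
  "inst k s (const_tm c) = const_tm c"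
  "inst k s (bin_tm j a b) = bin_tm j (inst k s a) (inst k s b)"
  by (simp_all add: const_tm_def bin_tm_def)

lemma inst_code_sound:
  "inst_code x \<Longrightarrow> decode (psnd (psnd (psnd x))) =
    inst (pfst x) (decode (pfst (psnd x))) (decode (pfst (psnd (psnd x))))"
  by (induction rule: inst_code.induct) (auto simp: inst_const_bin dest: lift_code_sound)

lemma inst_code_enc: "inst_code (pair k (pair (enc s) (pair (enc t) (enc (inst k s t)))))"
proof (induction t arbitrary: k s)
  case (Var j)
  show ?case by (auto intro: inst_code.intros)
qed (auto intro: inst_code.intros lift_code_enc)

lemma RE_inst_code: "RE inst_code"
  unfolding inst_code_def by (rule RE_lfp) (intro EO_intros PR_intros)

lemmas RE_inst_code' [RE_intros] = RE_comp[OF RE_inst_code]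
lemmas EO_inst_code [EO_intros] = EO_RE[OF RE_inst_code']

definition subst_code :: "nat \<Rightarrow> nat \<Rightarrow> nat \<Rightarrow> nat \<Rightarrow> bool" where
  "subst_code i s a b \<longleftrightarrow>
    (\<exists>c. lift_code (pair (Suc i) (pair a c)) \<and> inst_code (pair i (pair s (pair c b))))"

lemma subst_code_sound: "subst_code i s a b \<Longrightarrow> decode b = subst i (decode s) (decode a)"
  unfolding subst_code_def subst_eq_inst_lift
  by (auto dest!: inst_code_sound lift_code_sound)

lemma subst_code_enc: "subst_code i (enc s) (enc t) (enc (subst i s t))"
  unfolding subst_code_def subst_eq_inst_lift using lift_code_enc inst_code_enc by blast

lemma RE_subst_code [RE_intros]:
  assumes "PR f" "PR g" "PR h" "PR k"
  shows "RE (\<lambda>x. subst_code (f x) (g x) (h x) (k x))"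
  unfolding subst_code_def
  by (intro RE_intros PR_intros PR_comp[OF assms(1)] PR_comp[OF assms(2)] PR_comp[OF assms(3)]
      PR_comp[OF assms(4)])

lemmas EO_subst_code [EO_intros] = EO_RE[OF RE_subst_code]

definition num_code :: "nat \<Rightarrow> nat" where "num_code n = rec_nat cZero (\<lambda>m r. cSucc r) n"

lemma num_code: "num_code n = enc (num n)"
  by (induction n) (simp_all add: num_code_def num_simps)

lemma PR_num_code [PR_intros]: "PR f \<Longrightarrow> PR (\<lambda>x. num_code (f x))"
  unfolding num_code_def by (intro PR_rec PR_intros)

inductive head_code :: "nat \<Rightarrow> bool" where
  "inst_code (pair 0 (pair t (pair b r))) \<Longrightarrow> head_code (pair (cApp (cLam b) t) r)"
| "head_code (pair (cApp (cApp (cApp cRec g) h) cZero) g)"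
| "head_code (pair (cApp (cApp (cApp cRec g) h) (cSucc (num_code n)))
    (cApp (cApp h (num_code n)) (cApp (cApp (cApp cRec g) h) (num_code n))))"
| "head_code (pair t t') \<Longrightarrow> head_code (pair (cApp t u) (cApp t' u))"

lemma head_code_sound: "head_code x \<Longrightarrow> decode (pfst x) \<rhd> decode (psnd x)"
proof (induction rule: head_code.induct)
  case (1 t b r)
  then show ?case using head_step.beta[of "decode b" "decode t"] by (auto dest: inst_code_sound)
qed (auto simp: num_code intro: head_step.intros)

lemma head_code_enc: "t \<rhd> t' \<Longrightarrow> head_code (pair (enc t) (enc t'))"
proof (induction rule: head_step.induct)
  case (rec_Succ g h n)
  then show ?case using head_code.intros(3)[of "enc g" "enc h" n] by (simp add: num_code)
qed (auto intro: head_code.intros inst_code_enc)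

lemma RE_head_code: "RE head_code"
  unfolding head_code_def by (rule RE_lfp) (intro EO_intros PR_intros)

lemmas RE_head_code' [RE_intros] = RE_comp[OF RE_head_code]


section \<open>A coded system\<close>

text \<open>Rules that keep the context, all given two premises; a rule with one premise leaves the
  other slot arbitrary, and \<open>thm_code_infer1\<close> fills it with the same formula. There is
  no recursion, so enumerability is read off \<open>infer.simps\<close>.\<close>

inductive infer :: "nat \<Rightarrow> nat \<Rightarrow> nat \<Rightarrow> bool" where
  true_eq_one: "infer a b (cEq a (cSucc cZero))"
| eq_one_true: "infer (cEq a (cSucc cZero)) b a"
| false_eq_zero: "infer (cNeg a) b (cEq a cZero)"
| eq_zero_false: "infer (cEq a cZero) b (cNeg a)"
| explode: "infer (cNeg a) a c"
| NegNegI: "infer a b (cNeg (cNeg a))"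
| NegNegE: "infer (cNeg (cNeg a)) b a"
| OrI1: "infer a b (cOr a c)"
| OrI2: "infer a b (cOr c a)"
| NegOrI: "infer (cNeg a) (cNeg b) (cNeg (cOr a b))"
| NegOrE1: "infer (cNeg (cOr a c)) b (cNeg a)"
| NegOrE2: "infer (cNeg (cOr a c)) b (cNeg c)"
| eq_sym: "infer (cEq a c) b (cEq c a)"
| eq_subst: "subst_code i a p q \<Longrightarrow> subst_code i b p r \<Longrightarrow> infer (cEq a b) q r"
| neq_sym: "infer (cNeg (cEq a c)) b (cNeg (cEq c a))"
| eq_isB: "infer (cisN a) (cisN b) (cisB (cEq a b))"
| eq_isB_isN: "infer (cisB (cEq a c)) b (cAnd (cisN a) (cisN c))"
| Succ_isN: "infer (cisN a) b (cisN (cSucc a))"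
| isN_Succ: "infer (cisN (cSucc a)) b (cisN a)"
| Succ_neq_Zero: "infer (cisN a) b (cNeg (cEq (cSucc a) cZero))"
| Succ_neqI: "infer (cNeg (cEq a c)) b (cNeg (cEq (cSucc a) (cSucc c)))"
| Succ_neqE: "infer (cNeg (cEq (cSucc a) (cSucc c))) b (cNeg (cEq a c))"
| Succ_eqE: "infer (cEq (cSucc a) (cSucc c)) b (cEq a c)"
| Bot_isN: "infer (cisN cBot) b c"
| expand: "head_code (pair c a) \<Longrightarrow> infer a b c"
| reduce: "head_code (pair a c) \<Longrightarrow> infer a b c"
| Neg_reduce: "head_code (pair a c) \<Longrightarrow> infer (cNeg a) b (cNeg c)"
| step_eq: "head_code (pair c a) \<Longrightarrow> infer (cisN a) b (cEq c a)"
| rec_eq: "infer (cisN m) (cisN (cApp (cApp h m) (cApp (cApp (cApp cRec g) h) m)))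
    (cEq (cApp (cApp (cApp cRec g) h) (cSucc m)) (cApp (cApp h m) (cApp (cApp (cApp cRec g) h) m)))"
| ForallE: "infer (cApp cForall f) (cisN a) (cApp f a)"
| NegForallI: "infer (cNeg (cApp f a)) (cisN a) (cNeg (cApp cForall f))"
| ATI: "lift_code (pair 0 (pair u u')) \<Longrightarrow>
    infer (cApp cForall (cLam (cisB (cApp u' (cVar 0))))) b (cisB (cApp cForall u))"

lemma RE_infer [RE_intros]:
  assumes "PR f" "PR g" "PR h"
  shows "RE (\<lambda>x. infer (f x) (g x) (h x))"
proof -
  have "RE (\<lambda>p. infer (pfst p) (pfst (psnd p)) (psnd (psnd p)))"
    unfolding infer.simps by (intro RE_intros PR_intros)
  from RE_comp[OF this, of "\<lambda>x. pair (f x) (pair (g x) (h x))"] show ?thesis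
    by (simp add: assms PR_intros)
qed

lemmas EO_infer [EO_intros] = EO_RE[OF RE_infer]

text \<open>
  \<open>thm_code (pair l c)\<close> is derivability of the coded sequent with context \<open>members l\<close>.
  The condition on the context in \<open>induction\<close> says that \<open>v\<^sub>i\<close> is not free in it.
\<close>

inductive thm_code :: "nat \<Rightarrow> bool" where
  hyp: "c \<in> members l \<Longrightarrow> thm_code (pair l c)"
| Zero_isN: "thm_code (pair l (cisN cZero))"
| infer: "infer a b c \<Longrightarrow> thm_code (pair l a) \<Longrightarrow> thm_code (pair l b) \<Longrightarrow> thm_code (pair l c)"
| cut: "thm_code (pair l a) \<Longrightarrow> thm_code (pair (lcons a l) c) \<Longrightarrow> thm_code (pair l c)"
| OrE: "thm_code (pair l (cOr a b)) \<Longrightarrow> thm_code (pair (lcons a l) c) \<Longrightarrow>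
    thm_code (pair (lcons b l) c) \<Longrightarrow> thm_code (pair l c)"
| subst: "thm_code (pair l c) \<Longrightarrow> subst_code i s c d \<Longrightarrow>
    \<forall>a\<in>members l. \<exists>b. b \<in> members m \<and> subst_code i s a b \<Longrightarrow> thm_code (pair m d)"
| induction: "thm_code (pair l d) \<Longrightarrow> thm_code (pair (lcons (cisN (cVar i)) (lcons c l)) e) \<Longrightarrow>
    thm_code (pair l (cisN a)) \<Longrightarrow> subst_code i cZero c d \<Longrightarrow>
    subst_code i (cSucc (cVar i)) c e \<Longrightarrow> subst_code i a c r \<Longrightarrow>
    \<forall>b\<in>members l. subst_code i cZero b b \<Longrightarrow> thm_code (pair l r)"
| ForallI: "thm_code (pair m (cApp f' (cVar 0))) \<Longrightarrow> lift_code (pair 0 (pair f f')) \<Longrightarrow>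
    \<forall>b\<in>members m. b = cisN (cVar 0) \<or> (\<exists>a. a \<in> members l \<and> lift_code (pair 0 (pair a b))) \<Longrightarrow>
    thm_code (pair l (cApp cForall f))"
| NegForallE: "thm_code (pair l (cNeg (cApp cForall f))) \<Longrightarrow> thm_code (pair m c') \<Longrightarrow>
    lift_code (pair 0 (pair f f')) \<Longrightarrow> lift_code (pair 0 (pair c c')) \<Longrightarrow>
    \<forall>b\<in>members m. b = cisN (cVar 0) \<or> b = cNeg (cApp f' (cVar 0)) \<or>
      (\<exists>a. a \<in> members l \<and> lift_code (pair 0 (pair a b))) \<Longrightarrow>
    thm_code (pair l c)"

lemma RE_thm_code: "RE thm_code"
  unfolding thm_code_def by (rule RE_lfp) (intro EO_intros RE_intros PR_intros)


section \<open>The coded system lies between OGA and truth\<close>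

lemma ev_Zero_iff [simp]: "ev Zero [] n \<longleftrightarrow> n = 0"
  by (auto elim: ev_ZeroE intro: ev.Zero)

lemma ev_Succ_iff [simp]: "ev (Succ t) [] n \<longleftrightarrow> (\<exists>m. n = Suc m \<and> ev t [] m)"
  by (auto elim: ev_SuccE intro: ev.Succ)

lemma ev_Eq_iff [simp]:
  "ev (t \<doteq> u) [] (Suc 0) \<longleftrightarrow> (\<exists>n. ev t [] n \<and> ev u [] n)"
  "ev (t \<doteq> u) [] 0 \<longleftrightarrow> (\<exists>m n. ev t [] m \<and> ev u [] n \<and> m \<noteq> n)"
  by (auto elim!: ev_EqE intro: ev.EqT ev.EqF)

lemma ev_Neg_iff [simp]:
  "ev (Neg t) [] (Suc 0) \<longleftrightarrow> ev t [] 0" "ev (Neg t) [] 0 \<longleftrightarrow> ev t [] (Suc 0)"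
  by (auto elim: ev_NegE intro: ev.NegT ev.NegF)

lemma ev_Or_iff [simp]:
  "ev (Or t u) [] (Suc 0) \<longleftrightarrow> ev t [] (Suc 0) \<or> ev u [] (Suc 0)"
  "ev (Or t u) [] 0 \<longleftrightarrow> ev t [] 0 \<and> ev u [] 0"
  by (auto elim: ev_OrE intro: ev.OrT1 ev.OrT2 ev.OrF)

lemma ev_Bot_iff [simp]: "\<not> ev Bot us n"
  by (auto elim: ev_BotE)

lemma ev_Forall_iff [simp]:
  "ev Forall [u] (Suc 0) \<longleftrightarrow> (\<forall>n. ev u [num n] (Suc 0))"
  "ev Forall [u] 0 \<longleftrightarrow> (\<exists>n. ev u [num n] 0)"
  by (auto elim: ev_ForallE intro: ev.ForallT ev.ForallF)

text \<open>Links the quantifier rules, which instantiate by any term that is a number, to a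
  semantics whose quantifier ranges over numerals.\<close>

lemma ev_arg: "ev a [] n \<Longrightarrow> ev f [a] m \<longleftrightarrow> ev f [num n] m"
  using ev_eqv[of f "[a]" m f "[num n]"] ev_eqv[of f "[num n]" m f "[a]"]
    eqv.same[of a n "num n"] eqv.same[of "num n" n a] by (auto simp: ev_num)

lemma psub_upd_eqv:
  assumes "ev a [] n" "ev b [] n"
  shows "psub (\<sigma>(i := a)) t \<approx> psub (\<sigma>(i := b)) t"
  using assms by (intro psub_eqv) (auto intro: eqv.same)

lemma head_step_psub: "t \<rhd> t' \<Longrightarrow> psub \<sigma> t \<rhd> psub \<sigma> t'"
  by (induction rule: head_step.induct) (auto simp: psub_inst_0 intro: head_step.intros)

text \<open>Environments assign arbitrary terms, because the substitution rule may insert a term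
  without a value. Where a variable must denote a number, a hypothesis \<open>isN\<close> in the
  context says so.\<close>

definition sat :: "(nat \<Rightarrow> tm) \<Rightarrow> nat \<Rightarrow> bool" where
  "sat \<sigma> c \<longleftrightarrow> ev (psub \<sigma> (decode c)) [] (Suc 0)"

lemma ev_head_code:
  "head_code (pair c c') \<Longrightarrow> ev (psub \<sigma> (decode c)) [] n \<longleftrightarrow> ev (psub \<sigma> (decode c')) [] n"
  using head_code_sound[of "pair c c'"] head_step_psub ev_head_step by (metis pair_simps(1,2))

lemma infer_sound: "infer a b c \<Longrightarrow> sat \<sigma> a \<Longrightarrow> sat \<sigma> b \<Longrightarrow> sat \<sigma> c"
proof (induction rule: infer.induct)
  case (eq_subst i a p q b r)
  then obtain n where n: "ev (psub \<sigma> (decode a)) [] n" "ev (psub \<sigma> (decode b)) [] n"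
    by (auto simp: sat_def)
  have "decode q = Defs.subst i (decode a) (decode p)" "decode r = Defs.subst i (decode b) (decode p)"
    using eq_subst(1,2) by (auto dest: subst_code_sound)
  then show ?case
    using eq_subst(4) eqv_imp_ev[OF psub_upd_eqv[OF n]] by (simp add: sat_def psub_subst)
next
  case (rec_eq m h g)
  let ?s = "psub \<sigma>"
  obtain k where k: "ev (?s (decode m)) [] k" using rec_eq(1) by (auto simp: sat_def)
  obtain v where v: "ev (?s (decode h))
      [?s (decode m), Rec \<cdot> ?s (decode g) \<cdot> ?s (decode h) \<cdot> ?s (decode m)] v"
    using rec_eq(2) by (auto simp: sat_def)
  \<comment> \<open>\<open>RecS\<close> puts the numeral of the predecessor on the stack, so
    \<open>m\<close> has to be exchanged for it both as an argument and inside the recursive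
    call.\<close>
  have "?s (decode m) \<approx> num k" using k ev_num by (rule eqv.same)
  then have "ev (?s (decode h)) [num k, Rec \<cdot> ?s (decode g) \<cdot> ?s (decode h) \<cdot> num k] v"
    by (intro ev_eqv[OF v]) (simp_all add: eqv.App)
  then have "ev Rec [?s (decode g), ?s (decode h), Succ (?s (decode m))] v"
    using k by (intro ev.RecS[of _ k]) simp_all
  then show ?case using v by (auto simp: sat_def)
next
  case (ATI u u' b)
  have "decode u' = \<up> (decode u)" using ATI(1) by (auto dest: lift_code_sound)
  then have "inst 0 (num n) (psub (up_env \<sigma>) (decode u')) = psub \<sigma> (decode u)" for n
    by (simp add: inst_0_psub del: psub_up) simp
  \<comment> \<open>Every instance has value 0 or 1, so classically either all instances have value
    1 or one of them has value 0.\<close>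
  then show ?case using ATI(2) by (auto simp: sat_def)
next
  case (expand c a b)
  then show ?case by (simp add: sat_def ev_head_code)
next
  case (reduce a c b)
  then show ?case by (simp add: sat_def ev_head_code)
next
  case (Neg_reduce a c b)
  then show ?case by (simp add: sat_def ev_head_code)
next
  case (step_eq c a b)
  then show ?case by (simp add: sat_def ev_head_code)
next
  case (ForallE f a)
  then show ?case by (auto simp: sat_def ev_arg)
next
  case (NegForallI f a)
  then show ?case by (auto simp: sat_def ev_arg)
next
  case (eq_isB a b)
  then show ?case by (simp add: sat_def) metis
next
  case (neq_sym a c b)
  then show ?case by (simp add: sat_def) metis
next
  case (Succ_neqI a c b)
  then show ?case by (fastforce simp: sat_def)
next
  case (Succ_neqE a c b)
  then show ?case by (fastforce simp: sat_def)
next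
  case (explode a c)
  then show ?case by (auto simp: sat_def dest: ev_det)
qed (auto simp: sat_def dest: ev_det)

lemma thm_code_sound: "thm_code x \<Longrightarrow> (\<And>a. a \<in> members (pfst x) \<Longrightarrow> sat \<sigma> a) \<Longrightarrow> sat \<sigma> (psnd x)"
proof (induction arbitrary: \<sigma> rule: thm_code.induct)
  case (hyp c l)
  then show ?case by simp
next
  case (Zero_isN l)
  then show ?case by (simp add: sat_def)
next
  case (infer a b c l)
  then show ?case by (simp add: infer_sound[OF infer.hyps(1)])
next
  case (cut l a c)
  have "sat \<sigma> a" using cut.IH(1)[of \<sigma>] cut.prems by simp
  then show ?case using cut.IH(2)[of \<sigma>] cut.prems by auto
next
  case (OrE l a b c)
  have "sat \<sigma> a \<or> sat \<sigma> b" using OrE.IH(1)[of \<sigma>] OrE.prems by (simp add: sat_def)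
  then show ?case using OrE.IH(2,3)[of \<sigma>] OrE.prems by auto
next
  case (subst l c i s d m)
  have *: "sat \<sigma> b \<longleftrightarrow> sat (\<sigma>(i := psub \<sigma> (decode s))) a" if "subst_code i s a b" for a b
    using subst_code_sound[OF that] by (simp add: sat_def psub_subst)
  have "sat (\<sigma>(i := psub \<sigma> (decode s))) (psnd (pair l c))"
  proof (rule subst.IH)
    fix a assume "a \<in> members (pfst (pair l c))"
    then obtain b where "b \<in> members m" "subst_code i s a b" using subst.hyps(3) by auto
    then show "sat (\<sigma>(i := psub \<sigma> (decode s))) a" using subst.prems[of b] *[of a b] by simp
  qed
  then show ?case using *[OF subst.hyps(2)] by simp
next
  case (induction l d i c e a r)
  have *: "sat \<tau> b' \<longleftrightarrow> sat (\<tau>(i := psub \<tau> (decode s))) b" if "subst_code i s b b'" for \<tau> s b b'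
    using subst_code_sound[OF that] by (simp add: sat_def psub_subst)
  have l: "sat (\<sigma>(i := t)) b" if "b \<in> members l" for b t
  proof -
    \<comment> \<open>Replacing variable \<open>i\<close> by \<open>Zero\<close> fixes
      \<open>b\<close>, so each of the two environments agrees on \<open>b\<close> with the one
      assigning \<open>Zero\<close> to \<open>i\<close>.\<close>
    have "subst_code i cZero b b" using induction.hyps(7) that by blast
    from *[OF this, of "\<sigma>(i := t)"] *[OF this, of \<sigma>] show ?thesis
      using induction.prems that by simp
  qed
  have nat: "sat (\<sigma>(i := num k)) c" for k
  proof (induction k)
    case 0
    have "sat \<sigma> d" using induction.IH(1)[of \<sigma>] induction.prems by simp
    then show ?case using *[OF induction.hyps(4), of \<sigma>] by (simp add: num_simps fun_upd_def)
  next
    case (Suc k)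
    have "sat (\<sigma>(i := num k)) b" if "b \<in> members (lcons (cisN (cVar i)) (lcons c l))" for b
      using that l Suc ev_num[of k] by (auto simp: sat_def fun_upd_def)
    then have "sat (\<sigma>(i := num k)) e" using induction.IH(2)[of "\<sigma>(i := num k)"] by (simp add: fun_upd_def)
    then show ?case using *[OF induction.hyps(5), of "\<sigma>(i := num k)"]
      by (simp add: num_simps fun_upd_def cong: if_cong)
  qed
  have "sat \<sigma> (cisN a)" using induction.IH(3)[of \<sigma>] induction.prems by simp
  then obtain n where "ev (psub \<sigma> (decode a)) [] n" by (auto simp: sat_def)
  \<comment> \<open>The induction has reached all numerals; \<open>a\<close> is covered because it
    is exchangeable with the numeral of its value.\<close>
  from eqv_imp_ev[OF psub_upd_eqv[OF ev_num this]] nat[of n]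
  have "sat (\<sigma>(i := psub \<sigma> (decode a))) c" by (simp add: sat_def)
  then show ?case using *[OF induction.hyps(6), of \<sigma>] by simp
next
  case (ForallI m f' f l)
  have f': "decode f' = \<up> (decode f)" using ForallI.hyps(2) by (auto dest: lift_code_sound)
  have "ev (psub \<sigma> (decode f)) [num n] (Suc 0)" for n
  proof -
    \<comment> \<open>Interprets the eigenvariable by \<open>num n\<close> and shifts
      \<open>\<sigma>\<close>, so that a lifted formula means under it what the original means under
      \<open>\<sigma>\<close>.\<close>
    let ?\<tau> = "case_nat (num n) \<sigma>"
    have "sat ?\<tau> b" if b: "b \<in> members m" for b
    proof -
      consider "b = cisN (cVar 0)" | a where "a \<in> members l" "lift_code (pair 0 (pair a b))"
        using ForallI.hyps(3) b by blast
      then show ?thesis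
      proof cases
        case 1
        then show ?thesis by (auto simp: sat_def intro: ev_num)
      next
        case 2
        then show ?thesis using ForallI.prems[of a] lift_code_sound[OF 2(2)] by (simp add: sat_def)
      qed
    qed
    then have "sat ?\<tau> (cApp f' (cVar 0))" using ForallI.IH[of ?\<tau>] by simp
    then show ?thesis by (simp add: sat_def f')
  qed
  then show ?case by (simp add: sat_def)
next
  case (NegForallE l f m c' f' c)
  have f': "decode f' = \<up> (decode f)" "decode c' = \<up> (decode c)"
    using NegForallE.hyps(3,4) by (auto dest: lift_code_sound)
  have "sat \<sigma> (cNeg (cApp cForall f))" using NegForallE.IH(1)[of \<sigma>] NegForallE.prems by simp
  then obtain n where n: "ev (psub \<sigma> (decode f)) [num n] 0" by (auto simp: sat_def)
  let ?\<tau> = "case_nat (num n) \<sigma>"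
  have "sat ?\<tau> b" if b: "b \<in> members m" for b
  proof -
    consider "b = cisN (cVar 0)" | "b = cNeg (cApp f' (cVar 0))"
      | a where "a \<in> members l" "lift_code (pair 0 (pair a b))"
      using NegForallE.hyps(5) b by blast
    then show ?thesis
    proof cases
      case 1
      then show ?thesis by (auto simp: sat_def intro: ev_num)
    next
      case 2
      then show ?thesis using n f' by (simp add: sat_def)
    next
      case 3
      then show ?thesis using NegForallE.prems[of a] lift_code_sound[OF 3(2)] by (simp add: sat_def)
    qed
  qed
  then have "sat ?\<tau> c'" using NegForallE.IH(2)[of ?\<tau>] by simp
  then show ?case by (simp add: sat_def f')
qed

section \<open>Every OGA derivation is reproduced by the coded system\<close>

lemma thm_code_infer1: "thm_code (pair l a) \<Longrightarrow> infer a a c \<Longrightarrow> thm_code (pair l c)"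
  using thm_code.infer by blast

text \<open>Weakening comes from the substitution rule with the identity substitution, since that
  rule only asks the images of the old context to lie in the new one. Canonical codes guarantee that
  the identity is available on each member.\<close>

lemma thm_code_weaken: "thm_code (pair l (enc c)) \<Longrightarrow> members l = enc ` A \<Longrightarrow>
    members l \<subseteq> members m \<Longrightarrow> thm_code (pair m (enc c))"
proof (erule thm_code.subst)
  have "(\<lambda>j. if j = 0 then Var 0 else Var j) = Var" by (rule ext) simp
  then have *: "subst_code 0 (cVar 0) (enc t) (enc t)" for t
    using subst_code_enc[of 0 "Var 0" t] by (simp add: subst_eq_psub)
  then show "subst_code 0 (cVar 0) (enc c) (enc c)" .
  assume "members l = enc ` A" "members l \<subseteq> members m"
  then show "\<forall>a\<in>members l. \<exists>b. b \<in> members m \<and> subst_code 0 (cVar 0) a b" using * by auto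
qed

lemma num_1: "num (Suc 0) = Succ Zero"
  by (simp add: num_simps)

text \<open>Claiming derivability in every list that contains the coded context absorbs weakening
  and the order and repetition of hypotheses. The substitution, induction and quantifier rules
  constrain each member of a context, so there a list \<open>m\<close> with exactly the coded
  formulas is chosen.\<close>

lemma rga_rule_thm_code:
  assumes "rga_rule ps (\<Gamma>, c)"
    and "\<And>\<Delta> a l. (\<Delta>, a) \<in> set ps \<Longrightarrow> enc ` fset \<Delta> \<subseteq> members l \<Longrightarrow> thm_code (pair l (enc a))"
    and "enc ` fset \<Gamma> \<subseteq> members l"
  shows "thm_code (pair l (enc c))"
  using assms
proof (cases rule: rga_rule.cases)
  case (weaken \<Delta> a)
  then show ?thesis using assms(2)[of \<Delta> c l] assms(3) by auto
next
  case (cut a)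
  then show ?thesis using assms(2)[of \<Gamma> a l] assms(2)[of "finsert a \<Gamma>" c "lcons (enc a) l"] assms(3)
    by (auto intro: thm_code.cut)
next
  case (subst \<Delta> d i s)
  obtain m where m: "members m = enc ` fset \<Delta>" using members_surj[of "enc ` fset \<Delta>"] by auto
  have "thm_code (pair m (enc d))" using assms(2)[of \<Delta> d m] subst m by simp
  moreover have "\<forall>a\<in>members m. \<exists>b. b \<in> members l \<and> subst_code i (enc s) a b"
    unfolding m using assms(3) subst(2) subst_code_enc by fastforce
  ultimately show ?thesis using thm_code.subst[OF _ subst_code_enc] subst(3) by blast
next
  case (OrE a b)
  then show ?thesis using assms(2)[of \<Gamma> "Or a b" l] assms(2)[of "finsert a \<Gamma>" c "lcons (enc a) l"]
      assms(2)[of "finsert b \<Gamma>" c "lcons (enc b) l"] assms(3)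
    by (auto intro!: thm_code.OrE[of l "enc a" "enc b"])
next
  case (induction i d a)
  obtain m where m: "members m = enc ` fset \<Gamma>" using members_surj[of "enc ` fset \<Gamma>"] by auto
  have "thm_code (pair m (enc (Defs.subst i a d)))"
  proof (rule thm_code.induction[where i = i and c = "enc d" and a = "enc a"])
    show "thm_code (pair m (enc (Defs.subst i Zero d)))"
      using assms(2)[of \<Gamma> "Defs.subst i Zero d" m] induction(1) m by simp
    show "thm_code (pair (lcons (cisN (cVar i)) (lcons (enc d) m)) (enc (Defs.subst i (Succ (Var i)) d)))"
      using assms(2)[of "finsert (isN (Var i)) (finsert d \<Gamma>)" "Defs.subst i (Succ (Var i)) d"
          "lcons (cisN (cVar i)) (lcons (enc d) m)"] induction(1) m by auto
    show "thm_code (pair m (cisN (enc a)))"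
      using assms(2)[of \<Gamma> "isN a" m] induction(1) m by simp
    show "subst_code i cZero (enc d) (enc (Defs.subst i Zero d))"
      using subst_code_enc[of i Zero d] by simp
    show "subst_code i (cSucc (cVar i)) (enc d) (enc (Defs.subst i (Succ (Var i)) d))"
      using subst_code_enc[of i "Succ (Var i)" d] by simp
    show "subst_code i (enc a) (enc d) (enc (Defs.subst i a d))" by (rule subst_code_enc)
    have "subst_code i cZero (enc t) (enc t)" if "t |\<in>| \<Gamma>" for t
      using subst_code_enc[of i Zero t] induction(3) that by (simp add: subst_fresh)
    then show "\<forall>b\<in>members m. subst_code i cZero b b" unfolding m by auto
  qed
  then show ?thesis using thm_code_weaken[OF _ m] assms(3) m induction(2) by simp
next
  case (ForallI f)
  obtain m where m: "members m = enc ` fset (finsert (isN (Var 0)) (\<up> |`| \<Gamma>))"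
    using members_surj[of "enc ` fset (finsert (isN (Var 0)) (\<up> |`| \<Gamma>))"] by auto
  have "thm_code (pair m (cApp (enc (\<up> f)) (cVar 0)))"
    using assms(2)[of _ _ m] ForallI(1) m by fastforce
  moreover have "\<forall>b\<in>members m. b = cisN (cVar 0) \<or>
      (\<exists>a. a \<in> members l \<and> lift_code (pair 0 (pair a b)))"
    unfolding m using assms(3) lift_code_enc by fastforce
  ultimately show ?thesis using thm_code.ForallI[OF _ lift_code_enc] ForallI(2) by simp
next
  case (NegForallE f)
  let ?\<Delta> = "finsert (isN (Var 0)) (finsert (Neg (\<up> f \<cdot> Var 0)) (\<up> |`| \<Gamma>))"
  obtain m where m: "members m = enc ` fset ?\<Delta>" using members_surj[of "enc ` fset ?\<Delta>"] by auto
  have "thm_code (pair m (enc (\<up> c)))" using assms(2)[of ?\<Delta> "\<up> c" m] NegForallE m by simp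
  moreover have "thm_code (pair l (cNeg (cApp cForall (enc f))))"
    using assms(2)[of \<Gamma> "Neg (Forall \<cdot> f)" l] NegForallE assms(3) by simp
  moreover have "\<forall>b\<in>members m. b = cisN (cVar 0) \<or> b = cNeg (cApp (enc (\<up> f)) (cVar 0)) \<or>
      (\<exists>a. a \<in> members l \<and> lift_code (pair 0 (pair a b)))"
    unfolding m using assms(3) lift_code_enc by fastforce
  ultimately show ?thesis using thm_code.NegForallE[OF _ _ lift_code_enc lift_code_enc] by blast
next
  case (eq_subst a b i p)
  then have "thm_code (pair l (cEq (enc a) (enc b)))" "thm_code (pair l (enc (Defs.subst i a p)))"
    using assms(2)[of \<Gamma> "a \<doteq> b" l] assms(2)[of \<Gamma> "Defs.subst i a p" l] assms(3) by simp_all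
  then show ?thesis unfolding eq_subst(2)
    by (rule thm_code.infer[OF infer.eq_subst[OF subst_code_enc subst_code_enc]])
next
  case (explode a)
  then show ?thesis using assms(2)[of \<Gamma> "Neg a" l] assms(2)[of \<Gamma> a l] assms(3)
    by (auto intro: thm_code.infer[OF infer.explode])
next
  case (NegOrI a b)
  then show ?thesis using assms(2)[of \<Gamma> "Neg a" l] assms(2)[of \<Gamma> "Neg b" l] assms(3)
    by (auto intro: thm_code.infer[OF infer.NegOrI])
next
  case (eq_isB a b)
  then show ?thesis using assms(2)[of \<Gamma> "isN a" l] assms(2)[of \<Gamma> "isN b" l] assms(3)
    by (auto intro: thm_code.infer[OF infer.eq_isB])
next
  case (rec_eq m h g)
  then have "thm_code (pair l (enc (isN m)))"
    "thm_code (pair l (enc (isN (h \<cdot> m \<cdot> (Rec \<cdot> g \<cdot> h \<cdot> m)))))"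
    using assms(2)[of \<Gamma> "isN m" l] assms(2)[of \<Gamma> "isN (h \<cdot> m \<cdot> (Rec \<cdot> g \<cdot> h \<cdot> m))" l] assms(3)
    by simp_all
  then show ?thesis unfolding rec_eq(2) using thm_code.infer[OF infer.rec_eq] by simp
next
  case (ForallE f a)
  then show ?thesis using assms(2)[of \<Gamma> "Forall \<cdot> f" l] assms(2)[of \<Gamma> "isN a" l] assms(3)
    by (auto intro: thm_code.infer[OF infer.ForallE])
next
  case (NegForallI f a)
  then show ?thesis using assms(2)[of \<Gamma> "Neg (f \<cdot> a)" l] assms(2)[of \<Gamma> "isN a" l] assms(3)
    by (auto intro: thm_code.infer[OF infer.NegForallI])
next
  case (true_eq_one a)
  then show ?thesis using assms(2)[of \<Gamma> a l] assms(3) thm_code_infer1[OF _ infer.true_eq_one]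
    by (simp add: num_1)
next
  case eq_one_true
  then show ?thesis using assms(2)[of \<Gamma> "c \<doteq> num 1" l] assms(3)
      thm_code_infer1[OF _ infer.eq_one_true] by (simp add: num_1)
next
  case (hyp \<Delta>)
  then show ?thesis using assms(3) by (auto intro: thm_code.hyp)
next
  case Zero_isN
  then show ?thesis by (auto intro: thm_code.Zero_isN)
next
  case (expand c')
  then show ?thesis using assms(2)[of \<Gamma> c' l] assms(3)
    by (auto intro: thm_code_infer1 head_code_enc infer.expand)
next
  case (reduce d)
  then show ?thesis using assms(2)[of \<Gamma> d l] assms(3)
    by (auto intro: thm_code_infer1 head_code_enc infer.reduce)
next
  case (Neg_reduce d d')
  then show ?thesis using assms(2)[of \<Gamma> "Neg d" l] assms(3)
    by (auto intro: thm_code_infer1 head_code_enc infer.Neg_reduce)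
next
  case (step_eq d d')
  then show ?thesis using assms(2)[of \<Gamma> "isN d'" l] assms(3)
    by (auto intro: thm_code_infer1 head_code_enc infer.step_eq)
next
  case Bot_isN
  then show ?thesis using assms(2)[of \<Gamma> "isN Bot" l] assms(3)
    by (auto intro: thm_code_infer1 infer.Bot_isN)
next
  case (false_eq_zero a)
  then show ?thesis using assms(2)[of \<Gamma> "Neg a" l] assms(3)
    by (auto simp: num_simps intro: thm_code_infer1 infer.false_eq_zero)
next
  case (eq_zero_false a)
  then show ?thesis using assms(2)[of \<Gamma> "a \<doteq> num 0" l] assms(3)
    by (auto simp: num_simps intro: thm_code_infer1 infer.eq_zero_false)
next
  case (NegNegI a)
  then show ?thesis using assms(2)[of \<Gamma> "a" l] assms(3)
    by (auto simp: num_simps intro: thm_code_infer1 infer.NegNegI)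
next
  case NegNegE
  then show ?thesis using assms(2)[of \<Gamma> "Neg (Neg c)" l] assms(3)
    by (auto simp: num_simps intro: thm_code_infer1 infer.NegNegE)
next
  case (OrI1 a b)
  then show ?thesis using assms(2)[of \<Gamma> "a" l] assms(3)
    by (auto simp: num_simps intro: thm_code_infer1 infer.OrI1)
next
  case (OrI2 b a)
  then show ?thesis using assms(2)[of \<Gamma> "b" l] assms(3)
    by (auto simp: num_simps intro: thm_code_infer1 infer.OrI2)
next
  case (NegOrE1 a b)
  then show ?thesis using assms(2)[of \<Gamma> "Neg (Or a b)" l] assms(3)
    by (auto simp: num_simps intro: thm_code_infer1 infer.NegOrE1)
next
  case (NegOrE2 a b)
  then show ?thesis using assms(2)[of \<Gamma> "Neg (Or a b)" l] assms(3)
    by (auto simp: num_simps intro: thm_code_infer1 infer.NegOrE2)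
next
  case (eq_sym a b)
  then show ?thesis using assms(2)[of \<Gamma> "a \<doteq> b" l] assms(3)
    by (auto simp: num_simps intro: thm_code_infer1 infer.eq_sym)
next
  case (neq_sym a b)
  then show ?thesis using assms(2)[of \<Gamma> "Neg (a \<doteq> b)" l] assms(3)
    by (auto simp: num_simps intro: thm_code_infer1 infer.neq_sym)
next
  case (eq_isB_isN a b)
  then show ?thesis using assms(2)[of \<Gamma> "isB (a \<doteq> b)" l] assms(3)
    by (auto simp: num_simps intro: thm_code_infer1 infer.eq_isB_isN)
next
  case (Succ_isN a)
  then show ?thesis using assms(2)[of \<Gamma> "isN a" l] assms(3)
    by (auto simp: num_simps intro: thm_code_infer1 infer.Succ_isN)
next
  case (isN_Succ a)
  then show ?thesis using assms(2)[of \<Gamma> "isN (Succ a)" l] assms(3)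
    by (auto simp: num_simps intro: thm_code_infer1 infer.isN_Succ)
next
  case (Succ_neq_Zero a)
  then show ?thesis using assms(2)[of \<Gamma> "isN a" l] assms(3)
    by (auto simp: num_simps intro: thm_code_infer1 infer.Succ_neq_Zero)
next
  case (Succ_neqI a b)
  then show ?thesis using assms(2)[of \<Gamma> "Neg (a \<doteq> b)" l] assms(3)
    by (auto simp: num_simps intro: thm_code_infer1 infer.Succ_neqI)
next
  case (Succ_neqE a b)
  then show ?thesis using assms(2)[of \<Gamma> "Neg (Succ a \<doteq> Succ b)" l] assms(3)
    by (auto simp: num_simps intro: thm_code_infer1 infer.Succ_neqE)
next
  case (Succ_eqE a b)
  then show ?thesis using assms(2)[of \<Gamma> "Succ a \<doteq> Succ b" l] assms(3)
    by (auto simp: num_simps intro: thm_code_infer1 infer.Succ_eqE)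
qed

lemma oga_thm_code:
  assumes "oga_derivable j" "enc ` fset (fst j) \<subseteq> members l"
  shows "thm_code (pair l (enc (snd j)))"
  using assms
proof (induction arbitrary: l rule: oga_derivable_induct)
  case (step ps j)
  from step(1) show ?case
  proof (cases rule: oga_rule.cases)
    case rga
    obtain \<Gamma> c where j: "j = (\<Gamma>, c)" by (cases j)
    show ?thesis unfolding j snd_conv
      by (rule rga_rule_thm_code[OF rga[unfolded j]]) (use step(2,3) j in fastforce)+
  next
    case (ATI \<Gamma> u)
    have "thm_code (pair l (enc (Forall \<cdot> Lam (isB (\<up> u \<cdot> Var 0)))))"
      using step(2)[of "(\<Gamma>, Forall \<cdot> Lam (isB (\<up> u \<cdot> Var 0)))" l] step(3) ATI by simp
    then show ?thesis using thm_code_infer1[OF _ infer.ATI[OF lift_code_enc]] ATI(2) by simp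
  qed
qed

lemma provable_thm_code: "provable t \<Longrightarrow> thm_code (pair lnil (enc t))"
  using oga_thm_code[of "({||}, t)" lnil] by (simp add: provable_def)

lemma thm_code_true: "thm_code (pair lnil (enc t)) \<Longrightarrow> ev (psub \<sigma> t) [] (Suc 0)"
  using thm_code_sound[of "pair lnil (enc t)" \<sigma>] by (simp add: sat_def)

lemma provable_true: "provable t \<Longrightarrow> ev t [] (Suc 0)"
  using thm_code_true[OF provable_thm_code, of t Var] by simp


section \<open>Diagonalization\<close>

definition pr_const_code :: "nat \<Rightarrow> nat" where
  "pr_const_code x = rec_nat (cLam (cLam cZero))
    (\<lambda>m r. cLam (cLam (cApp (cLam (cSucc (cVar 0))) (cApp (cApp r (cVar 1)) (cVar 0))))) x"

text \<open>The definition enters only through the code \<open>c\<close> of its compiled term, so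
  the diagonal argument gets by without a coding of \<open>prdef\<close>.\<close>

definition claim_code :: "nat \<Rightarrow> nat \<Rightarrow> nat" where
  "claim_code c x = cApp cForall (cLam (cNeg (cApp cForall (cLam (cEq (cApp (cApp
    (cLam (cLam (cApp (cApp c (cApp (cApp (pr_const_code x) (cVar 1)) (cVar 0)))
      (cApp (cApp (enc (cmp (PProj 2 0))) (cVar 1)) (cVar 0)))))
    (cVar 1)) (cVar 0)) cZero)))))"

lemma args_2: "args 0 2 = [Var 1, Var 0]"
  by (simp add: args_def numeral_2_eq_2)

lemma lams_2: "lams 2 t = Lam (Lam t)"
  by (simp add: numeral_2_eq_2)

lemma pr_const_code: "enc (cmp (pr_const 2 x)) = pr_const_code x"
  by (induction x) (simp_all add: pr_const_code_def args_2 lams_2)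

lemma claim_code: "enc (totality_claim (diag_step T x)) = claim_code (enc (cmp T)) x"
  unfolding totality_claim_def rrep_def diag_step_def claim_code_def pr_const_code[symmetric]
  \<comment> \<open>The projection stays folded, matching the constant
    \<open>enc (cmp (PProj 2 0))\<close> in \<open>claim_code\<close>.\<close>
  by (simp add: args_2 lams_2 del: cmp.simps(3))

lemma PR_claim_code: "PR f \<Longrightarrow> PR g \<Longrightarrow> PR (\<lambda>x. claim_code (f x) (g x))"
  unfolding claim_code_def pr_const_code_def by (intro PR_intros PR_rec; assumption)

lemma not_refutable:
  assumes "ev t [] (Suc 0)"
  shows "\<not> refutable t"
  using provable_true[of "Neg t"] ev_det[OF assms, of 0] by (auto simp: refutable_def)

text \<open>The common core of both parts. The third assumption is the self-reference: the value 0
  is reached at \<open>x\<close> exactly if the claim about \<open>x\<close> is a coded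
  theorem.\<close>

lemma diag_fiction:
  assumes "pr_wf D" "pr_arity D = 2"
    and "(\<forall>n. pr_eval D [x, n] \<noteq> 0) \<longleftrightarrow> \<not> thm_code (pair lnil (claim_code (enc (cmp D)) x))"
  shows "\<forall>n. pr_eval D [x, n] \<noteq> 0" "genuine_fiction (totality_claim (diag_step D x))"
    "has_pedigree (totality_claim (diag_step D x)) {totality_claim (diag_step D x)}"
proof -
  let ?G = "totality_claim (diag_step D x)"
  have ev: "ev ?G [] (of_bool (\<forall>n. pr_eval D [x, n] \<noteq> 0))"
    using assms by (intro ev_totality_claim_diag)
  have no_thm: "\<not> thm_code (pair lnil (enc ?G))"
  proof
    assume *: "thm_code (pair lnil (enc ?G))"
    then have "ev ?G [] (Suc 0)" using thm_code_true[of ?G Var] by simp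
    then have "of_bool (\<forall>n. pr_eval D [x, n] \<noteq> 0) = (1 :: nat)" using ev_det[OF ev] by simp
    then have "\<forall>n. pr_eval D [x, n] \<noteq> 0" unfolding of_bool_eq_1_iff .
    then show False using * assms(3) unfolding claim_code by simp
  qed
  then show true: "\<forall>n. pr_eval D [x, n] \<noteq> 0" using assms(3) unfolding claim_code by simp
  have "\<not> provable ?G" using no_thm provable_thm_code by blast
  moreover have "\<not> refutable ?G" using ev true by (intro not_refutable) simp
  ultimately show "genuine_fiction ?G" "has_pedigree ?G {?G}"
    using genuine_fiction_totality_claim[OF pr_wf_diag_step[OF assms(1,2)]] by blast+
qed

theorem theorem6p6:
  shows "(\<forall>(\<phi> :: nat \<Rightarrow> nat \<Rightarrow> nat option) (halts :: nat \<Rightarrow> nat \<Rightarrow> nat \<Rightarrow> bool) (D :: prdef).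
            standard_enumeration \<phi> \<and> pr_step_predicate \<phi> halts \<and> presents_d halts D \<longrightarrow>
            (\<exists>x. diagonal_instance \<phi> x \<and>
                 genuine_fiction (totality_claim (diag_step D x)) \<and>
                 has_pedigree (totality_claim (diag_step D x)) {totality_claim (diag_step D x)}))
       \<and> (\<exists>f. step_function f \<and> genuine_fiction (totality_claim f))"
proof (intro conjI allI impI)
  fix \<phi> :: "nat \<Rightarrow> nat \<Rightarrow> nat option" and halts D
  assume "standard_enumeration \<phi> \<and> pr_step_predicate \<phi> halts \<and> presents_d halts D"
  then have \<phi>: "range \<phi> = {\<psi>. partrec1 \<psi>}"
    and halts: "\<And>x y. \<phi> x y \<noteq> None \<longleftrightarrow> (\<exists>n. halts x y n)"
    and D: "pr_wf D" "pr_arity D = 2" "\<And>x n. pr_eval D [x, n] = (if halts x x n then 0 else 1)"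
    by (simp_all add: standard_enumeration_def pr_step_predicate_def presents_d_def)
  have "RE (\<lambda>x. thm_code (pair lnil (claim_code (enc (cmp D)) x)))"
    by (intro RE_comp[OF RE_thm_code] PR_intros PR_claim_code)
  then obtain \<chi> where \<chi>: "partrec1 \<chi>"
    "\<And>x. \<chi> x \<noteq> None \<longleftrightarrow> thm_code (pair lnil (claim_code (enc (cmp D)) x))"
    using RE_partrec1 by blast
  then obtain e where "\<phi> e = \<chi>" using \<phi> by (metis mem_Collect_eq rangeE)
  then have "(\<forall>n. pr_eval D [e, n] \<noteq> 0) \<longleftrightarrow> \<not> thm_code (pair lnil (claim_code (enc (cmp D)) e))"
    using \<chi>(2)[of e] halts[of e e] D(3) by auto
  note F = diag_fiction[OF D(1,2) this]
  have "diagonal_instance \<phi> e"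
    using F(1) halts[of e e] D(3) by (auto simp: diagonal_instance_def split: if_splits)
  then show "\<exists>x. diagonal_instance \<phi> x \<and> genuine_fiction (totality_claim (diag_step D x)) \<and>
      has_pedigree (totality_claim (diag_step D x)) {totality_claim (diag_step D x)}"
    using F(2,3) by blast
next
  have "RE (\<lambda>x. thm_code (pair lnil (claim_code x x)))"
    by (intro RE_comp[OF RE_thm_code] PR_intros PR_claim_code)
  then obtain T where T: "pr_wf T" "pr_arity T = 2"
    "\<And>x. thm_code (pair lnil (claim_code x x)) \<longleftrightarrow> (\<exists>n. pr_eval T [x, n] = 0)"
    using RE_step by blast
  \<comment> \<open>\<open>T\<close> is fixed before its own code is known. Taking that code as
    input makes the two arguments of \<open>claim_code\<close> coincide, which replaces an appeal to
    the recursion theorem.\<close>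
  then have "genuine_fiction (totality_claim (diag_step T (enc (cmp T))))"
    by (intro diag_fiction(2)) simp_all
  then show "\<exists>f. step_function f \<and> genuine_fiction (totality_claim f)"
    using pr_wf_diag_step[OF T(1,2)] by blast
qed

end
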